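(* There is an algorithm that, given a connected undirected simple graph $G=(V,E)$ with $n=|V|$ and $m=|E|$ and a positive integer $k$, enumerates (outputs each exactly once) all $k$-graphlets of $G$ in $O(n+m+k^2\cdot N)$ total time and $O(n+m)$ space, where $N$ is the number of $k$-graphlets of $G$.
   Context: A $k$-graphlet of $G$ is a connected subgraph of $G$ induced by a set of exactly $k$ vertices; a $k$-graphlet is output by listing its vertex set. The graph is given in adjacency-list form (standard RAM model), supporting iteration over the neighbours of a vertex $v$ in $O(\deg(v))$ time and insertion/deletion of an edge in $O(1)$ time. *)

theory Defs
  imports "Graph_Theory.Digraph_Component"
begin

definition uedges :: "'a pair_pre_digraph \<Rightarrow> 'a set set" where
  "uedges G = {{u, v} | u v. (u, v) \<in> parcs G}"

definition graphlets :: "('a, 'b) pre_digraph \<Rightarrow> nat \<Rightarrow> ('a, 'b) pre_digraph set" where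
  "graphlets G k =
     {H. induced_subgraph H G \<and> Digraph_Component.connected H \<and> card (verts H) = k}"

text \<open>
  Unit-cost random access machine. A program is a finite list of instructions. It has finitely
  many registers of its own (those that its instructions name) and indirect access to a memory
  of \<open>S\<close> words, at the addresses \<open>0, \<dots>, S - 1\<close>; every word and every register holds a natural
  number that is at most \<open>B\<close>. A step that would leave these limits is not possible, so a run
  that reaches \<open>HALT\<close> is a run in space \<open>S\<close> with words of about \<open>log B\<close> bits. The bound \<open>B\<close>
  excludes packing much data into a single huge number. The output is write-only and does not
  count as space; printing one word takes one step.
\<close>

datatype instr =
    LOADI nat nat
  | ADD nat nat nat
  | SUB nat nat nat
  | LOAD nat nat
  | STORE nat nat
  | JZ nat nat
  | PRINT nat
  | HALT

record ram =
  pc :: nat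
  regs :: "nat \<Rightarrow> nat"
  mem :: "nat \<Rightarrow> nat"
  out :: "nat list"

definition set_reg :: "nat \<Rightarrow> nat \<Rightarrow> nat \<Rightarrow> ram \<Rightarrow> ram option" where
  "set_reg B i x s =
     (if x \<le> B then Some (s\<lparr>pc := pc s + 1, regs := (regs s)(i := x)\<rparr>) else None)"

text \<open>Subtraction is the truncated subtraction on \<open>nat\<close>.\<close>

fun exec :: "nat \<Rightarrow> nat \<Rightarrow> instr \<Rightarrow> ram \<Rightarrow> ram option" where
  "exec S B (LOADI i c) s = set_reg B i c s"
| "exec S B (ADD i j l) s = set_reg B i (regs s j + regs s l) s"
| "exec S B (SUB i j l) s = set_reg B i (regs s j - regs s l) s"
| "exec S B (LOAD i j) s =
     (if regs s j < S then set_reg B i (mem s (regs s j)) s else None)"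
| "exec S B (STORE i j) s =
     (if regs s i < S
      then Some (s\<lparr>pc := pc s + 1, mem := (mem s)(regs s i := regs s j)\<rparr>) else None)"
| "exec S B (JZ i l) s = Some (s\<lparr>pc := (if regs s i = 0 then l else pc s + 1)\<rparr>)"
| "exec S B (PRINT i) s = Some (s\<lparr>pc := pc s + 1, out := out s @ [regs s i]\<rparr>)"
| "exec S B HALT s = None"

definition ram_step :: "nat \<Rightarrow> nat \<Rightarrow> instr list \<Rightarrow> ram \<Rightarrow> ram \<Rightarrow> bool" where
  "ram_step S B P s s' \<longleftrightarrow> pc s < length P \<and> exec S B (P ! pc s) s = Some s'"

definition halted :: "instr list \<Rightarrow> ram \<Rightarrow> bool" where
  "halted P s \<longleftrightarrow> pc s < length P \<and> P ! pc s = HALT"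

definition initial :: "(nat \<Rightarrow> nat) \<Rightarrow> ram" where
  "initial M = \<lparr>pc = 0, regs = (\<lambda>_. 0), mem = M, out = []\<rparr>"

text \<open>
  Memory contents that represent a graph on the vertices \<open>0, \<dots>, n - 1\<close> by doubly linked adjacency
  lists, together with \<open>k\<close>. Words 0, 1, 2 hold \<open>n\<close>, \<open>m\<close>, \<open>k\<close>, and word \<open>3 + v\<close> points to the first
  list node of vertex \<open>v\<close>. Each edge has one list node for each of its two directions. The node of
  \<open>(v, w)\<close> consists of four words: \<open>w\<close>, the next and the previous node in the list of \<open>v\<close>, and the
  node of \<open>(w, v)\<close>; so a node, and with it an edge, can be unlinked and relinked in constant time.
  The null pointer is 0. The order of each list (\<open>adj\<close>) and the placement of the nodes in the block
  behind the list heads (\<open>addr\<close>) are arbitrary. The remaining memory is 0.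
\<close>

definition adjacency_list_input :: "nat pair_pre_digraph \<Rightarrow> nat \<Rightarrow> (nat \<Rightarrow> nat) \<Rightarrow> bool" where
  "adjacency_list_input G k M \<longleftrightarrow>
     (let n = card (pverts G); m = card (uedges G) in
      M 0 = n \<and> M 1 = m \<and> M 2 = k \<and>
      (\<exists>(adj :: nat \<Rightarrow> nat list) (addr :: nat \<times> nat \<Rightarrow> nat).
         bij_betw addr (parcs G) {3 + n + 4 * i | i. i < 2 * m} \<and>
         (\<forall>v \<in> pverts G.
            distinct (adj v) \<and> set (adj v) = {w. (v, w) \<in> parcs G} \<and>
            M (3 + v) = (if adj v = [] then 0 else addr (v, adj v ! 0)) \<and>
            (\<forall>i < length (adj v).
               let p = addr (v, adj v ! i) in
               M p = adj v ! i \<and>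
               M (p + 1) = (if i + 1 < length (adj v) then addr (v, adj v ! (i + 1)) else 0) \<and>
               M (p + 2) = (if i > 0 then addr (v, adj v ! (i - 1)) else 0) \<and>
               M (p + 3) = addr (adj v ! i, v)))) \<and>
      (\<forall>a \<ge> 3 + n + 8 * m. M a = 0))"

text \<open>
  The printed words are vertex lists of graphlets, one after the other. No separator is needed, as
  each of them has length \<open>k\<close>.
\<close>

definition lists_graphlets :: "(nat, 'b) pre_digraph \<Rightarrow> nat \<Rightarrow> nat list \<Rightarrow> bool" where
  "lists_graphlets G k ys \<longleftrightarrow>
     (\<exists>xss. ys = concat xss \<and> (\<forall>xs \<in> set xss. distinct xs) \<and>
            distinct (map set xss) \<and> set (map set xss) = verts ` graphlets G k)"

end

theory Submission
  imports Defs
begin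

text \<open>
  Idea. Order the vertices by breadth-first search, so that every prefix is connected, and take them
  as roots from the last to the first, deleting each root when it is done. For a root, binary
  partition lists the connected \<open>k\<close>-sets \<open>X\<close> with \<open>T \<subseteq> X \<subseteq> A\<close>, where \<open>T\<close> is connected and \<open>A\<close> is the
  set of vertices not yet deleted, always under the invariant that there is such an \<open>X\<close>.

  At a node \<open>(T, A)\<close> run a search from \<open>T\<close> that holds back the first vertex \<open>v\<close> it discovers. If it finds
  \<open>k\<close> vertices without \<open>v\<close>, then both \<open>(T \<union> {v}, A)\<close> and \<open>(T, A - {v})\<close> have solutions, and we branch. If
  it gets stuck before, then \<open>v\<close> separates the fewer than \<open>k\<close> vertices found from the rest and lies in
  every solution; \<open>v\<close> is added to \<open>T\<close> and the same search continues behind \<open>v\<close>, holding back its first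
  discovery. So a whole chain of forced vertices costs one search. A search visits at most \<open>k + 1\<close>
  vertices and, as deleted vertices are unlinked from all lists, takes \<open>O(k\<^sup>2)\<close> steps; these are paid
  by the branchings and leaves, of which there are at most \<open>2 N - 1\<close>.

  The deletion of \<open>v\<close> takes \<open>O(deg v)\<close> steps. If \<open>T \<union> {v}\<close> has fewer than \<open>k\<close> elements, each of the
  neighbours of \<open>v\<close> outside \<open>T\<close> is in one of the \<open>N\<^sub>1\<close> solutions that contain \<open>T \<union> {v}\<close>, so
  \<open>deg v \<le> k + k N\<^sub>1\<close>. This charges \<open>O(k)\<close> to each of these solutions, at most once for each of the
  \<open>k\<close> possible sizes of \<open>T\<close>. Sets \<open>T\<close> with \<open>k - 1\<close> elements are not branched on: there, all sets
  \<open>T \<union> {w}\<close> with \<open>w\<close> adjacent to \<open>T\<close> are printed at once.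
\<close>

section \<open>Structured programs for the random access machine\<close>

text \<open>The machine has no recursion and only linear space, so one loop with an explicit trail
  traverses the tree. Its correctness is still an induction over the tree, in continuation form: if
  the rest of the loop is right from every state in which a node has been finished, then it is right
  from the state in which the node is entered. For the state to reappear after a subtree,
  backtracking must restore the graph word by word, not just up to the order of the lists. An
  unlinked list node keeps its own pointers, and deletions are undone in reverse order, so each
  restoration finds exactly the memory that its deletion left behind. The bound
  \<open>2 N - 1\<close> rests on the invariant that every node has a solution: the leaves have
  disjoint nonempty sets of solutions, so there are at most \<open>N\<close> of them, and a binary
  tree has one branching less than leaves. Time is a counter carried by the weakest preconditions.
  Every loop has a potential that proves termination and pays for the steps at once; the constants
  in the time bounds are generous and have no deeper meaning.\<close>

datatype com =
    Skip
  | Ins instr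
  | Seq com com (infixr \<open>;;\<close> 60)
  | Cond nat com com
  | Loop nat com

fun clen :: "com \<Rightarrow> nat" where
  "clen Skip = 0"
| "clen (Ins i) = 1"
| "clen (c1 ;; c2) = clen c1 + clen c2"
| "clen (Cond r c1 c2) = clen c1 + clen c2 + 2"
| "clen (Loop r c) = clen c + 2"

text \<open>Register 0 is never a target of a verified instruction and so stays 0; hence
  \<open>JZ 0 l\<close> serves as unconditional jump. Jump targets are absolute, which is why the
  start address \<open>a\<close> is a parameter.\<close>

fun compile :: "nat \<Rightarrow> com \<Rightarrow> instr list" where
  "compile a Skip = []"
| "compile a (Ins i) = [i]"
| "compile a (c1 ;; c2) = compile a c1 @ compile (a + clen c1) c2"
| "compile a (Cond r c1 c2) =
     JZ r (a + clen c1 + 2) # compile (a + 1) c1 @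
     JZ 0 (a + clen c1 + clen c2 + 2) # compile (a + clen c1 + 2) c2"
| "compile a (Loop r c) = JZ r (a + clen c + 2) # compile (a + 1) c @ [JZ 0 a]"

lemma length_compile [simp]: "length (compile a c) = clen c"
  by (induction c arbitrary: a) auto

section \<open>Weakest preconditions over registers, memory, output and number of steps\<close>

type_synonym post = "(nat \<Rightarrow> nat) \<Rightarrow> (nat \<Rightarrow> nat) \<Rightarrow> nat list \<Rightarrow> nat \<Rightarrow> bool"

definition code_at :: "instr list \<Rightarrow> nat \<Rightarrow> instr list \<Rightarrow> bool" where
  "code_at P a is \<longleftrightarrow> (\<exists>xs ys. P = xs @ is @ ys \<and> length xs = a)"

lemma code_at_Cons:
  "code_at P a (i # is) \<Longrightarrow> a < length P \<and> P ! a = i \<and> code_at P (a + 1) is"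
  unfolding code_at_def by (force simp: nth_append intro: exI[of _ "_ @ [_]"])

lemma code_at_append:
  "code_at P a (is @ js) \<Longrightarrow> code_at P a is \<and> code_at P (a + length is) js"
  unfolding code_at_def
  by (metis append.assoc length_append)

locale machine =
  fixes S B :: nat
begin

text \<open>The limits \<open>S\<close> and \<open>B\<close> are part of the preconditions, so a
  verified program never gets stuck. \<open>JZ\<close> and \<open>HALT\<close> are refused: control
  flow comes from \<open>Cond\<close> and \<open>Loop\<close> alone. The condition
  \<open>i \<noteq> 0\<close> protects the zero register.\<close>

fun wp_instr :: "instr \<Rightarrow> post \<Rightarrow> post" where
  "wp_instr (LOADI i c) Q R M Z t \<longleftrightarrow> i \<noteq> 0 \<and> c \<le> B \<and> Q (R(i := c)) M Z (t + 1)"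
| "wp_instr (ADD i j l) Q R M Z t \<longleftrightarrow> i \<noteq> 0 \<and> R j + R l \<le> B \<and> Q (R(i := R j + R l)) M Z (t + 1)"
| "wp_instr (SUB i j l) Q R M Z t \<longleftrightarrow> i \<noteq> 0 \<and> R j - R l \<le> B \<and> Q (R(i := R j - R l)) M Z (t + 1)"
| "wp_instr (LOAD i j) Q R M Z t \<longleftrightarrow>
     i \<noteq> 0 \<and> R j < S \<and> M (R j) \<le> B \<and> Q (R(i := M (R j))) M Z (t + 1)"
| "wp_instr (STORE i j) Q R M Z t \<longleftrightarrow> R i < S \<and> Q R (M(R i := R j)) Z (t + 1)"
| "wp_instr (PRINT i) Q R M Z t \<longleftrightarrow> Q R M (Z @ [R i]) (t + 1)"
| "wp_instr (JZ i l) Q R M Z t \<longleftrightarrow> False"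
| "wp_instr HALT Q R M Z t \<longleftrightarrow> False"

text \<open>The weakest precondition for termination in \<open>Q\<close>; the last argument is a step counter.\<close>

primrec wp :: "com \<Rightarrow> post \<Rightarrow> post" where
  "wp Skip Q = Q"
| "wp (Ins i) Q = wp_instr i Q"
| "wp (c1 ;; c2) Q = wp c1 (wp c2 Q)"
| "wp (Cond r c1 c2) Q = (\<lambda>R M Z t.
     if R r \<noteq> 0 then wp c1 (\<lambda>R M Z t. Q R M Z (t + 1)) R M Z (t + 1) else wp c2 Q R M Z (t + 1))"
| "wp (Loop r c) Q = lfp (\<lambda>X R M Z t.
     if R r \<noteq> 0 then wp c (\<lambda>R M Z t. X R M Z (t + 1)) R M Z (t + 1) else Q R M Z (t + 1))"

lemma wp_instr_mono:
  "(\<And>R M Z t. Q R M Z t \<Longrightarrow> Q' R M Z t) \<Longrightarrow> wp_instr i Q R M Z t \<Longrightarrow> wp_instr i Q' R M Z t"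
  by (cases i) auto

lemma wp_mono:
  assumes "wp c Q R M Z t" "\<And>R M Z t. Q R M Z t \<Longrightarrow> Q' R M Z t"
  shows "wp c Q' R M Z t"
  using assms
proof (induction c arbitrary: Q Q' R M Z t)
  case (Ins i)
  then show ?case using wp_instr_mono[of Q Q' i R M Z t] by simp
next
  case (Cond r c1 c2)
  have "wp c1 (\<lambda>R M Z t. Q' R M Z (t + 1)) R M Z (t + 1)"
    if "wp c1 (\<lambda>R M Z t. Q R M Z (t + 1)) R M Z (t + 1)"
    using that by (rule Cond.IH(1)) (rule Cond.prems)
  then show ?case using Cond by (simp split: if_splits)
next
  case (Loop r c)
  have "wp (Loop r c) Q \<le> wp (Loop r c) Q'"
    unfolding wp.simps by (rule lfp_mono) (auto simp: le_fun_def intro: Loop.prems(2))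
  then show ?case using Loop.prems(1) by (auto simp: le_fun_def)
next
  case (Seq c1 c2)
  show ?case
    using Seq.prems Seq.IH(1)[of "wp c2 Q" R M Z t "wp c2 Q'"] Seq.IH(2)[of Q _ _ _ _ Q'] by simp
qed simp

text \<open>Monotonicity of \<open>wp\<close> makes the fixed point equation available. As the fixed
  point is the least one, it includes termination.\<close>

lemma wp_Loop_unfold:
  "wp (Loop r c) Q R M Z t \<longleftrightarrow>
     (if R r \<noteq> 0 then wp c (\<lambda>R M Z t. wp (Loop r c) Q R M Z (t + 1)) R M Z (t + 1)
      else Q R M Z (t + 1))"
proof -
  have "mono (\<lambda>X R M Z t.
     if R r \<noteq> 0 then wp c (\<lambda>R M Z t. X R M Z (t + 1)) R M Z (t + 1) else Q R M Z (t + 1))"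
    by (rule monoI) (auto simp: le_fun_def elim!: wp_mono)
  from fun_cong[OF fun_cong[OF fun_cong[OF fun_cong[OF lfp_unfold[OF this]]]]]
  show ?thesis by simp
qed

declare wp.simps(5) [simp del]

text \<open>\<open>g\<close> is a ghost state, such as the part of a list already walked, which no
  register holds. The potential \<open>f\<close> is variant and time budget in one:
  \<open>t + f g\<close> does not grow from round to round. The \<open>2\<close> stands for the loop
  test and the jump back, the \<open>1\<close> in the exit condition for the last test.\<close>

lemma wp_Loop:
  assumes inv: "I g R M Z"
    and step: "\<And>g R M Z t P. I g R M Z \<Longrightarrow> R r \<noteq> 0 \<Longrightarrow>
      (\<And>g' R' M' Z' t'. I g' R' M' Z' \<Longrightarrow> f g' < f g \<Longrightarrow> t' + 2 + f g' \<le> t + f g \<Longrightarrow> P R' M' Z' t') \<Longrightarrow>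
      wp c P R M Z t"
    and exit: "\<And>g' R' M' Z' t'. I g' R' M' Z' \<Longrightarrow> R' r = 0 \<Longrightarrow>
      t' + f g' \<le> t + f g + 1 \<Longrightarrow> Q R' M' Z' t'"
  shows "wp (Loop r c) Q R M Z t"
proof -
  have "wp (Loop r c) Q R' M' Z' t'"
    if "I g' R' M' Z'" "t' + f g' \<le> t + f g" for g' R' M' Z' t'
    using that
  proof (induction "f g'" arbitrary: g' R' M' Z' t' rule: less_induct)
    case less
    show ?case
    proof (cases "R' r = 0")
      case True
      then show ?thesis using exit[OF less.prems(1)] less.prems by (simp add: wp_Loop_unfold)
    next
      case False
      have "wp c (\<lambda>R M Z t. wp (Loop r c) Q R M Z (t + 1)) R' M' Z' (t' + 1)"
        by (rule step[OF less.prems(1) False]) (use less in auto)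
      then show ?thesis using False by (simp add: wp_Loop_unfold)
    qed
  qed
  then show ?thesis using inv by blast
qed

section \<open>Soundness of the weakest preconditions for compiled code\<close>

abbreviation conf :: "nat \<Rightarrow> (nat \<Rightarrow> nat) \<Rightarrow> (nat \<Rightarrow> nat) \<Rightarrow> nat list \<Rightarrow> ram" where
  "conf a R M Z \<equiv> \<lparr>pc = a, regs = R, mem = M, out = Z\<rparr>"

abbreviation runs :: "instr list \<Rightarrow> nat \<Rightarrow> ram \<Rightarrow> ram \<Rightarrow> bool" where
  "runs P u \<equiv> ram_step S B P ^^ u"

lemma runs_trans: "runs P u s s' \<Longrightarrow> runs P u' s' s'' \<Longrightarrow> runs P (u + u') s s''"
  by (auto simp: relpowp_add)

lemma runs_Suc: "ram_step S B P s s' \<Longrightarrow> runs P u s' s'' \<Longrightarrow> runs P (Suc u) s s''"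
  by (rule relpowp_Suc_I2)

lemma runs_snoc: "runs P u s s' \<Longrightarrow> ram_step S B P s' s'' \<Longrightarrow> runs P (Suc u) s s''"
  by (rule relpowp_Suc_I)

lemma wp_instr_sound:
  assumes "code_at P a [i]" "R 0 = 0" "wp_instr i Q R M Z t"
  shows "\<exists>R' M' Z'. ram_step S B P (conf a R M Z) (conf (a + 1) R' M' Z') \<and> R' 0 = 0 \<and>
           Q R' M' Z' (t + 1)"
  using assms code_at_Cons[OF assms(1)]
  by (cases i) (auto simp: ram_step_def set_reg_def)

theorem wp_sound:
  assumes "code_at P a (compile a c)" "R 0 = 0" "wp c Q R M Z t"
  shows "\<exists>u R' M' Z'. runs P u (conf a R M Z) (conf (a + clen c) R' M' Z') \<and> R' 0 = 0 \<and>
           Q R' M' Z' (t + u)"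
  using assms
proof (induction c arbitrary: a Q R M Z t)
  case Skip
  then show ?case by (auto intro!: exI[of _ 0])
next
  case (Ins i)
  then show ?case using wp_instr_sound[of P a i R Q M Z t]
    by (auto intro!: exI[of _ "Suc 0"] simp: relcompp_apply) blast
next
  case (Seq c1 c2)
  note code = code_at_append[OF Seq.prems(1)[unfolded compile.simps]]
  obtain u R1 M1 Z1 where 1: "runs P u (conf a R M Z) (conf (a + clen c1) R1 M1 Z1)" "R1 0 = 0"
    "wp c2 Q R1 M1 Z1 (t + u)"
    using Seq.IH(1)[of a R "wp c2 Q" M Z t] code Seq.prems by auto
  obtain u' R2 M2 Z2 where
    "runs P u' (conf (a + clen c1) R1 M1 Z1) (conf (a + clen c1 + clen c2) R2 M2 Z2)" "R2 0 = 0"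
    "Q R2 M2 Z2 (t + u + u')"
    using Seq.IH(2)[of "a + clen c1", OF _ 1(2,3)] code by auto
  then show ?case using runs_trans[OF 1(1)] by (simp add: add.assoc) blast
next
  case (Cond r c1 c2)
  let ?e = "a + clen c1 + clen c2 + 2"
  have code: "a < length P" "P ! a = JZ r (a + clen c1 + 2)" "code_at P (a + 1) (compile (a + 1) c1)"
    "a + 1 + clen c1 < length P" "P ! (a + 1 + clen c1) = JZ 0 ?e"
    "code_at P (a + clen c1 + 2) (compile (a + clen c1 + 2) c2)"
    using code_at_Cons[OF Cond.prems(1)[unfolded compile.simps]]
    by (auto dest!: code_at_append code_at_Cons simp: algebra_simps)
  show ?case
  proof (cases "R r = 0")
    case True
    have 1: "ram_step S B P (conf a R M Z) (conf (a + clen c1 + 2) R M Z)"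
      using code True by (simp add: ram_step_def)
    obtain u R' M' Z' where "runs P u (conf (a + clen c1 + 2) R M Z) (conf ?e R' M' Z')"
      "R' 0 = 0" "Q R' M' Z' (t + 1 + u)"
      using Cond.IH(2)[OF code(6), of R Q M Z "t + 1"] Cond.prems(2) Cond.prems(3) True by (auto simp: algebra_simps)
    then show ?thesis using runs_Suc[OF 1] 
      by (intro exI[of _ "Suc u"] exI[of _ R'] exI[of _ M'] exI[of _ Z'])
        (simp add: algebra_simps del: relpowp.simps)
  next
    case False
    have 1: "ram_step S B P (conf a R M Z) (conf (a + 1) R M Z)"
      using code False by (simp add: ram_step_def)
    obtain u R' M' Z' where 2: "runs P u (conf (a + 1) R M Z) (conf (a + 1 + clen c1) R' M' Z')"
      "R' 0 = 0" "Q R' M' Z' (t + 1 + u + 1)"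
      using Cond.IH(1)[OF code(3), of R "\<lambda>R M Z t. Q R M Z (t + 1)" M Z "t + 1"] Cond.prems False
      by (auto simp: algebra_simps)
    have "ram_step S B P (conf (a + 1 + clen c1) R' M' Z') (conf ?e R' M' Z')"
      using code 2(2) by (simp add: ram_step_def)
    then have "runs P (Suc (Suc u)) (conf a R M Z) (conf ?e R' M' Z')"
      by (intro runs_snoc[OF runs_Suc[OF 1 2(1)]])
    then show ?thesis using 2 
      by (intro exI[of _ "Suc (Suc u)"] exI[of _ R'] exI[of _ M'] exI[of _ Z'])
        (simp add: algebra_simps del: relpowp.simps)
  qed
next
  case (Loop r c)
  let ?e = "a + clen c + 2"
  have code: "a < length P" "P ! a = JZ r ?e" "code_at P (a + 1) (compile (a + 1) c)"
    "a + 1 + clen c < length P" "P ! (a + 1 + clen c) = JZ 0 a"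
    using code_at_Cons[OF Loop.prems(1)[unfolded compile.simps]]
    by (auto dest!: code_at_append code_at_Cons simp: algebra_simps)
  define X where "X = (\<lambda>R M Z t. R 0 = 0 \<longrightarrow>
    (\<exists>u R' M' Z'. runs P u (conf a R M Z) (conf ?e R' M' Z') \<and> R' 0 = (0 :: nat) \<and>
           Q R' M' Z' (t + u)))"
  \<comment> \<open>The states from which the compiled loop reaches its end in \<open>Q\<close> are
    closed under the functional of the loop. The least fixed point lies below every closed set, so
    no induction on the number of rounds is needed.\<close>
  have "wp (Loop r c) Q \<le> X"
    unfolding wp.simps
  proof (rule lfp_lowerbound, intro le_funI le_boolI)
    fix R M Z t
    assume A: "if R r \<noteq> 0 then wp c (\<lambda>R M Z t. X R M Z (t + 1)) R M Z (t + 1) else Q R M Z (t + 1)"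
    show "X R M Z t"
      unfolding X_def
    proof
      assume R0: "R 0 = 0"
      show "\<exists>u R' M' Z'. runs P u (conf a R M Z) (conf ?e R' M' Z') \<and> R' 0 = (0 :: nat) \<and>
           Q R' M' Z' (t + u)"
      proof (cases "R r = 0")
        case True
        have "ram_step S B P (conf a R M Z) (conf ?e R M Z)"
          using code True by (simp add: ram_step_def)
        then show ?thesis using A True R0
          by (intro exI[of _ "Suc 0"] exI[of _ R] exI[of _ M] exI[of _ Z]) (simp add: relcompp_apply)
      next
        case False
        have 1: "ram_step S B P (conf a R M Z) (conf (a + 1) R M Z)"
          using code False by (simp add: ram_step_def)
        obtain u R' M' Z' where 2: "runs P u (conf (a + 1) R M Z) (conf (a + 1 + clen c) R' M' Z')"
          "R' 0 = 0" "X R' M' Z' (t + 1 + u + 1)"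
          using Loop.IH[OF code(3), of R "\<lambda>R M Z t. X R M Z (t + 1)" M Z "t + 1"] R0 A False
          by (auto simp: algebra_simps)
        have "ram_step S B P (conf (a + 1 + clen c) R' M' Z') (conf a R' M' Z')"
          using code 2(2) by (simp add: ram_step_def)
        then have 3: "runs P (Suc (Suc u)) (conf a R M Z) (conf a R' M' Z')"
          by (intro runs_snoc[OF runs_Suc[OF 1 2(1)]])
        obtain u' R'' M'' Z'' where "runs P u' (conf a R' M' Z') (conf ?e R'' M'' Z'')" "R'' 0 = 0"
          "Q R'' M'' Z'' (t + 1 + u + 1 + u')"
          using 2 unfolding X_def by blast
        then show ?thesis using runs_trans[OF 3]
          by (intro exI[of _ "Suc (Suc u) + u'"] exI[of _ R''] exI[of _ M''] exI[of _ Z''])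
            (simp add: algebra_simps del: relpowp.simps)
      qed
    qed
  qed
  then have "X R M Z t" using Loop.prems(3) by (auto simp: le_fun_def)
  then show ?case using Loop.prems(2) unfolding X_def by (simp add: algebra_simps)
qed

end

section \<open>Connected sets of vertices\<close>

text \<open>
  Connectedness is expressed by cuts: a nonempty subset that no edge leaves is everything.
\<close>

definition conn :: "('a \<times> 'a) set \<Rightarrow> 'a set \<Rightarrow> bool" where
  "conn E T \<longleftrightarrow> T \<noteq> {} \<and>
     (\<forall>U \<subseteq> T. U \<noteq> {} \<longrightarrow> (\<forall>x \<in> U. \<forall>y \<in> T. (x, y) \<in> E \<longrightarrow> y \<in> U) \<longrightarrow> U = T)"

lemma conn_singleton: "conn E {v}"
  by (auto simp: conn_def)

text \<open>The form in which cuts are applied: what a search has found is closed under edges, so a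
  connected set that meets it cannot leave it.\<close>

lemma conn_closed:
  assumes "conn E T" "x \<in> T" "x \<in> R" "\<And>u w. u \<in> R \<Longrightarrow> u \<in> T \<Longrightarrow> w \<in> T \<Longrightarrow> (u, w) \<in> E \<Longrightarrow> w \<in> R"
  shows "T \<subseteq> R"
proof -
  have "T \<inter> R = T"
    using assms(1)[unfolded conn_def, THEN conjunct2, rule_format, of "T \<inter> R"] assms(2-4) by blast
  then show ?thesis by blast
qed

lemma conn_insert:
  assumes "sym E" "conn E T" "x \<in> T" "(x, y) \<in> E"
  shows "conn E (insert y T)"
  unfolding conn_def
proof (intro conjI allI impI)
  fix U assume U: "U \<subseteq> insert y T" "U \<noteq> {}" "\<forall>x\<in>U. \<forall>z\<in>insert y T. (x, z) \<in> E \<longrightarrow> z \<in> U"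
  have "\<exists>z \<in> T. z \<in> U"
    using U assms(3) symD[OF assms(1,4)] by (cases "y \<in> U") auto
  then have "T \<subseteq> U" using conn_closed[OF assms(2), of _ U] U by blast
  then show "U = insert y T" using U assms by blast
qed auto

lemma conn_Un:
  assumes "conn E X" "conn E Y" "X \<inter> Y \<noteq> {}"
  shows "conn E (X \<union> Y)"
  unfolding conn_def
proof (intro conjI allI impI)
  fix U assume U: "U \<subseteq> X \<union> Y" "U \<noteq> {}" "\<forall>x\<in>U. \<forall>y\<in>X \<union> Y. (x, y) \<in> E \<longrightarrow> y \<in> U"
  have X: "X \<subseteq> U" if "x \<in> X" "x \<in> U" for x
    using conn_closed[OF assms(1) that] U by blast
  have Y: "Y \<subseteq> U" if "x \<in> Y" "x \<in> U" for x
    using conn_closed[OF assms(2) that] U by blast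
  have "X \<subseteq> U \<and> Y \<subseteq> U" using X Y U(1,2) assms(3) by blast
  then show "U = X \<union> Y" using U by blast
qed (use assms in \<open>auto simp: conn_def\<close>)

text \<open>As long as \<open>T\<close> is not \<open>R\<close>, an edge of the connected set
  \<open>R\<close> leaves \<open>T\<close>; adding its end point keeps \<open>T\<close>
  connected.\<close>

lemma conn_grow:
  assumes "sym E" "conn E R" "finite R" "conn E T" "T \<subseteq> R" "card T \<le> k" "k \<le> card R"
  shows "\<exists>T'. T \<subseteq> T' \<and> T' \<subseteq> R \<and> conn E T' \<and> card T' = k"
  using assms(4-)
proof (induction "k - card T" arbitrary: T)
  case 0
  then show ?case by auto
next
  case (Suc d)
  have "T \<noteq> R" using Suc by auto
  obtain x where x: "x \<in> T" using Suc.prems(1) by (auto simp: conn_def)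
  have "\<exists>u w. u \<in> T \<and> w \<in> R \<and> (u, w) \<in> E \<and> w \<notin> T"
  proof (rule ccontr)
    assume "\<not> ?thesis"
    then have "R \<subseteq> T" using conn_closed[OF assms(2), of x T] x Suc.prems by blast
    then show False using \<open>T \<noteq> R\<close> Suc.prems by blast
  qed
  then obtain u w where uw: "u \<in> T" "w \<in> R" "(u, w) \<in> E" "w \<notin> T" by blast
  have fin: "finite T" using Suc.prems assms(3) finite_subset by blast
  have "conn E (insert w T)" using conn_insert[OF assms(1) Suc.prems(1) uw(1,3)] .
  then have "\<exists>T'. insert w T \<subseteq> T' \<and> T' \<subseteq> R \<and> conn E T' \<and> card T' = k"
    using Suc.hyps(1)[of "insert w T"] Suc.hyps(2) Suc.prems uw fin by auto
  then show ?case by auto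
qed

text \<open>The solutions at the node \<open>(T, A)\<close> of the enumeration tree. With
  \<open>T = {}\<close> and all vertices in \<open>A\<close> these are the vertex sets of the
  graphlets.\<close>

definition csets :: "('a \<times> 'a) set \<Rightarrow> nat \<Rightarrow> 'a set \<Rightarrow> 'a set \<Rightarrow> 'a set set" where
  "csets E k A T = {X. T \<subseteq> X \<and> X \<subseteq> A \<and> conn E X \<and> card X = k}"

lemma finite_csets: "finite A \<Longrightarrow> finite (csets E k A T)"
  by (rule finite_subset[of _ "Pow A"]) (auto simp: csets_def)

lemma csets_small:
  assumes "finite A" "card A < k"
  shows "csets E k A T = {}"
proof -
  have "card X \<noteq> k" if "X \<subseteq> A" for X using card_mono[OF assms(1) that] assms(2) by linarith
  then show ?thesis by (auto simp: csets_def)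
qed

lemma csets_split: "csets E k A T = csets E k A (insert v T) \<union> csets E k (A - {v}) T"
  "csets E k A (insert v T) \<inter> csets E k (A - {v}) T = {}"
  by (auto simp: csets_def)

text \<open>The certificate for the invariant that every node has a solution: any connected set of
  at least \<open>k\<close> available vertices around \<open>T\<close> will do. This is why a search
  may stop after \<open>k\<close> vertices.\<close>

lemma csets_nonempty:
  assumes "sym E" "finite R" "conn E R" "R \<subseteq> A" "conn E T" "T \<subseteq> R" "card T \<le> k" "k \<le> card R"
  shows "csets E k A T \<noteq> {}"
  using conn_grow[OF assms(1,3,2,5,6,7,8)] assms(4) by (auto simp: csets_def)

text \<open>A search from \<open>T\<close> that is stuck with fewer than \<open>k\<close> vertices behind \<open>v\<close>.\<close>

lemma csets_forced:
  assumes "finite R" "T \<noteq> {}" "T \<subseteq> R" "card R < k"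
    "\<And>u w. u \<in> R \<Longrightarrow> w \<in> A \<Longrightarrow> (u, w) \<in> E \<Longrightarrow> w \<in> insert v R"
  shows "csets E k A (insert v T) = csets E k A T"
proof
  show "csets E k A T \<subseteq> csets E k A (insert v T)"
  proof
    fix X assume X: "X \<in> csets E k A T"
    have "v \<in> X"
    proof (rule ccontr)
      assume "v \<notin> X"
      obtain x where "x \<in> T" using assms by blast
      have "X \<subseteq> R"
        by (rule conn_closed[of E X x])
          (use X assms(3) assms(5) \<open>v \<notin> X\<close> \<open>x \<in> T\<close> in \<open>unfold csets_def, blast+\<close>)
      then show False using X assms(4) card_mono[OF assms(1), of X] by (auto simp: csets_def)
    qed
    then show "X \<in> csets E k A (insert v T)" using X by (auto simp: csets_def)
  qed
qed (auto simp: csets_def)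

text \<open>For a search that is exhausted with no vertex held back: a solution is trapped in
  \<open>R\<close>, which has at most \<open>k\<close> vertices, so it is \<open>R\<close>
  itself.\<close>

lemma csets_component:
  assumes "finite R" "T \<noteq> {}" "T \<subseteq> R" "card R \<le> k" "csets E k A T \<noteq> {}"
    "\<And>u w. u \<in> R \<Longrightarrow> w \<in> A \<Longrightarrow> (u, w) \<in> E \<Longrightarrow> w \<in> R"
  shows "csets E k A T = {R}"
proof -
  have "X = R" if X: "X \<in> csets E k A T" for X
  proof -
    obtain x where "x \<in> T" using assms by blast
    have "X \<subseteq> R"
      by (rule conn_closed[of E X x])
        (use X assms(3) assms(6) \<open>x \<in> T\<close> in \<open>auto simp: csets_def\<close>)
    then show ?thesis using X assms(4) card_seteq[OF assms(1), of X] by (auto simp: csets_def)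
  qed
  then show ?thesis using assms(5) by blast
qed

lemma csets_fan:
  assumes "sym E" "conn E T" "finite T" "T \<subseteq> A" "card T + 1 = k" 
  shows "csets E k A T = (\<lambda>w. insert w T) ` {w \<in> A - T. \<exists>u \<in> T. (u, w) \<in> E}" (is "_ = ?r")
proof
  show "?r \<subseteq> csets E k A T"
    using assms conn_insert[OF assms(1,2)] by (auto simp: csets_def)
  show "csets E k A T \<subseteq> ?r"
  proof
    fix X assume X: "X \<in> csets E k A T"
    have fX: "finite X" using X assms(5) card.infinite[of X] by (auto simp: csets_def)
    have "\<not> X \<subseteq> T" using X assms card_mono[of T X] by (auto simp: csets_def)
    moreover obtain x where "x \<in> T" using assms(2) by (auto simp: conn_def)
    ultimately obtain u w where uw: "u \<in> T" "w \<in> X" "(u, w) \<in> E" "w \<notin> T"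
      using X conn_closed[of E X x T] by (auto simp: csets_def)
    have "insert w T = X"
      by (rule card_seteq[OF fX]) (use X uw assms in \<open>auto simp: csets_def\<close>)
    then show "X \<in> ?r" using uw X by (auto simp: csets_def)
  qed
qed

text \<open>The degree bound that pays for deletions. For a neighbour \<open>w\<close> outside
  \<open>T\<close> and any solution \<open>X\<close>, both \<open>insert w T\<close> and
  \<open>insert w X\<close> are connected; growing the former inside the latter to \<open>k\<close>
  vertices gives a solution that contains \<open>w\<close>. So all neighbours lie in
  \<open>T\<close> or in the union of the solutions.\<close>

lemma card_neighbours_le:
  assumes "sym E" "finite A" "conn E T" "T \<subseteq> A" "csets E k A T \<noteq> {}" "card T < k" "v \<in> T"
  shows "card {w \<in> A. (v, w) \<in> E} \<le> k + k * card (csets E k A T)"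
proof -
  let ?N = "{w \<in> A. (v, w) \<in> E}"
  have fT: "finite T" using assms finite_subset by blast
  have "w \<in> \<Union> (csets E k A T)" if w: "w \<in> ?N - T" for w
  proof -
    obtain X where X: "X \<in> csets E k A T" using assms by blast
    then have fX: "finite X" using assms by (auto simp: csets_def intro: finite_subset)
    have Xc: "conn E (insert w X)"
      using conn_insert[OF assms(1), of X v w] X w assms by (auto simp: csets_def)
    have Tc: "conn E (insert w T)" using conn_insert[OF assms(1), of T v w] w assms by auto
    have "csets E k A (insert w T) \<noteq> {}"
      by (rule csets_nonempty[OF assms(1) _ Xc _ Tc])
        (use X w assms fX fT in \<open>auto simp: csets_def card_insert_if\<close>)
    then show ?thesis by (auto simp: csets_def)
  qed
  then have "?N \<subseteq> T \<union> \<Union> (csets E k A T)" by blast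
  then have "card ?N \<le> card (T \<union> \<Union> (csets E k A T))"
    using assms fT by (intro card_mono) (auto simp: csets_def intro: finite_subset[of _ A])
  also have "\<dots> \<le> card T + card (\<Union> (csets E k A T))" by (rule card_Un_le)
  also have "card (\<Union> (csets E k A T)) \<le> (\<Sum>X\<in>csets E k A T. card X)"
    by (rule card_Union_le_sum_card)
  also have "\<dots> = k * card (csets E k A T)" by (simp add: csets_def)
  finally show ?thesis using assms by linarith
qed

lemma conn_prefix:
  assumes "sym E" "0 < j" "j \<le> length xs"
    "\<And>l. 0 < l \<Longrightarrow> l < length xs \<Longrightarrow> \<exists>l'<l. (xs ! l', xs ! l) \<in> E"
  shows "conn E (set (take j xs))"
  using assms(2,3)
proof (induction j)
  case (Suc j)
  show ?case
  proof (cases "j = 0")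
    case True
    then show ?thesis using Suc by (cases xs) (auto simp: conn_singleton)
  next
    case False
    obtain l' where "l' < j" "(xs ! l', xs ! j) \<in> E" using assms(4)[of j] False Suc by auto
    moreover have "xs ! l' \<in> set (take j xs)"
      using \<open>l' < j\<close> Suc.prems by (auto simp: in_set_conv_nth intro!: exI[of _ l'])
    ultimately have "conn E (insert (xs ! j) (set (take j xs)))"
      using conn_insert[OF assms(1) Suc.IH, of "xs ! l'" "xs ! j"] False Suc by auto
    then show ?thesis using Suc by (simp add: take_Suc_conv_app_nth)
  qed
qed simp

section \<open>Adjacency lists in memory\<close>

text \<open>
  Register conventions of the program. Constants: 0 to 3 hold their own number, 4 to 6 hold \<open>n\<close>, \<open>k\<close>,
  \<open>k - 1\<close>, and 7 to 12 the base addresses of the arrays of \<open>n\<close> words behind the input: visited marks,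
  root order, search queue (which is the root order array during the breadth-first search), \<open>T\<close>, and
  the vertices and flags of the trail of decisions. Flag 0 is a
  forced vertex, 1 an included vertex whose exclusion is still to be tried, 2 a deleted vertex.
  Variables: 13 is the size of \<open>T\<close>, 14 the length of the trail, 15 the length of the queue and 16 the
  position in it, 17 points into the adjacency list being scanned, 18 tells whether a vertex is
  held back and 19 is this vertex (also the vertex to delete or restore), 20 is the search loop
  condition, 24 the mode (1: process a node, 2: backtrack, 0: root done), 25 the number of remaining
  roots, 30 the root loop condition; the others are scratch.
\<close>

definition frame :: "nat set \<Rightarrow> (nat \<Rightarrow> nat) \<Rightarrow> (nat \<Rightarrow> nat) \<Rightarrow> bool" where
  "frame W R R' \<longleftrightarrow> (\<forall>r. r \<notin> W \<longrightarrow> R' r = R r)"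

lemma frameD: "frame W R R' \<Longrightarrow> r \<notin> W \<Longrightarrow> R' r = R r"
  by (simp add: frame_def)

lemma frame_refl: "frame W R R"
  by (simp add: frame_def)

lemma frame_trans: "frame W R R' \<Longrightarrow> frame W' R' R'' \<Longrightarrow> W \<subseteq> V \<Longrightarrow> W' \<subseteq> V \<Longrightarrow> frame V R R''"
  unfolding frame_def by (metis subsetD)

definition array :: "(nat \<Rightarrow> nat) \<Rightarrow> nat \<Rightarrow> nat list \<Rightarrow> bool" where
  "array M b xs \<longleftrightarrow> (\<forall>i < length xs. M (b + i) = xs ! i)"

lemma array_upd: "x < b \<or> b + length xs \<le> x \<Longrightarrow> array (M(x := y)) b xs = array M b xs"
proof -
  assume "x < b \<or> b + length xs \<le> x"
  then have "(M(x := y)) (b + i) = M (b + i)" if "i < length xs" for i using that by auto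
  then show ?thesis unfolding array_def by metis
qed

lemma array_snoc: "array M b xs \<Longrightarrow> array (M(b + length xs := y)) b (xs @ [y])"
  by (auto simp: array_def nth_append)

lemma array_Nil [simp]: "array M b []"
  by (simp add: array_def)

lemma array_prefix: "array M b (xs @ ys) \<Longrightarrow> array M b xs"
  by (auto simp: array_def nth_append split: if_splits)

definition For :: "nat \<Rightarrow> nat \<Rightarrow> com \<Rightarrow> com" where
  "For i lr c = Ins (LOADI i 0) ;; Ins (SUB 31 lr i) ;;
     Loop 31 (c ;; Ins (ADD i i 1) ;; Ins (SUB 31 lr i))"

context machine
begin

text \<open>A round takes the \<open>d\<close> steps of the body, two instructions, the loop test
  and the jump back, hence \<open>d + 4\<close>. The \<open>3\<close> is the two initial
  instructions and the last test.\<close>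

lemma wp_For:
  assumes i: "i \<noteq> 0" "i \<noteq> 31" "lr \<noteq> 31" "i \<noteq> lr" "i \<noteq> 1" "lr \<noteq> 1" "R 1 = 1" "R lr = L" "L \<le> B"
    and init: "J 0 (R(i := 0, 31 := L)) M Z"
    and step: "\<And>x R M Z t. x < L \<Longrightarrow> J x R M Z \<Longrightarrow> R i = x \<Longrightarrow> R lr = L \<Longrightarrow> R 1 = 1 \<Longrightarrow>
      wp c (\<lambda>R' M' Z' t'. t' \<le> t + d \<and> R' i = x \<and> R' lr = L \<and> R' 1 = 1 \<and>
        J (x + 1) (R'(i := x + 1, 31 := L - (x + 1))) M' Z') R M Z t"
    and exit: "\<And>R' M' Z' t'. J L R' M' Z' \<Longrightarrow> t' \<le> t + 3 + (d + 4) * L \<Longrightarrow> Q R' M' Z' t'"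
  shows "wp (For i lr c) Q R M Z t"
proof -
  have "wp (Loop 31 (c ;; Ins (ADD i i 1) ;; Ins (SUB 31 lr i))) Q (R(i := 0, 31 := L)) M Z (t + 2)"
  proof (rule wp_Loop[where f = "\<lambda>x. (d + 4) * (L - x)" and g = 0 and
        I = "\<lambda>x R M Z. x \<le> L \<and> J x R M Z \<and> R i = x \<and> R lr = L \<and> R 1 = 1 \<and> R 31 = L - x"])
    show "0 \<le> L \<and> J 0 (R(i := 0, 31 := L)) M Z \<and> (R(i := 0, 31 := L)) i = 0 \<and>
      (R(i := 0, 31 := L)) lr = L \<and> (R(i := 0, 31 := L)) 1 = 1 \<and> (R(i := 0, 31 := L)) 31 = L - 0"
      using init i by auto
  next
    fix x R M Z t P
    assume A: "x \<le> L \<and> J x R M Z \<and> R i = x \<and> R lr = L \<and> R 1 = 1 \<and> R 31 = L - x" "R 31 \<noteq> 0"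
      and fin: "\<And>x' R' M' Z' t'. x' \<le> L \<and> J x' R' M' Z' \<and> R' i = x' \<and> R' lr = L \<and> R' 1 = 1 \<and> R' 31 = L - x' \<Longrightarrow>
        (d + 4) * (L - x') < (d + 4) * (L - x) \<Longrightarrow>
        t' + 2 + (d + 4) * (L - x') \<le> t + (d + 4) * (L - x) \<Longrightarrow> P R' M' Z' t'"
    then have x: "x < L" by simp
    have e: "(d + 4) * (L - x) = (d + 4) * (L - (x + 1)) + (d + 4)"
      using x by (metis Suc_diff_Suc Suc_eq_plus1 add.commute mult_Suc_right)
    show "wp (c;; Ins (ADD i i 1);; Ins (SUB 31 lr i)) P R M Z t"
      unfolding wp.simps(3)
    proof (rule wp_mono[OF step[of x R M Z t]])
      fix R' M' Z' t'
      assume "t' \<le> t + d \<and> R' i = x \<and> R' lr = L \<and> R' 1 = 1 \<and>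
        J (x + 1) (R'(i := x + 1, 31 := L - (x + 1))) M' Z'"
      then show "wp (Ins (ADD i i 1)) (wp (Ins (SUB 31 lr i)) P) R' M' Z' t'"
        using x i e fin[of "x + 1" "R'(i := x + 1, 31 := L - (x + 1))"] by simp
    qed (use A x in simp_all)
  next
    fix x R' M' Z' t'
    assume A: "x \<le> L \<and> J x R' M' Z' \<and> R' i = x \<and> R' lr = L \<and> R' 1 = 1 \<and> R' 31 = L - x"
      "R' 31 = 0" "t' + (d + 4) * (L - x) \<le> t + 2 + (d + 4) * (L - 0) + 1"
    then have "x = L" by simp
    then show "Q R' M' Z' t'" using exit A by auto
  qed
  then show ?thesis using i by (simp add: For_def numeral_2_eq_2)
qed

end

text \<open>\<open>ad u w\<close> is the address of the list node of \<open>(u, w)\<close>. The six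
  arrays of \<open>n\<close> words lie behind the \<open>3 + n + 8 * m\<close> words of the input.
  \<open>k\<close> needs a bound of its own because it is read before it is compared with
  \<open>n\<close>.\<close>

locale gmem = machine S B for S B +
  fixes n m k :: nat and E :: "(nat \<times> nat) set" and ad :: "nat \<Rightarrow> nat \<Rightarrow> nat"
  assumes n0: "0 < n" and symE: "sym E" and E_sub: "E \<subseteq> {..<n} \<times> {..<n}" and irrE: "(v, v) \<notin> E"
    and ad_in: "(u, w) \<in> E \<Longrightarrow> \<exists>i < 2 * m. ad u w = 3 + n + 4 * i"
    and ad_inj: "(u, w) \<in> E \<Longrightarrow> (u', w') \<in> E \<Longrightarrow> ad u w = ad u' w' \<Longrightarrow> u = u' \<and> w = w'"
    and S_big: "3 + n + 8 * m + 6 * n \<le> S" and B_big: "S + 10 \<le> B" "k + 10 \<le> B"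
begin

section \<open>Memory regions of the lists and doubly linked segments\<close>

definition D :: nat where "D = 3 + n + 8 * m"

lemma D_bounds: "3 + n \<le> D" "D + 6 * n \<le> S" "S + 10 \<le> B"
  using S_big B_big by (auto simp: D_def)

lemma ED: "(u, w) \<in> E \<Longrightarrow> u < n \<and> w < n \<and> u \<noteq> w \<and> (w, u) \<in> E"
  using E_sub symE irrE by (auto dest: symD)

lemma ad_bounds: "(u, w) \<in> E \<Longrightarrow> 3 + n \<le> ad u w \<and> ad u w + 3 < D"
  using ad_in[of u w] by (auto simp: D_def)

text \<open>The offsets of the nodes behind the list heads are multiples of 4, the size of a node,
  so two words of nodes coincide only if node and field do.\<close>

lemma ad_eq:
  assumes "(u, w) \<in> E" "(u', w') \<in> E" "a < 4" "b < 4" "ad u w + a = ad u' w' + b"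
  shows "u = u' \<and> w = w' \<and> a = b"
proof -
  obtain i i' where "ad u w = 3 + n + 4 * i" "ad u' w' = 3 + n + 4 * i'"
    using ad_in assms by meson
  with assms have "i = i'" "a = b" by presburger+
  then show ?thesis using ad_inj assms by simp
qed

lemma ad_eq_iff [simp]:
  assumes "(u, w) \<in> E" "(u', w') \<in> E"
  shows "ad u w = ad u' w' \<longleftrightarrow> u = u' \<and> w = w'"
    "ad u w \<noteq> Suc (ad u' w')" "Suc (ad u w) \<noteq> ad u' w'"
    "ad u w \<noteq> Suc (Suc (ad u' w'))" "Suc (Suc (ad u w)) \<noteq> ad u' w'"
    "ad u w \<noteq> ad u' w' + 3" "ad u w + 3 \<noteq> ad u' w'"
  by (use ad_eq[OF assms, of 0 0] in force, use ad_eq[OF assms, of 0 1] in force,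
      use ad_eq[OF assms, of 1 0] in force, use ad_eq[OF assms, of 0 2] in force,
      use ad_eq[OF assms, of 2 0] in force, use ad_eq[OF assms, of 0 3] in force,
      use ad_eq[OF assms, of 3 0] in force)

text \<open>The words owned by \<open>u\<close>: its list head and all its nodes, including those
  currently unlinked. Regions of different vertices are disjoint and unlinking \<open>(w, v)\<close>
  writes only into \<open>region w\<close>, so the deletion of \<open>v\<close> splits into
  independent changes, one for each neighbour.\<close>

definition region :: "nat \<Rightarrow> nat set" where
  "region u = insert (3 + u) {ad u w + a | w a. (u, w) \<in> E \<and> a < 4}"

lemma region_head [simp]: "3 + u \<in> region u"
  by (simp add: region_def)

lemma region_node: "(u, w) \<in> E \<Longrightarrow> a < 4 \<Longrightarrow> ad u w + a \<in> region u"
  unfolding region_def by auto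

lemma region_node' [simp]:
  assumes "(u, w) \<in> E"
  shows "ad u w \<in> region u" "Suc (ad u w) \<in> region u" "Suc (Suc (ad u w)) \<in> region u" "ad u w + 3 \<in> region u"
  using region_node[OF assms, of 0] region_node[OF assms, of 1] region_node[OF assms, of 2]
    region_node[OF assms, of 3] by auto

lemma region_disj: "x \<in> region u \<Longrightarrow> x \<in> region u' \<Longrightarrow> u < n \<Longrightarrow> u' < n \<Longrightarrow> u = u'"
  unfolding region_def by (auto dest: ad_eq ad_bounds)

lemma region_low: "x \<in> region u \<Longrightarrow> u < n \<Longrightarrow> x < D"
  unfolding region_def using D_bounds by (auto dest!: ad_bounds)

definition nxt :: "nat \<Rightarrow> nat \<Rightarrow> nat list \<Rightarrow> nat" where
  "nxt u e ys = (case ys of [] \<Rightarrow> e | y # _ \<Rightarrow> ad u y)"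

definition prv :: "nat \<Rightarrow> nat \<Rightarrow> nat list \<Rightarrow> nat" where
  "prv u b xs = (if xs = [] then b else ad u (last xs))"

lemma nxt_simps [simp]: "nxt u e [] = e" "nxt u e (y # ys) = ad u y"
  by (simp_all add: nxt_def)

text \<open>\<open>b\<close> is the backward pointer of the first node and \<open>e\<close> the
  forward pointer of the last one; leaving both open lets segments be split and joined at any
  node.\<close>

primrec dlseg :: "(nat \<Rightarrow> nat) \<Rightarrow> nat \<Rightarrow> nat \<Rightarrow> nat list \<Rightarrow> nat \<Rightarrow> bool" where
  "dlseg M u b [] e \<longleftrightarrow> True"
| "dlseg M u b (w # ws) e \<longleftrightarrow>
     M (ad u w) = w \<and> M (ad u w + 1) = nxt u e ws \<and> M (ad u w + 2) = b \<and>
     M (ad u w + 3) = ad w u \<and> dlseg M u (ad u w) ws e"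

lemma dlseg_append:
  "dlseg M u b (xs @ ys) e \<longleftrightarrow> dlseg M u b xs (nxt u e ys) \<and> dlseg M u (prv u b xs) ys e"
proof (induction xs arbitrary: b)
  case (Cons x xs)
  have "nxt u e (xs @ ys) = nxt u (nxt u e ys) xs" by (cases xs) auto
  then show ?case using Cons by (auto simp: prv_def)
qed (simp add: prv_def)

lemma dlseg_cong:
  assumes "dlseg M u b xs e" "\<And>w a. w \<in> set xs \<Longrightarrow> a < 4 \<Longrightarrow> M' (ad u w + a) = M (ad u w + a)"
  shows "dlseg M' u b xs e"
  using assms
proof (induction xs arbitrary: b)
  case (Cons x xs)
  have "M' (ad u x) = M (ad u x)" "M' (ad u x + 1) = M (ad u x + 1)" "M' (ad u x + 2) = M (ad u x + 2)"
    "M' (ad u x + 3) = M (ad u x + 3)"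
    using Cons.prems(2)[of x 0] Cons.prems(2)[of x 1] Cons.prems(2)[of x 2] Cons.prems(2)[of x 3] by auto
  then show ?case using Cons by simp
qed simp

text \<open>Only linked nodes are described. The contents of unlinked nodes, on which restoration
  depends, are recorded by \<open>unlinked\<close> instead.\<close>

definition reprv :: "nat list \<Rightarrow> nat \<Rightarrow> (nat \<Rightarrow> nat) \<Rightarrow> bool" where
  "reprv xs u M \<longleftrightarrow> distinct xs \<and> (\<forall>w \<in> set xs. (u, w) \<in> E) \<and> M (3 + u) = nxt u 0 xs \<and> dlseg M u 0 xs 0"

definition repr :: "(nat \<Rightarrow> nat list) \<Rightarrow> (nat \<Rightarrow> nat) \<Rightarrow> bool" where
  "repr adj M \<longleftrightarrow> (\<forall>u < n. reprv (adj u) u M)"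

lemma reprv_cong:
  assumes "reprv xs u M" "\<And>x. x \<in> region u \<Longrightarrow> M' x = M x"
  shows "reprv xs u M'"
proof -
  have "M' (ad u w + a) = M (ad u w + a)" if "w \<in> set xs" "a < 4" for w a
    using assms that by (auto simp: reprv_def region_def)
  then show ?thesis using assms dlseg_cong[of M u 0 xs 0 M'] by (auto simp: reprv_def)
qed

lemma repr_cong: "repr adj M \<Longrightarrow> (\<And>x. x < D \<Longrightarrow> M' x = M x) \<Longrightarrow> repr adj M'"
  unfolding repr_def using reprv_cong region_low by blast

text \<open>
  With \<open>del\<close> the node of \<open>(w, v)\<close> is unlinked from the list of \<open>w\<close>; without, it is put back to
  the place that its own, still intact, pointers tell.
\<close>

definition relink :: "bool \<Rightarrow> nat \<Rightarrow> nat \<Rightarrow> (nat \<Rightarrow> nat) \<Rightarrow> (nat \<Rightarrow> nat)" where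
  "relink del v w M = (let q = ad w v; a = M (q + 1); b = M (q + 2);
       M1 = M((if b = 0 then w + 3 else b + 1) := (if del then a else q))
     in if a = 0 then M1 else M1(a + 2 := (if del then b else q)))"

definition listptr :: "nat \<Rightarrow> nat \<Rightarrow> bool" where
  "listptr w a \<longleftrightarrow> a = 0 \<or> (\<exists>y. (w, y) \<in> E \<and> a = ad w y)"

text \<open>The writes go through the two pointers stored in the node, so they stay in
  \<open>region w\<close> only if these are null or lead to nodes of \<open>w\<close>.\<close>

lemma relink_local:
  assumes "listptr w (M (ad w v + 1))" "listptr w (M (ad w v + 2))"
  shows "x \<notin> region w \<Longrightarrow> relink del v w M x = M x"
proof -
  assume x: "x \<notin> region w"
  have "x \<noteq> w + 3" using x region_head[of w] by (metis add.commute)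
  then show ?thesis
    using assms x unfolding relink_def listptr_def Let_def by (auto split: if_splits)
qed

lemma relink_cong:
  assumes "(w, v) \<in> E" "\<And>x. x \<in> region w \<Longrightarrow> M' x = M x" "x \<in> region w"
  shows "relink del v w M' x = relink del v w M x"
proof -
  have "M' (ad w v + 1) = M (ad w v + 1)" "M' (ad w v + 2) = M (ad w v + 2)" "M' x = M x"
    using assms by auto
  then show ?thesis unfolding relink_def Let_def by (auto simp: fun_upd_apply)
qed

lemma reprv_ptrs:
  assumes "reprv (xs @ v # ys) w M"
  shows "M (ad w v + 1) = nxt w 0 ys" "M (ad w v + 2) = prv w 0 xs" "(w, v) \<in> E"
  using assms by (auto simp: reprv_def dlseg_append)

lemma listptr_repv:
  assumes "reprv xs w M" "v \<in> set xs"
  shows "listptr w (M (ad w v + 1))" "listptr w (M (ad w v + 2))"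
proof -
  obtain as bs where xs: "xs = as @ v # bs" using assms by (meson split_list)
  have "\<forall>y \<in> set xs. (w, y) \<in> E" using assms by (simp add: reprv_def)
  then show "listptr w (M (ad w v + 1))" "listptr w (M (ad w v + 2))"
    using reprv_ptrs[OF assms(1)[unfolded xs]] xs
    by (cases bs; auto simp: listptr_def prv_def)+
qed

lemma ad_nz: "(w, y) \<in> E \<Longrightarrow> ad w y \<noteq> 0"
  using ad_bounds by fastforce

text \<open>The list is split at \<open>v\<close>. Without a predecessor the list head is rewritten,
  without a successor there is no backward pointer to correct; all other words are unaffected
  because \<open>ad_eq\<close> separates them from the two that are written.\<close>

lemma reprv_unlink:
  assumes "reprv xs w M" "v \<in> set xs" "w < n"
  shows "reprv (remove1 v xs) w (relink True v w M)"
proof -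
  obtain as bs where xs: "xs = as @ v # bs" and v: "v \<notin> set as" using assms by (meson split_list_first)
  have rm: "remove1 v xs = as @ bs" using xs v by (simp add: remove1_append)
  have r: "reprv (as @ v # bs) w M" using assms xs by simp
  note p = reprv_ptrs[OF r]
  have E: "(w, v) \<in> E" "\<forall>y \<in> set as. (w, y) \<in> E" "\<forall>y \<in> set bs. (w, y) \<in> E" and d: "distinct as" "distinct bs"
    "set as \<inter> set bs = {}" "v \<notin> set bs" and M: "M (3 + w) = nxt w 0 (as @ v # bs)"
    "dlseg M w 0 as (ad w v)" "dlseg M w (ad w v) bs 0"
    using r by (auto simp: reprv_def dlseg_append)
  let ?a = "nxt w 0 bs" and ?b = "prv w 0 as"
  let ?M1 = "M((if ?b = 0 then w + 3 else ?b + 1) := ?a)"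
  let ?M = "if ?a = 0 then ?M1 else ?M1(?a + 2 := ?b)"
  have L: "relink True v w M = ?M" using p by (simp add: relink_def Let_def)
  have hd: "w + 3 < ad w y" if "(w, y) \<in> E" for y using ad_bounds[OF that] ED[OF that] by simp
  have h: "?M (3 + w) = nxt w 0 (as @ bs)"
  proof (cases as rule: rev_cases)
    case Nil
    then show ?thesis using hd[of "hd bs"] E by (cases bs) (auto simp: prv_def)
  next
    case (snoc zs z)
    then have "(w, z) \<in> E" using E by auto
    then have "?M (3 + w) = M (3 + w)"
      using hd[of z] snoc E ad_nz[of w z] hd[of "hd bs"] by (cases bs) (auto simp: prv_def)
    then show ?thesis using M snoc by (cases zs) auto
  qed
  have s1: "dlseg ?M w 0 as ?a"
  proof (cases as rule: rev_cases)
    case (snoc zs z)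
    have z: "(w, z) \<in> E" "z \<notin> set zs" "\<forall>y \<in> set zs. (w, y) \<in> E" using E d snoc by auto
    have b: "?b = ad w z" "ad w z \<noteq> 0" using snoc ad_nz[OF z(1)] by (auto simp: prv_def)
    have 1: "dlseg M w 0 zs (ad w z)" "dlseg M w (prv w 0 zs) [z] (ad w v)"
      using M snoc by (auto simp: dlseg_append)
    have "?M (ad w y + a) = M (ad w y + a)" if "y \<in> set zs" "a < 4" for y a
    proof -
      have "(w, y) \<in> E" "y \<noteq> z" using that z by auto
      then have "ad w y + a \<noteq> ad w z + 1" using ad_eq[of w y w z a 1] z that by auto
      moreover have "ad w y + a \<noteq> ad w c + 2" if "bs = c # cs" for c cs
      proof -
        have "y \<noteq> c" using d snoc that \<open>y \<in> set zs\<close> by auto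
        then show ?thesis using ad_eq[of w y w c a 2] \<open>(w, y) \<in> E\<close> E that \<open>a < 4\<close> by auto
      qed
      ultimately show ?thesis using b by (cases bs) auto
    qed
    then have "dlseg ?M w 0 zs (ad w z)" using dlseg_cong[OF 1(1), of ?M] by blast
    moreover have "dlseg ?M w (prv w 0 zs) [z] ?a"
    proof -
      have "z \<noteq> c" if "bs = c # cs" for c cs using d snoc that by auto
      then show ?thesis using 1(2) b z E by (cases bs) auto
    qed
    ultimately show ?thesis using snoc by (simp add: dlseg_append)
  qed simp
  have s2: "dlseg ?M w ?b bs 0"
  proof (cases bs)
    case (Cons c cs)
    have c: "(w, c) \<in> E" "c \<notin> set cs" "\<forall>y \<in> set cs. (w, y) \<in> E" using E d Cons by auto
    have a: "?a = ad w c" "ad w c \<noteq> 0" using Cons ad_nz[OF c(1)] by auto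
    have 1: "dlseg M w (ad w c) cs 0" "M (ad w c) = c" "M (ad w c + 1) = nxt w 0 cs" "M (ad w c + 3) = ad c w"
      using M Cons by auto
    have o: "?M1 (ad w y + x) = M (ad w y + x)" if "y \<in> set bs" "x < 4" for y x
    proof (cases as rule: rev_cases)
      case Nil
      then show ?thesis using hd[of y] E that by (auto simp: prv_def)
    next
      case (snoc zs z)
      then have "(w, z) \<in> E" "y \<noteq> z" "(w, y) \<in> E" using E d that by auto
      then show ?thesis using snoc ad_eq[of w y w z x 1] that ad_nz[of w z] by (auto simp: prv_def)
    qed
    have "?M (ad w y + x) = M (ad w y + x)" if "y \<in> set cs" "x < 4" for y x
      using o[of y x] that a c ad_eq[of w y w c x 2] Cons by auto
    then have "dlseg ?M w (ad w c) cs 0" using dlseg_cong[OF 1(1), of ?M] by blast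
    moreover have "?M (ad w c) = c" "?M (ad w c + 1) = nxt w 0 cs" "?M (ad w c + 3) = ad c w" "?M (ad w c + 2) = ?b"
      using o[of c 0] o[of c 1] o[of c 3] a 1 Cons by auto
    ultimately show ?thesis using Cons by simp
  qed simp
  show ?thesis
    unfolding rm L reprv_def dlseg_append using h s1 s2 E d by auto
qed

text \<open>The principle of dancing links: unlinking leaves the pointers of the node itself intact
  (\<open>a'\<close>, \<open>b'\<close>), and each overwritten word used to hold the address of that
  node (\<open>bM\<close>, \<open>aM\<close>). Writing this address back therefore restores every
  word of the region.\<close>

lemma relink_unlink_relink:
  assumes "reprv xs w M" "v \<in> set xs" "w < n" "\<And>x. x \<in> region w \<Longrightarrow> M' x = relink True v w M x" "x \<in> region w"
  shows "relink False v w M' x = M x"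
proof -
  obtain as bs where xs: "xs = as @ v # bs" and v: "v \<notin> set as" using assms by (meson split_list_first)
  have r: "reprv (as @ v # bs) w M" using assms xs by simp
  note p = reprv_ptrs[OF r]
  have E: "(w, v) \<in> E" "\<forall>y \<in> set as. (w, y) \<in> E" "\<forall>y \<in> set bs. (w, y) \<in> E" and d: "distinct as" "distinct bs"
    "set as \<inter> set bs = {}" "v \<notin> set bs" and M: "M (3 + w) = nxt w 0 (as @ v # bs)"
    "dlseg M w 0 as (ad w v)" "dlseg M w (ad w v) bs 0"
    using r by (auto simp: reprv_def dlseg_append)
  let ?a = "nxt w 0 bs" and ?b = "prv w 0 as"
  let ?M1 = "M((if ?b = 0 then w + 3 else ?b + 1) := ?a)"
  let ?M = "if ?a = 0 then ?M1 else ?M1(?a + 2 := ?b)"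
  have L: "relink True v w M = ?M" using p by (simp add: relink_def Let_def)
  have hd: "w + 3 < ad w y" if "(w, y) \<in> E" for y using ad_bounds[OF that] ED[OF that] by simp
  have bM: "M (if ?b = 0 then w + 3 else ?b + 1) = ad w v"
  proof (cases as rule: rev_cases)
    case Nil
    then show ?thesis using M by (simp add: prv_def add.commute)
  next
    case (snoc zs z)
    then show ?thesis using M E ad_nz[of w z] by (auto simp: prv_def dlseg_append)
  qed
  have aM: "?a \<noteq> 0 \<Longrightarrow> M (?a + 2) = ad w v"
    using M by (cases bs) auto
  have a': "M' (ad w v + 1) = ?a"
  proof -
    have "ad w v + 1 \<noteq> (if ?b = 0 then w + 3 else ?b + 1)"
    proof (cases as rule: rev_cases)
      case (snoc zs z)
      then show ?thesis using E v ad_nz[of w z] ad_eq[of w v w z 1 1] by (auto simp: prv_def)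
    qed (use hd[OF E(1)] in \<open>auto simp: prv_def\<close>)
    moreover have "?a \<noteq> 0 \<Longrightarrow> ad w v + 1 \<noteq> ?a + 2"
      using E d by (cases bs) auto
    ultimately show ?thesis using assms(4)[of "ad w v + 1"] E L p by auto
  qed
  have b': "M' (ad w v + 2) = ?b"
  proof -
    have "ad w v + 2 \<noteq> (if ?b = 0 then w + 3 else ?b + 1)"
    proof (cases as rule: rev_cases)
      case (snoc zs z)
      then show ?thesis using E v ad_nz[of w z] ad_eq[of w v w z 2 1] by (auto simp: prv_def)
    qed (use hd[OF E(1)] in \<open>auto simp: prv_def\<close>)
    moreover have "?a \<noteq> 0 \<Longrightarrow> ad w v + 2 \<noteq> ?a + 2"
      using E d by (cases bs) auto
    ultimately show ?thesis using assms(4)[of "ad w v + 2"] E L p by auto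
  qed
  define c where "c = (if ?b = 0 then w + 3 else ?b + 1)"
  define a where "a = ?a"
  have "relink False v w M' = (if a = 0 then M'(c := ad w v) else (M'(c := ad w v))(a + 2 := ad w v))"
    using a' b' unfolding relink_def Let_def c_def a_def by simp
  moreover have "M' x = (if a = 0 then M(c := a) else (M(c := a))(a + 2 := ?b)) x"
    using assms(4)[OF assms(5)] unfolding L c_def a_def by simp
  moreover have "M c = ad w v" "a \<noteq> 0 \<Longrightarrow> M (a + 2) = ad w v"
    using aM bM unfolding c_def a_def by auto
  ultimately show ?thesis by (cases "x = c"; cases "x = a + 2"; cases "a = 0") auto
qed

end

section \<open>Deleting and restoring a vertex\<close>

text \<open>Register 17 points to the node of \<open>(v, w)\<close>, 21 holds \<open>w\<close>, 28
  points to the twin node in the list of \<open>w\<close>, and 26 and 27 are successor and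
  predecessor of the twin. Deletion and restoration differ only in the values stored.\<close>

definition walk_body :: "bool \<Rightarrow> com" where
  "walk_body del =
     Ins (LOAD 21 17) ;; Ins (ADD 22 17 3) ;; Ins (LOAD 28 22) ;;
     Ins (ADD 22 28 1) ;; Ins (LOAD 26 22) ;; Ins (ADD 22 28 2) ;; Ins (LOAD 27 22) ;;
     Cond 27 (Ins (ADD 22 27 1)) (Ins (ADD 22 21 3)) ;;
     Ins (STORE 22 (if del then 26 else 28)) ;;
     Cond 26 (Ins (ADD 22 26 2) ;; Ins (STORE 22 (if del then 27 else 28))) Skip ;;
     Ins (ADD 22 17 1) ;; Ins (LOAD 17 22)"

definition walk :: "bool \<Rightarrow> com" where
  "walk del = Ins (ADD 22 3 19) ;; Ins (LOAD 17 22) ;; Loop 17 (walk_body del)"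

definition copyS :: com where
  "copyS = For 16 13 (
      Ins (ADD 22 10 16) ;; Ins (LOAD 21 22) ;; Ins (ADD 22 9 16) ;; Ins (STORE 22 21) ;;
      Ins (ADD 22 7 21) ;; Ins (STORE 22 1)) ;;
    Ins (ADD 15 13 0) ;; Ins (LOADI 16 0) ;; Ins (LOADI 17 0)"

text \<open>Marks are reset along the queue, so a search pays for the vertices it has queued and not
  for all \<open>n\<close>.\<close>

definition unmarkQ :: com where
  "unmarkQ = For 16 15 (
      Ins (ADD 22 9 16) ;; Ins (LOAD 21 22) ;; Ins (ADD 22 7 21) ;; Ins (STORE 22 0))"

context gmem
begin

section \<open>Constant registers and work arrays\<close>

definition cregs :: "nat \<Rightarrow> (nat \<Rightarrow> nat) \<Rightarrow> bool" where
  "cregs qB R \<longleftrightarrow> R 0 = 0 \<and> R 1 = 1 \<and> R 2 = 2 \<and> R 3 = 3 \<and> R 4 = n \<and> R 5 = k \<and> R 6 = k - 1 \<and>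
     R 7 = D \<and> R 8 = D + n \<and> R 9 = qB \<and> R 10 = D + 3 * n \<and> R 11 = D + 4 * n \<and> R 12 = D + 5 * n"

lemma cregs_upd [simp]: "12 < i \<Longrightarrow> cregs qB (R(i := x)) = cregs qB R"
  by (auto simp: cregs_def)

lemma cregs_frame: "cregs qB R \<Longrightarrow> frame W R R' \<Longrightarrow> (\<And>r. r \<in> W \<Longrightarrow> 12 < r) \<Longrightarrow> cregs qB R'"
proof -
  assume A: "cregs qB R" "frame W R R'" "\<And>r. r \<in> W \<Longrightarrow> 12 < r"
  have "R' r = R r" if "r \<le> 12" for r using A(2,3) that unfolding frame_def by (meson not_less)
  then show ?thesis using A(1) unfolding cregs_def by simp
qed

lemma cregsD:
  assumes "cregs qB R"
  shows "R 0 = 0" "R (Suc 0) = 1" "R 2 = 2" "R 3 = 3" "R 4 = n" "R 5 = k" "R 6 = k - 1"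
     "R 7 = D" "R 8 = D + n" "R 9 = qB" "R 10 = D + 3 * n" "R 11 = D + 4 * n" "R 12 = D + 5 * n"
  using assms by (auto simp: cregs_def)

text \<open>The queue base \<open>qB\<close> is a parameter since the breadth-first search queues
  directly into the array of the root order; \<open>D + n + length ord \<le> qB\<close> keeps later
  queues from overwriting that order.\<close>

definition work :: "nat \<Rightarrow> nat set \<Rightarrow> nat list \<Rightarrow> nat list \<Rightarrow> nat list \<Rightarrow> nat list \<Rightarrow> nat list \<Rightarrow> (nat \<Rightarrow> nat) \<Rightarrow> bool"
  where
  "work qB mk ord qs ss tv tf M \<longleftrightarrow>
     (\<forall>v < n. M (D + v) = (if v \<in> mk then 1 else 0)) \<and> array M (D + n) ord \<and> array M qB qs \<and>
     array M (D + 3 * n) ss \<and> array M (D + 4 * n) tv \<and> array M (D + 5 * n) tf \<and>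
     D + n + length ord \<le> qB \<and> qB \<le> D + 2 * n \<and>
     length qs \<le> n \<and> length ss \<le> n \<and> length tv \<le> n \<and> length tf \<le> n"

lemma work_cong:
  assumes "work qB mk ord qs ss tv tf M" "\<And>x. D \<le> x \<Longrightarrow> M' x = M x"
  shows "work qB mk ord qs ss tv tf M'"
  using assms by (auto simp: work_def array_def)

lemma work_mark:
  assumes "work qB mk ord qs ss tv tf M" "v < n"
  shows "work qB (insert v mk) ord qs ss tv tf (M(D + v := Suc 0))"
  using assms by (auto simp: work_def array_upd)

lemma work_unmark:
  assumes "work qB mk ord qs ss tv tf M" "v < n"
  shows "work qB (mk - {v}) ord qs ss tv tf (M(D + v := 0))"
  using assms by (auto simp: work_def array_upd)

lemma work_snoc_q:
  assumes "work qB mk ord qs ss tv tf M" "length qs < n" "x = qB + length qs"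
  shows "work qB mk ord (qs @ [w]) ss tv tf (M(x := w))"
  using assms array_snoc[of M qB qs w] by (auto simp: work_def array_upd)

lemma work_snoc_s:
  assumes "work qB mk ord qs ss tv tf M" "length ss < n" "x = D + 3 * n + length ss"
  shows "work qB mk ord qs (ss @ [w]) tv tf (M(x := w))"
  using assms array_snoc[of M "D + 3 * n" ss w] by (auto simp: work_def array_upd)

lemma work_snoc_tv:
  assumes "work qB mk ord qs ss tv tf M" "length tv < n" "x = D + 4 * n + length tv"
  shows "work qB mk ord qs ss (tv @ [w]) tf (M(x := w))"
  using assms array_snoc[of M "D + 4 * n" tv w] by (auto simp: work_def array_upd)

lemma work_snoc_tf:
  assumes "work qB mk ord qs ss tv tf M" "length tf < n" "x = D + 5 * n + length tf"
  shows "work qB mk ord qs ss tv (tf @ [w]) (M(x := w))"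
  using assms array_snoc[of M "D + 5 * n" tf w] by (auto simp: work_def array_upd)

lemma work_prefix:
  assumes "work qB mk ord (qs @ qs') (ss @ ss') (tv @ tv') (tf @ tf') M"
  shows "work qB mk ord qs ss tv tf M"
  using assms by (auto simp: work_def dest: array_prefix)

lemma work_nth:
  assumes "work qB mk ord qs ss tv tf M"
  shows "v < n \<Longrightarrow> M (D + v) = (if v \<in> mk then 1 else 0)" "i < length ord \<Longrightarrow> M (D + n + i) = ord ! i"
    "i < length qs \<Longrightarrow> M (qB + i) = qs ! i" "i < length ss \<Longrightarrow> M (D + 3 * n + i) = ss ! i"
    "i < length tv \<Longrightarrow> M (D + 4 * n + i) = tv ! i" "i < length tf \<Longrightarrow> M (D + 5 * n + i) = tf ! i"
  using assms by (auto simp: work_def array_def)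

lemma work_bounds:
  assumes "work qB mk ord qs ss tv tf M"
  shows "D + n \<le> qB" "qB \<le> D + 2 * n" "length qs \<le> n" "length ss \<le> n" "length tv \<le> n" "length tf \<le> n"
  using assms by (auto simp: work_def)

lemma wp_walk:
  assumes R: "R 3 = 3" "R 2 = 2" "R (Suc 0) = 1" "R 19 = v"
    and v: "v < n" "reprv ws v M"
    and ptrs: "\<And>w. w \<in> set ws \<Longrightarrow> listptr w (M (ad w v + 1)) \<and> listptr w (M (ad w v + 2))"
    and post: "\<And>R' M' t'. frame {17, 21, 22, 26, 27, 28} R R' \<Longrightarrow> t' \<le> t + 5 + 20 * length ws \<Longrightarrow>
        (\<And>x. (\<And>w. w \<in> set ws \<Longrightarrow> x \<notin> region w) \<Longrightarrow> M' x = M x) \<Longrightarrow>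
        (\<And>w x. w \<in> set ws \<Longrightarrow> x \<in> region w \<Longrightarrow> M' x = relink del v w M x) \<Longrightarrow> Q R' M' Z t'"
  shows "wp (walk del) Q R M Z t"
proof -
  let ?W = "{17, 21, 22, 26, 27, 28 :: nat}"
  have ws: "distinct ws" "\<And>w. w \<in> set ws \<Longrightarrow> (v, w) \<in> E" "M (3 + v) = nxt v 0 ws" "dlseg M v 0 ws 0"
    using v by (auto simp: reprv_def)
  define I where "I = (\<lambda>(dn, rs) R' M' Z'. ws = dn @ rs \<and> R' 17 = nxt v 0 rs \<and> Z' = Z \<and> frame ?W R R' \<and>
     (\<forall>x. (\<forall>w \<in> set dn. x \<notin> region w) \<longrightarrow> M' x = M x) \<and>
     (\<forall>w \<in> set dn. \<forall>x \<in> region w. M' x = relink del v w M x))"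
  let ?f = "\<lambda>(dn, rs). 20 * length (rs :: nat list)"
  have nb: "nxt v 0 ws \<le> B"
    using ws(2) ad_bounds D_bounds by (cases ws) fastforce+
  have "wp (Loop 17 (walk_body del)) Q (R(22 := 3 + v, 17 := nxt v 0 ws)) M Z (t + 2)"
  proof (rule wp_Loop[where I = I and f = ?f and g = "([], ws)"])
    show "I ([], ws) (R(22 := 3 + v, 17 := nxt v 0 ws)) M Z"
      by (auto simp: I_def frame_def)
  next
    fix g' R' M' Z' t'
    assume "I g' R' M' Z'" "R' 17 = 0" and t: "t' + ?f g' \<le> t + 2 + ?f ([], ws) + 1"
    moreover obtain dn rs where g': "g' = (dn, rs)" by fastforce
    ultimately have I: "ws = dn @ rs" "nxt v 0 rs = 0" "frame ?W R R'" "Z' = Z"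
      "\<forall>x. (\<forall>w \<in> set dn. x \<notin> region w) \<longrightarrow> M' x = M x" "\<forall>w \<in> set dn. \<forall>x \<in> region w. M' x = relink del v w M x"
      by (auto simp: I_def)
    have "rs = []" using I(1,2) ws(2) ad_nz by (cases rs) auto
    then show "Q R' M' Z' t'" using post[of R' t' M'] I t g' by auto
  next
    fix g R' M' Z' t' P
    assume I0: "I g R' M' Z'" and R17: "R' 17 \<noteq> 0"
      and P: "\<And>g' R'' M'' Z'' t''. I g' R'' M'' Z'' \<Longrightarrow> ?f g' < ?f g \<Longrightarrow> t'' + 2 + ?f g' \<le> t' + ?f g \<Longrightarrow>
        P R'' M'' Z'' t''"
    obtain dn rs where g: "g = (dn, rs)" by fastforce
    have I: "ws = dn @ rs" "R' 17 = nxt v 0 rs" "frame ?W R R'" "Z' = Z"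
      "\<And>x. (\<And>w. w \<in> set dn \<Longrightarrow> x \<notin> region w) \<Longrightarrow> M' x = M x"
      "\<And>w x. w \<in> set dn \<Longrightarrow> x \<in> region w \<Longrightarrow> M' x = relink del v w M x"
      using I0 g by (auto simp: I_def)
    obtain w rs' where rs: "rs = w # rs'" using I(2) R17 by (cases rs) auto
    have E: "(v, w) \<in> E" "(w, v) \<in> E" "w < n" "v \<noteq> w" using ws(2)[of w] I(1) rs ED by auto
    have dn: "x \<in> set dn \<Longrightarrow> x \<noteq> w \<and> x \<noteq> v \<and> x < n" for x
      using ws(1,2) I(1) rs ED by fastforce
    \<comment> \<open>The list being walked lies in \<open>region v\<close>, while all changes are
      in regions of neighbours of \<open>v\<close>; so the walk does not disturb its own
      path.\<close>
    have Mv: "x \<in> region v \<Longrightarrow> M' x = M x" for x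
      by (rule I(5)) (use dn region_disj v(1) in blast)
    have Mw: "x \<in> region w \<Longrightarrow> M' x = M x" for x
      by (rule I(5)) (use dn region_disj E(3) in blast)
    have sg: "dlseg M v (prv v 0 dn) (w # rs') 0" using ws(4) I(1) rs by (simp add: dlseg_append)
    have m: "M' (ad v w) = w" "M' (ad v w + 3) = ad w v" "M (Suc (ad v w)) = nxt v 0 rs'"
      using sg Mv E by auto
    define a b where "a = M' (Suc (ad w v))" and "b = M' (Suc (Suc (ad w v)))"
    have "a = M (ad w v + 1)" "b = M (ad w v + 2)" unfolding a_def b_def using Mw E by auto
    then have p: "listptr w a" "listptr w b" using ptrs[of w] I(1) rs by auto
    have "w \<in> set ws" using I(1) rs by simp
    have ptrb: "x + 3 < D" if "listptr w x" for x
      using that ad_bounds[of w] D_bounds n0 unfolding listptr_def by (auto simp: D_def)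
    have bounds: "ad v w + 3 < D" "ad w v + 3 < D" "a + 3 < D" "b + 3 < D" "w < D"
      using ad_bounds E ptrb p D_bounds by auto
    have R': "R' 3 = 3" "R' 2 = 2" "R' (Suc 0) = 1" "R' 17 = ad v w"
      using I(2) rs R by (auto simp: frameD[OF I(3)])
    let ?N = "relink del v w M'"
    have loc: "x \<notin> region w \<Longrightarrow> ?N x = M' x" for x
      using relink_local[of w M' v x del] p unfolding a_def b_def by simp
    have N1: "?N (Suc (ad v w)) = nxt v 0 rs'"
    proof -
      have "Suc (ad v w) \<notin> region w" using region_disj[of "Suc (ad v w)" v w] E v(1) by auto
      then show ?thesis using loc m Mv E by simp
    qed
    have N2: "(\<forall>y \<in> set (dn @ [w]). x \<notin> region y) \<Longrightarrow> ?N x = M x" for x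
      using loc[of x] I(5)[of x] by auto
    have N3: "?N x = relink del v y M x" if "y \<in> set (dn @ [w])" "x \<in> region y" for x y
    proof (cases "y = w")
      case True
      then show ?thesis using relink_cong[OF E(2), of M' M x del] Mw that by simp
    next
      case False
      then have "y \<in> set dn" "x \<notin> region w" using that region_disj[of x y w] dn[of y] E(3) by auto
      then show ?thesis using I(6) loc that by simp
    qed
    have Nb: "nxt v 0 rs' \<le> B"
      using ws(2) I(1) rs ad_bounds[of v "hd rs'"] D_bounds by (cases rs') auto
    have Neq: "?N = (if a = 0 then M'((if b = 0 then w + 3 else Suc b) := (if del then a else ad w v))
      else M'((if b = 0 then w + 3 else Suc b) := (if del then a else ad w v),
           Suc (Suc a) := (if del then b else ad w v)))"
      unfolding relink_def Let_def a_def b_def by simp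
    define T where "T = wp (Ins (ADD 22 17 1)) (wp (Ins (LOAD 17 22)) P)"
    have fin: "P R'' ?N Z' t''"
      if "frame ?W R' R''" "R'' 17 = nxt v 0 rs'" "t'' \<le> t' + 17" for R'' t''
    proof (rule P[of "(dn @ [w], rs')"])
      show "I (dn @ [w], rs') R'' ?N Z'"
        using I(1,4) rs that N2 N3 frame_trans[OF I(3) that(1), of ?W] unfolding I_def by auto
    qed (use g rs that in auto)
    have T: "T R2 N Z' t2" if "N = ?N" "frame {21, 22, 26, 27, 28} R' R2" "t2 \<le> t' + 15" for R2 N t2
    proof -
      have "frame ?W R' (R2(22 := Suc (ad v w), 17 := nxt v 0 rs'))"
        using that(2) by (auto simp: frame_def)
      then show ?thesis using that R' N1 Nb bounds D_bounds
        by (simp add: T_def frameD[OF that(2)] fin)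
    qed
    show "wp (walk_body del) P R' M' Z' t'"
      unfolding walk_body_def wp.simps(3) T_def[symmetric]
      using R' m bounds E(3) D_bounds a_def[symmetric] b_def[symmetric]
      by (cases "a = 0"; cases "b = 0"; cases del)
        (simp_all add: T[unfolded Neq] frame_def)
  qed
  then show ?thesis
    using R ws(3) nb v(1) D_bounds by (simp add: walk_def numeral_2_eq_2 add.commute)
qed

text \<open>The exact effect of a deletion on the graph part of the memory. It is kept as a fact
  while the subtree below the deletion is enumerated and is what the restoration inverts.\<close>

definition unlinked :: "nat \<Rightarrow> nat list \<Rightarrow> (nat \<Rightarrow> nat) \<Rightarrow> (nat \<Rightarrow> nat) \<Rightarrow> bool" where
  "unlinked v ws M M' \<longleftrightarrow> (\<forall>x < D. (\<forall>w \<in> set ws. x \<notin> region w) \<longrightarrow> M' x = M x) \<and>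
     (\<forall>w \<in> set ws. \<forall>x \<in> region w. M' x = relink True v w M x)"

text \<open>
  The list of \<open>v\<close> itself stays as it is: the restoration of \<open>v\<close> walks along it.
\<close>

definition deladj :: "nat \<Rightarrow> (nat \<Rightarrow> nat list) \<Rightarrow> nat \<Rightarrow> nat list" where
  "deladj v adj u = (if u \<in> set (adj v) then remove1 v (adj u) else adj u)"

lemma repr_E: "repr adj M \<Longrightarrow> v < n \<Longrightarrow> w \<in> set (adj v) \<Longrightarrow> (v, w) \<in> E"
  by (simp add: repr_def reprv_def)

lemma repr_deladj:
  assumes "repr adj M" "unlinked v (adj v) M M'" "v < n" "\<And>w. w \<in> set (adj v) \<Longrightarrow> v \<in> set (adj w)"
  shows "repr (deladj v adj) M'"
  unfolding repr_def
proof (intro allI impI)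
  fix u assume u: "u < n"
  have r: "reprv (adj u) u M" using assms u by (simp add: repr_def)
  have lt: "w \<in> set (adj v) \<Longrightarrow> w < n" for w
    using ED[OF repr_E[OF assms(1,3)]] by blast
  show "reprv (deladj v adj u) u M'"
  proof (cases "u \<in> set (adj v)")
    case True
    then have "reprv (remove1 v (adj u)) u (relink True v u M)"
      using reprv_unlink[OF r _ u] assms(4) by blast
    then have "reprv (remove1 v (adj u)) u M'"
      by (rule reprv_cong) (use assms(2) True in \<open>auto simp: unlinked_def\<close>)
    then show ?thesis using True by (simp add: deladj_def)
  next
    case False
    have "M' x = M x" if "x \<in> region u" for x
      using assms(2) that False u lt region_disj[of x u] region_low[OF that u] unfolding unlinked_def by blast
    then show ?thesis using False reprv_cong[OF r] by (simp add: deladj_def)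
  qed
qed

lemma wp_delete:
  assumes "cregs qB R" "R 19 = v" "v < n" "repr adj M" "\<And>w. w \<in> set (adj v) \<Longrightarrow> v \<in> set (adj w)"
    and post: "\<And>R' M' t'. frame {17, 21, 22, 26, 27, 28} R R' \<Longrightarrow>
        t' \<le> t + 5 + 20 * length (adj v) \<Longrightarrow> unlinked v (adj v) M M' \<Longrightarrow> (\<And>x. D \<le> x \<Longrightarrow> M' x = M x) \<Longrightarrow>
        Q R' M' Z t'"
  shows "wp (walk True) Q R M Z t"
proof (rule wp_walk[where v = v and ws = "adj v"])
  have lt: "w \<in> set (adj v) \<Longrightarrow> w < n" for w
    using ED[OF repr_E[OF assms(4,3)]] by blast
  show "reprv (adj v) v M" using assms by (simp add: repr_def)
  show "listptr w (M (ad w v + 1)) \<and> listptr w (M (ad w v + 2))" if "w \<in> set (adj v)" for w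
    using listptr_repv[of "adj w" w M v] assms(4,5) lt that by (simp add: repr_def)
  show "Q R' M' Z t'" if A: "frame {17, 21, 22, 26, 27, 28} R R'" "t' \<le> t + 5 + 20 * length (adj v)"
    "\<And>x. (\<And>w. w \<in> set (adj v) \<Longrightarrow> x \<notin> region w) \<Longrightarrow> M' x = M x"
    "\<And>w x. w \<in> set (adj v) \<Longrightarrow> x \<in> region w \<Longrightarrow> M' x = relink True v w M x" for R' M' t'
  proof (rule post)
    show "unlinked v (adj v) M M'" using A by (simp add: unlinked_def)
    show "M' x = M x" if "D \<le> x" for x
      by (rule A(3)) (use lt region_low that in force)
  qed fact+
qed (use assms in \<open>auto simp: cregs_def\<close>)

text \<open>\<open>M0\<close> is the memory before the deletion of \<open>v\<close> and
  \<open>M1\<close> the one right after it. The current memory agrees with \<open>M1\<close> on the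
  graph part once all later deletions have been undone.\<close>

lemma wp_undelete:
  assumes "cregs qB R" "R 19 = v" "v < n" "repr adj M0" "\<And>w. w \<in> set (adj v) \<Longrightarrow> v \<in> set (adj w)"
    "unlinked v (adj v) M0 M1" "\<And>x. x < D \<Longrightarrow> M x = M1 x"
    and post: "\<And>R' M' t'. frame {17, 21, 22, 26, 27, 28} R R' \<Longrightarrow>
        t' \<le> t + 5 + 20 * length (adj v) \<Longrightarrow> (\<And>x. x < D \<Longrightarrow> M' x = M0 x) \<Longrightarrow>
        (\<And>x. D \<le> x \<Longrightarrow> M' x = M x) \<Longrightarrow> Q R' M' Z t'"
  shows "wp (walk False) Q R M Z t"
proof -
  have Ew: "w \<in> set (adj v) \<Longrightarrow> w < n \<and> (v, w) \<in> E \<and> (w, v) \<in> E \<and> v \<noteq> w" for w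
    using ED[OF repr_E[OF assms(4,3)]] repr_E[OF assms(4,3)] by blast
  have low: "w \<in> set (adj v) \<Longrightarrow> x \<in> region w \<Longrightarrow> M x = relink True v w M0 x" for w x
    using assms(6,7) Ew region_low unfolding unlinked_def by metis
  have rw: "w \<in> set (adj v) \<Longrightarrow> reprv (adj w) w M0" for w using assms(4) Ew by (simp add: repr_def)
  \<comment> \<open>Unlinking writes into nodes of other neighbours of \<open>w\<close> or into the
    list head, never into the node of \<open>(w, v)\<close>, which still tells its place.\<close>
  have nodes: "M (ad w v + 1) = M0 (ad w v + 1) \<and> M (ad w v + 2) = M0 (ad w v + 2)"
    if w: "w \<in> set (adj v)" for w
  proof -
    let ?a = "M0 (ad w v + 1)" and ?b = "M0 (ad w v + 2)"
    obtain as bs where xs: "adj w = as @ v # bs" using assms(5)[OF w] by (meson split_list)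
    have p: "?a = nxt w 0 bs" "?b = prv w 0 as" using reprv_ptrs[of as v bs w M0] rw[OF w] xs by auto
    have E: "(w, v) \<in> E" "\<forall>y \<in> set as. (w, y) \<in> E \<and> y \<noteq> v" "\<forall>y \<in> set bs. (w, y) \<in> E \<and> y \<noteq> v"
      using rw[OF w] xs by (auto simp: reprv_def)
    have h: "ad w v > w + 3" using ad_bounds[OF E(1)] ED[OF E(1)] by simp
    have b: "?b = 0 \<or> (\<exists>y. ?b = ad w y \<and> (w, y) \<in> E \<and> y \<noteq> v)" using p E by (auto simp: prv_def)
    have a: "?a = 0 \<or> (\<exists>y. ?a = ad w y \<and> (w, y) \<in> E \<and> y \<noteq> v)" using p E by (cases bs) auto
    have "relink True v w M0 (ad w v + 1) = ?a" "relink True v w M0 (ad w v + 2) = ?b"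
      using a b h E(1) ad_nz unfolding relink_def Let_def by auto
    then show ?thesis using low[OF w, of "ad w v + 1"] low[OF w, of "ad w v + 2"] E(1) by simp
  qed
  show ?thesis
  proof (rule wp_walk[where v = v and ws = "adj v"])
    have "M x = M0 x" if "x \<in> region v" for x
      using assms(3,6,7) that Ew region_disj[of x v] region_low[of x v] unfolding unlinked_def by metis
    then show "reprv (adj v) v M" using reprv_cong[of "adj v" v M0 M] assms(3,4) by (simp add: repr_def)
    show "listptr w (M (ad w v + 1)) \<and> listptr w (M (ad w v + 2))" if "w \<in> set (adj v)" for w
      using listptr_repv[of "adj w" w M0 v] assms(5) rw nodes that by simp
    show "Q R' M' Z t'" if A: "frame {17, 21, 22, 26, 27, 28} R R'" "t' \<le> t + 5 + 20 * length (adj v)"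
      "\<And>x. (\<And>w. w \<in> set (adj v) \<Longrightarrow> x \<notin> region w) \<Longrightarrow> M' x = M x"
      "\<And>w x. w \<in> set (adj v) \<Longrightarrow> x \<in> region w \<Longrightarrow> M' x = relink False v w M x" for R' M' t'
    proof (rule post)
      show "M' x = M x" if "D \<le> x" for x
        by (rule A(3)) (use Ew region_low that in force)
      show "M' x = M0 x" if "x < D" for x
      proof (cases "\<exists>w \<in> set (adj v). x \<in> region w")
        case True
        then obtain w where w: "w \<in> set (adj v)" "x \<in> region w" by blast
        then show ?thesis
          using relink_unlink_relink[OF rw[OF w(1)] assms(5)[OF w(1)] _ low[OF w(1)] w(2)] Ew A(4) by simp
      next
        case False
        then show ?thesis using A(3) assms(6,7) that unfolding unlinked_def by metis
      qed
    qed (use A in auto)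
  qed (use assms in \<open>auto simp: cregs_def\<close>)
qed

end

section \<open>Graph search\<close>

text \<open>One program for two purposes. With \<open>lr = 15\<close>, the growing length of the
  queue, it searches until the queue is exhausted; with \<open>lr = 13\<close>, the size of
  \<open>T\<close>, it scans only the lists of \<open>T\<close> and so appends just the neighbours
  of \<open>T\<close>.\<close>

definition expand_body :: "nat \<Rightarrow> com" where
  "expand_body lr = Cond 17
     (Ins (LOAD 21 17) ;; Ins (ADD 22 17 1) ;; Ins (LOAD 17 22) ;; Ins (ADD 22 7 21) ;; Ins (LOAD 23 22) ;;
      Cond 23 Skip
        (Ins (STORE 22 1) ;; Ins (ADD 22 9 15) ;; Ins (STORE 22 21) ;; Ins (ADD 15 15 1)))
     (Ins (SUB 23 lr 16) ;;
      Cond 23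
        (Ins (ADD 22 9 16) ;; Ins (LOAD 21 22) ;; Ins (ADD 22 21 3) ;; Ins (LOAD 17 22) ;; Ins (ADD 16 16 1))
        (Ins (LOADI 20 0)))"

definition expand :: "nat \<Rightarrow> com" where
  "expand lr = Ins (LOADI 20 1) ;; Loop 20 (expand_body lr)"

context gmem
begin

lemma wp_copyS:
  assumes c: "cregs qB R" and R: "R 13 = length ss" and a: "work qB {} ord qs ss tv tf M"
    and ss: "set ss \<subseteq> {..<n}"
    and post: "\<And>R' M' t'. frame {15, 16, 17, 21, 22, 31} R R' \<Longrightarrow> R' 15 = length ss \<Longrightarrow> R' 16 = 0 \<Longrightarrow>
      R' 17 = 0 \<Longrightarrow> t' \<le> t + 6 + 10 * length ss \<Longrightarrow> work qB (set ss) ord ss ss tv tf M' \<Longrightarrow>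
      (\<And>x. x < D \<Longrightarrow> M' x = M x) \<Longrightarrow> Q R' M' Z t'"
  shows "wp copyS Q R M Z t"
  unfolding copyS_def wp.simps(3)
proof (rule wp_For[where L = "length ss" and d = 6 and
      J = "\<lambda>x R' M' Z'. frame {16, 21, 22, 31} R R' \<and> Z' = Z \<and>
        work qB (set (take x ss)) ord (take x ss) ss tv tf M' \<and> (\<forall>y < D. M' y = M y)"])
  note b = work_bounds[OF a] D_bounds
  show "R 1 = 1" "length ss \<le> B" using c b by (auto simp: cregs_def)
  have "work qB {} ord [] ss tv tf M" using work_prefix[of qB "{}" ord "[]" qs ss "[]" tv "[]" tf "[]" M] a by simp
  then show "frame {16, 21, 22, 31} R (R(16 := 0, 31 := length ss)) \<and> Z = Z \<and>
      work qB (set (take 0 ss)) ord (take 0 ss) ss tv tf M \<and> (\<forall>y < D. M y = M y)"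
    by (auto simp: frame_def)
next
  fix x R1 M1 Z1 t1
  assume x: "x < length ss" and J: "frame {16, 21, 22, 31} R R1 \<and> Z1 = Z \<and>
      work qB (set (take x ss)) ord (take x ss) ss tv tf M1 \<and> (\<forall>y < D. M1 y = M y)"
    and R1: "R1 16 = x" "R1 13 = length ss" "R1 1 = 1"
  have c1: "cregs qB R1" using J by (intro cregs_frame[OF c, of _ R1]) auto
  have a1: "work qB (set (take x ss)) ord (take x ss) ss tv tf M1" using J by simp
  have v: "ss ! x < n" using ss x by (meson lessThan_iff nth_mem subsetD)
  note b = work_bounds[OF a1] D_bounds
  have r: "M1 (D + 3 * n + x) = ss ! x" using work_nth(4)[OF a1] x by simp
  have "work qB (insert (ss ! x) (set (take x ss))) ord (take x ss @ [ss ! x]) ss tv tf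
     (M1(qB + x := ss ! x, D + ss ! x := Suc 0))"
    using x b by (intro work_mark work_snoc_q a1 v) auto
  then have a2: "work qB (set (take (Suc x) ss)) ord (take (Suc x) ss) ss tv tf
     (M1(qB + x := ss ! x, D + ss ! x := Suc 0))"
    using x by (simp add: take_Suc_conv_app_nth)
  show "wp (Ins (ADD 22 10 16) ;; Ins (LOAD 21 22) ;; Ins (ADD 22 9 16) ;; Ins (STORE 22 21) ;;
      Ins (ADD 22 7 21) ;; Ins (STORE 22 1)) (\<lambda>R' M' Z' t'. t' \<le> t1 + 6 \<and> R' 16 = x \<and> R' 13 = length ss \<and> R' 1 = 1 \<and>
        frame {16, 21, 22, 31} R (R'(16 := x + 1, 31 := length ss - (x + 1))) \<and> Z' = Z \<and>
        work qB (set (take (x + 1) ss)) ord (take (x + 1) ss) ss tv tf M' \<and> (\<forall>y < D. M' y = M y)) R1 M1 Z1 t1"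
    using R1 x b v J a2 by (simp add: cregsD[OF c1] r frame_def)
next
  fix R1 M1 Z1 t1
  assume J: "frame {16, 21, 22, 31} R R1 \<and> Z1 = Z \<and>
      work qB (set (take (length ss) ss)) ord (take (length ss) ss) ss tv tf M1 \<and> (\<forall>y < D. M1 y = M y)"
    and t1: "t1 \<le> t + 3 + (6 + 4) * length ss"
  have c1: "cregs qB R1" using J by (intro cregs_frame[OF c, of _ R1]) auto
  have b: "length ss \<le> B" using work_bounds[OF a] D_bounds by simp
  have s: "R1 13 = length ss" using J R by (simp add: frame_def)
  have "Q (R1(15 := length ss, 16 := 0, 17 := 0)) M1 Z (Suc (Suc (Suc t1)))"
    by (rule post) (use J t1 in \<open>auto simp: frame_def\<close>)
  then show "wp (Ins (ADD 15 13 0)) (wp (Ins (LOADI 16 0)) (wp (Ins (LOADI 17 0)) Q)) R1 M1 Z1 t1"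
    using J s b by (simp add: cregsD[OF c1])
qed (use c R in \<open>auto simp: cregs_def\<close>)

lemma wp_unmarkQ:
  assumes c: "cregs qB R" and R: "R 15 = length qs" and a: "work qB mk ord qs ss tv tf M"
    and qs: "set qs \<subseteq> {..<n}"
    and post: "\<And>R' M' t'. frame {16, 21, 22, 31} R R' \<Longrightarrow>
      t' \<le> t + 3 + 8 * length qs \<Longrightarrow> work qB (mk - set qs) ord qs ss tv tf M' \<Longrightarrow>
      (\<And>x. x < D \<Longrightarrow> M' x = M x) \<Longrightarrow> Q R' M' Z t'"
  shows "wp unmarkQ Q R M Z t"
  unfolding unmarkQ_def
proof (rule wp_For[where L = "length qs" and d = 4 and
      J = "\<lambda>x R' M' Z'. frame {16, 21, 22, 31} R R' \<and> Z' = Z \<and>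
        work qB (mk - set (take x qs)) ord qs ss tv tf M' \<and> (\<forall>y < D. M' y = M y)"])
  note b = work_bounds[OF a] D_bounds
  show "R 1 = 1" "length qs \<le> B" using c b by (auto simp: cregs_def)
  show "frame {16, 21, 22, 31} R (R(16 := 0, 31 := length qs)) \<and> Z = Z \<and>
      work qB (mk - set (take 0 qs)) ord qs ss tv tf M \<and> (\<forall>y < D. M y = M y)"
    using a by (auto simp: frame_def)
next
  fix x R1 M1 Z1 t1
  assume x: "x < length qs" and J: "frame {16, 21, 22, 31} R R1 \<and> Z1 = Z \<and>
      work qB (mk - set (take x qs)) ord qs ss tv tf M1 \<and> (\<forall>y < D. M1 y = M y)"
    and R1: "R1 16 = x" "R1 15 = length qs" "R1 1 = 1"
  have c1: "cregs qB R1" using J by (intro cregs_frame[OF c, of _ R1]) auto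
  have a1: "work qB (mk - set (take x qs)) ord qs ss tv tf M1" using J by simp
  have v: "qs ! x < n" using qs x by (meson lessThan_iff nth_mem subsetD)
  note b = work_bounds[OF a1] D_bounds
  have r: "M1 (qB + x) = qs ! x" using work_nth(3)[OF a1] x by simp
  have "mk - set (take (Suc x) qs) = mk - set (take x qs) - {qs ! x}"
    using x by (auto simp: take_Suc_conv_app_nth)
  then have a2: "work qB (mk - set (take (Suc x) qs)) ord qs ss tv tf (M1(D + qs ! x := 0))"
    using work_unmark[OF a1 v] by simp
  show "wp (Ins (ADD 22 9 16) ;; Ins (LOAD 21 22) ;; Ins (ADD 22 7 21) ;; Ins (STORE 22 0))
      (\<lambda>R' M' Z' t'. t' \<le> t1 + 4 \<and> R' 16 = x \<and> R' 15 = length qs \<and> R' 1 = 1 \<and>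
        frame {16, 21, 22, 31} R (R'(16 := x + 1, 31 := length qs - (x + 1))) \<and> Z' = Z \<and>
        work qB (mk - set (take (x + 1) qs)) ord qs ss tv tf M' \<and> (\<forall>y < D. M' y = M y)) R1 M1 Z1 t1"
    using R1 x b v J a2 by (simp add: cregsD[OF c1] r frame_def)
next
  fix R1 M1 Z1 t1
  assume J: "frame {16, 21, 22, 31} R R1 \<and> Z1 = Z \<and>
      work qB (mk - set (take (length qs) qs)) ord qs ss tv tf M1 \<and> (\<forall>y < D. M1 y = M y)"
    and t1: "t1 \<le> t + 3 + (4 + 4) * length qs"
  show "Q R1 M1 Z1 t1"
    using post[of R1 t1 M1] J t1 by auto
qed (use c R in \<open>auto simp: cregs_def\<close>)

text \<open>The lists of deleted vertices are left open: they are frozen in the state they had at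
  the time of deletion.\<close>

definition active :: "nat set \<Rightarrow> (nat \<Rightarrow> nat list) \<Rightarrow> bool" where
  "active A adj \<longleftrightarrow> A \<subseteq> {..<n} \<and> (\<forall>u \<in> A. set (adj u) = {w \<in> A. (u, w) \<in> E})"

text \<open>The first \<open>i\<close> vertices of the queue have been taken up, and
  \<open>rs\<close> is the part of the list of \<open>cur\<close> still to be scanned. The last
  conjunct gives every new vertex an earlier neighbour in the queue; it yields the connected
  prefixes of the root order and shows that the fan consists of neighbours of
  \<open>T\<close>.\<close>

definition expanded ::
  "nat set \<Rightarrow> (nat \<Rightarrow> nat list) \<Rightarrow> nat list \<Rightarrow> nat list \<Rightarrow> nat \<Rightarrow> nat \<Rightarrow> nat list \<Rightarrow> bool" where
  "expanded A adj Q0 Q i cur rs \<longleftrightarrow>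
     (\<exists>xs. Q = Q0 @ xs) \<and> distinct Q \<and> set Q \<subseteq> A \<and> i \<le> length Q \<and>
     (rs \<noteq> [] \<longrightarrow> cur \<in> set (take i Q) \<and> (\<exists>dn. adj cur = dn @ rs)) \<and>
     (\<forall>u \<in> set (take i Q). set (adj u) \<subseteq> set Q \<union> (if u = cur then set rs else {})) \<and>
     (\<forall>l. length Q0 \<le> l \<longrightarrow> l < length Q \<longrightarrow> (\<exists>l' < l. l' < i \<and> Q ! l \<in> set (adj (Q ! l'))))"

lemma expanded_seen: "expanded A adj Q0 Q i cur (w # rs) \<Longrightarrow> w \<in> set Q \<Longrightarrow> expanded A adj Q0 Q i cur rs"
  unfolding expanded_def by (auto split: if_splits)

lemma expanded_new:
  assumes "expanded A adj Q0 Q i cur (w # rs)" "w \<notin> set Q" "w \<in> A"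
  shows "expanded A adj Q0 (Q @ [w]) i cur rs"
  unfolding expanded_def
proof (intro conjI)
  note A = assms(1)[unfolded expanded_def]
  have i: "i \<le> length Q" using A by blast
  then have tk: "take i (Q @ [w]) = take i Q" by simp
  have cur: "cur \<in> set (take i Q)" "\<exists>dn. adj cur = dn @ w # rs" using A by auto
  then obtain l0 where l0: "l0 < i" "Q ! l0 = cur" using i by (auto simp: in_set_conv_nth)
  show "\<exists>xs. Q @ [w] = Q0 @ xs" using A by auto
  show "distinct (Q @ [w])" "set (Q @ [w]) \<subseteq> A" "i \<le> length (Q @ [w])" using A assms by auto
  show "rs \<noteq> [] \<longrightarrow> cur \<in> set (take i (Q @ [w])) \<and> (\<exists>dn. adj cur = dn @ rs)"
    using cur tk by (metis append.assoc append_Cons append_Nil)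
  show "\<forall>u\<in>set (take i (Q @ [w])). set (adj u) \<subseteq> set (Q @ [w]) \<union> (if u = cur then set rs else {})"
    unfolding tk using A by (auto split: if_splits)
  show "\<forall>l\<ge>length Q0. l < length (Q @ [w]) \<longrightarrow>
     (\<exists>l'<l. l' < i \<and> (Q @ [w]) ! l \<in> set (adj ((Q @ [w]) ! l')))"
  proof (intro allI impI)
    fix l assume l: "length Q0 \<le> l" "l < length (Q @ [w])"
    show "\<exists>l'<l. l' < i \<and> (Q @ [w]) ! l \<in> set (adj ((Q @ [w]) ! l'))"
    proof (cases "l < length Q")
      case True
      then obtain l' where "l' < l" "l' < i" "Q ! l \<in> set (adj (Q ! l'))" using A l by blast
      then show ?thesis using True by (intro exI[of _ l']) (simp add: nth_append)
    next
      case False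
      then have "l = length Q" using l by simp
      then show ?thesis using l0 i cur by (intro exI[of _ l0]) (auto simp: nth_append)
    qed
  qed
qed

lemma expanded_next:
  assumes "expanded A adj Q0 Q i cur []" "i < length Q"
  shows "expanded A adj Q0 Q (Suc i) (Q ! i) (adj (Q ! i))"
proof -
  have "\<forall>l. length Q0 \<le> l \<longrightarrow> l < length Q \<longrightarrow> (\<exists>l' < l. l' < Suc i \<and> Q ! l \<in> set (adj (Q ! l')))"
    using assms unfolding expanded_def by (meson less_SucI)
  then show ?thesis
    using assms unfolding expanded_def by (auto simp: take_Suc_conv_app_nth split: if_splits)
qed

lemma expanded_init: "distinct Q0 \<Longrightarrow> set Q0 \<subseteq> A \<Longrightarrow> expanded A adj Q0 Q0 0 0 []"
  by (auto simp: expanded_def)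

lemma repr_seg:
  assumes "repr adj M" "u < n" "adj u = dn @ w # rs"
  shows "M (ad u w) = w" "M (Suc (ad u w)) = nxt u 0 rs" "(u, w) \<in> E"
  using assms by (auto simp: repr_def reprv_def dlseg_append)

lemma nxt_bound: "(\<And>w. w \<in> set rs \<Longrightarrow> (u, w) \<in> E) \<Longrightarrow> nxt u 0 rs < D"
  using ad_bounds[of u "hd rs"] D_bounds by (cases rs) auto

lemma wp_expand:
  assumes c: "cregs qB R" and lr: "lr = 13 \<and> R 13 = length Q0 \<or> lr = 15" and A: "active A adj"
    and r: "repr adj M" and a: "work qB (set Q0) ord Q0 ss tv tf M" and Q0: "distinct Q0" "set Q0 \<subseteq> A"
    and R: "R 15 = length Q0" "R 16 = 0" "R 17 = 0"
    and U: "U = (if lr = 13 then set Q0 else A)"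
    and post: "\<And>R' M' t' Q1 cur. frame {15, 16, 17, 20, 21, 22, 23} R R' \<Longrightarrow> R' 15 = length Q1 \<Longrightarrow>
      t' \<le> t + 22 + 20 * (\<Sum>u\<in>U. length (adj u) + 2) \<Longrightarrow> work qB (set Q1) ord Q1 ss tv tf M' \<Longrightarrow>
      (\<And>x. x < D \<Longrightarrow> M' x = M x) \<Longrightarrow>
      expanded A adj Q0 Q1 (if lr = 13 then length Q0 else length Q1) cur [] \<Longrightarrow> Q R' M' Z t'"
  shows "wp (expand lr) Q R M Z t"
proof -
  let ?W = "{15, 16, 17, 20, 21, 22, 23 :: nat}"
  have An: "A \<subseteq> {..<n}" and adjA: "\<And>u. u \<in> A \<Longrightarrow> set (adj u) = {w \<in> A. (u, w) \<in> E}"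
    using A by (auto simp: active_def)
  have finU: "finite U" using U An Q0(2) finite_subset[OF An] by auto
  define I where "I = (\<lambda>(Q1, i, cur, rs, st) R' M' Z'. Z' = Z \<and> frame ?W R R' \<and>
     expanded A adj Q0 Q1 i cur rs \<and> i \<le> (if lr = 13 then length Q0 else length Q1) \<and>
     R' 15 = length Q1 \<and> R' 16 = i \<and> R' 17 = nxt cur 0 rs \<and> R' 20 = st \<and>
     (st = 0 \<longrightarrow> rs = [] \<and> i = (if lr = 13 then length Q0 else length Q1)) \<and> st \<le> 1 \<and>
     work qB (set Q1) ord Q1 ss tv tf M' \<and> (\<forall>x < D. M' x = M x))"
  \<comment> \<open>A vertex not yet taken up holds the budget for its whole list; when it is taken
    up, this budget passes to \<open>rs\<close>. The term with \<open>st\<close> pays for the final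
    round.\<close>
  define f where "f = (\<lambda>(Q1, i, cur :: nat, rs :: nat list, st).
     20 * (\<Sum>u\<in>U - set (take i Q1). length (adj u) + 2) + 20 * length rs + 20 * st)"
  have "wp (Loop 20 (expand_body lr)) Q (R(20 := 1)) M Z (t + 1)"
  proof (rule wp_Loop[where I = I and f = f and g = "(Q0, 0, 0, [], 1)"])
    show "I (Q0, 0, 0, [], 1) (R(20 := 1)) M Z"
      using R Q0 a by (auto simp: I_def frame_def expanded_init)
  next
    fix g' R' M' Z' t'
    assume I: "I g' R' M' Z'" "R' 20 = 0" and t: "t' + f g' \<le> t + 1 + f (Q0, 0, 0, [], 1) + 1"
    obtain Q1 i cur rs st where g': "g' = (Q1, i, cur, rs, st)" by (metis surj_pair)
    show "Q R' M' Z' t'"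
      using post[of R' Q1 t' M' cur] I t unfolding g' I_def f_def by auto
  next
    fix g R1 M1 Z1 t1 P
    assume I0: "I g R1 M1 Z1" and st0: "R1 20 \<noteq> 0"
      and P: "\<And>g' R' M' Z' t'. I g' R' M' Z' \<Longrightarrow> f g' < f g \<Longrightarrow> t' + 2 + f g' \<le> t1 + f g \<Longrightarrow> P R' M' Z' t'"
    obtain Q1 i cur rs st where g: "g = (Q1, i, cur, rs, st)" by (metis surj_pair)
    have I: "Z1 = Z" "frame ?W R R1" "expanded A adj Q0 Q1 i cur rs" "i \<le> (if lr = 13 then length Q0 else length Q1)"
     "R1 15 = length Q1" "R1 16 = i" "R1 17 = nxt cur 0 rs" "R1 20 = 1" "st = 1"
     "work qB (set Q1) ord Q1 ss tv tf M1" "\<forall>x < D. M1 x = M x"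
      using I0 st0 unfolding g I_def by auto
    have c1: "cregs qB R1" by (rule cregs_frame[OF c I(2)]) auto
    note b = work_bounds[OF I(10)] D_bounds
    have r1: "repr adj M1" using repr_cong[OF r] I(11) by auto
    have Q1: "distinct Q1" "set Q1 \<subseteq> A" "set Q1 \<subseteq> {..<n}" "i \<le> length Q1" using I(3) An by (auto simp: expanded_def)
    have Q1len: "w \<in> A \<Longrightarrow> w \<notin> set Q1 \<Longrightarrow> length Q1 < n" for w
      using card_mono[of "{..<n}" "insert w (set Q1)"] Q1 An distinct_card[OF Q1(1)] by auto
    show "wp (expand_body lr) P R1 M1 Z1 t1"
    proof (cases rs)
      case (Cons w rs')
      obtain dn where cur: "cur \<in> set (take i Q1)" "adj cur = dn @ w # rs'"
        using I(3) Cons unfolding expanded_def by auto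
      have curA: "cur \<in> A" "cur < n" using cur(1) Q1 An by (auto dest: in_set_takeD)
      have w: "w \<in> A" "w < n" "(cur, w) \<in> E" "\<And>x. x \<in> set rs' \<Longrightarrow> (cur, x) \<in> E"
        using adjA[OF curA(1)] cur(2) An by auto
      note m = repr_seg[OF r1 curA(2) cur(2)]
      have nb: "nxt cur 0 rs' < D" using nxt_bound w by blast
      have ab: "ad cur w + 3 < D" "3 + n \<le> ad cur w" using ad_bounds[OF w(3)] by auto
      have mk: "M1 (D + w) = (if w \<in> set Q1 then 1 else 0)" using work_nth(1)[OF I(10) w(2)] .
      show ?thesis
      proof (cases "w \<in> set Q1")
        case True
        \<comment> \<open>\<open>K\<close> characterises the end states of a round that re-establish
          the invariant; the instructions are then executed symbolically up to such a state. The
          later facts \<open>K\<close> have the same role.\<close>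
        have K: "P R2 M1 Z t2" if "frame {17, 21, 22, 23} R1 R2" "R2 17 = nxt cur 0 rs'" "t2 \<le> t1 + 15" for R2 t2
          
        proof (rule P[of "(Q1, i, cur, rs', 1)"])
          show "I (Q1, i, cur, rs', 1) R2 M1 Z"
            using I that frame_trans[OF I(2) that(1), of ?W] expanded_seen[OF I(3)[unfolded Cons] True]
            unfolding I_def by (auto simp: frameD[OF that(1)])
        qed (use that in \<open>auto simp: f_def g I(9) Cons\<close>)
        show ?thesis using I(1,5-8) Cons m nb ab w mk True b D_bounds
          by (simp add: expand_body_def cregsD[OF c1] K frame_def)
      next
        case False
        have len: "length Q1 < n" using Q1len w False by blast
        have K: "P R2 N Z t2" if "N = M1(D + w := Suc 0, qB + length Q1 := w)"
          "frame {15, 17, 21, 22, 23} R1 R2" "R2 17 = nxt cur 0 rs'" "R2 15 = Suc (length Q1)" "t2 \<le> t1 + 15" for R2 N t2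
          
        proof (rule P[of "(Q1 @ [w], i, cur, rs', 1)"])
          have "work qB (set (Q1 @ [w])) ord (Q1 @ [w]) ss tv tf N"
            using that(1) work_snoc_q[OF work_mark[OF I(10) w(2)] len refl, of w] by simp
          moreover have "\<forall>x < D. N x = M x" using that(1) I(11) b by auto
          ultimately show "I (Q1 @ [w], i, cur, rs', 1) R2 N Z"
            using I that frame_trans[OF I(2) that(2), of ?W] expanded_new[OF I(3)[unfolded Cons] False w(1)]
            unfolding I_def by (auto simp: frameD[OF that(2)])
        qed (use that Q1 in \<open>auto simp: f_def g I(9) Cons\<close>)
        show ?thesis using I(1,5-8) Cons m nb ab w mk False b D_bounds len
          by (simp add: expand_body_def cregsD[OF c1] K frame_def)
      qed
    next
      case Nil
      have lr1: "R1 lr = (if lr = 13 then length Q0 else length Q1)"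
        using lr I(5) by (auto simp: frameD[OF I(2)])
      have lr': "lr \<noteq> 0" "lr \<noteq> 23" using lr by auto
      show ?thesis
      proof (cases "i < (if lr = 13 then length Q0 else length Q1)")
        case True
        have "length Q0 \<le> length Q1" using I(3) by (auto simp: expanded_def)
        then have i: "i < length Q1" using True by (auto split: if_splits)
        let ?u = "Q1 ! i"
        have u: "?u \<in> A" "?u < n" using Q1 i An by (meson nth_mem subsetD lessThan_iff)+
        have E: "w \<in> set (adj ?u) \<Longrightarrow> (?u, w) \<in> E" for w using adjA[OF u(1)] by auto
        have nb: "nxt ?u 0 (adj ?u) < D" using nxt_bound E by blast
        have hd: "M1 (?u + 3) = nxt ?u 0 (adj ?u)" using r1 u(2) by (simp add: repr_def reprv_def add.commute)
        have qm: "M1 (qB + i) = ?u" using work_nth(3)[OF I(10) i] .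
        have "?u \<in> U"
        proof (cases "lr = 13")
          case True
          then have "?u = Q0 ! i" using I(3) \<open>i < (if lr = 13 then length Q0 else length Q1)\<close>
            by (auto simp: expanded_def nth_append)
          then show ?thesis using U True \<open>i < (if lr = 13 then length Q0 else length Q1)\<close> by simp
        qed (use U u in auto)
        moreover have nt: "?u \<notin> set (take i Q1)"
          using Q1(1) i by (auto simp: in_set_conv_nth nth_eq_iff_index_eq)
        ultimately have "(\<Sum>u\<in>U - set (take i Q1). length (adj u) + 2) =
          (length (adj ?u) + 2) + (\<Sum>u\<in>U - set (take i Q1) - {?u}. length (adj u) + 2)"
          using finU by (intro sum.remove) auto
        moreover have "U - set (take i Q1) - {?u} = U - set (take (Suc i) Q1)"
          using i by (auto simp: take_Suc_conv_app_nth)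
        ultimately have sm: "(\<Sum>u\<in>U - set (take i Q1). length (adj u) + 2) =
          (length (adj ?u) + 2) + (\<Sum>u\<in>U - set (take (Suc i) Q1). length (adj u) + 2)" by simp
        have K: "P R2 M1 Z t2" if
          "frame {16, 17, 21, 22, 23} R1 R2" "R2 17 = nxt ?u 0 (adj ?u)" "R2 16 = Suc i" "t2 \<le> t1 + 15" for R2 t2
          
        proof (rule P[of "(Q1, Suc i, ?u, adj ?u, 1)"])
          show "I (Q1, Suc i, ?u, adj ?u, 1) R2 M1 Z"
            using I that frame_trans[OF I(2) that(1), of ?W] expanded_next[OF I(3)[unfolded Nil] i] True
            unfolding I_def by (auto simp: frameD[OF that(1)])
        qed (use that sm in \<open>auto simp: f_def g I(9) Nil\<close>)
        have "length Q0 - i \<le> B" "length Q1 - i \<le> B" using \<open>length Q0 \<le> length Q1\<close> b by linarith+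
        then show ?thesis using I(1,5-8) Nil hd nb u qm b i True lr1 lr'
          by (simp add: expand_body_def cregsD[OF c1] K frame_def)
      next
        case False
        then have i: "i = (if lr = 13 then length Q0 else length Q1)" using I(4) by simp
        have K: "P R2 M1 Z t2" if "frame {20, 23} R1 R2" "R2 20 = 0" "t2 \<le> t1 + 15" for R2 t2
          
        proof (rule P[of "(Q1, i, cur, [], 0)"])
          show "I (Q1, i, cur, [], 0) R2 M1 Z"
            using I that frame_trans[OF I(2) that(1), of ?W] i Nil
            unfolding I_def by (auto simp: frameD[OF that(1)])
        qed (use that in \<open>auto simp: f_def g I(9) Nil\<close>)
        show ?thesis using I(1,5-8) Nil b D_bounds i lr1 lr'
          by (simp add: expand_body_def cregsD[OF c1] K frame_def)
      qed
    qed
  qed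
  then show ?thesis using D_bounds by (simp add: expand_def)
qed

end

section \<open>The search that holds a vertex back\<close>

definition push :: "nat \<Rightarrow> com" where
  "push fr = Ins (ADD 22 10 13) ;; Ins (STORE 22 19) ;; Ins (ADD 13 13 1) ;;
     Ins (ADD 22 11 14) ;; Ins (STORE 22 19) ;; Ins (ADD 22 12 14) ;; Ins (STORE 22 fr) ;; Ins (ADD 14 14 1)"

text \<open>A new vertex is held back if none is, and queued otherwise; the loop ends if the queue
  then has \<open>k\<close> vertices. When the queue is exhausted, a held vertex becomes forced and
  is queued itself. If the queue reaches size \<open>k\<close> in this way, the search still goes on
  until a vertex is held back or nothing is left, unless \<open>T\<close> has grown to
  \<open>k - 1\<close> vertices.\<close>

definition search_body :: com where
  "search_body = Cond 17
     (Ins (LOAD 21 17) ;; Ins (ADD 22 17 1) ;; Ins (LOAD 17 22) ;; Ins (ADD 22 7 21) ;; Ins (LOAD 23 22) ;;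
      Cond 23 Skip
        (Ins (STORE 22 1) ;;
         Cond 18 (Ins (ADD 22 9 15) ;; Ins (STORE 22 21) ;; Ins (ADD 15 15 1))
           (Ins (LOADI 18 1) ;; Ins (ADD 19 21 0)) ;;
         Ins (SUB 23 5 15) ;; Cond 23 Skip (Ins (LOADI 20 0))))
     (Ins (SUB 23 15 16) ;;
      Cond 23
        (Ins (ADD 22 9 16) ;; Ins (LOAD 21 22) ;; Ins (ADD 22 21 3) ;; Ins (LOAD 17 22) ;; Ins (ADD 16 16 1))
        (Cond 18
          (Ins (ADD 22 9 15) ;; Ins (STORE 22 19) ;; Ins (ADD 15 15 1) ;; Ins (LOADI 18 0) ;;
           push 0 ;; Ins (SUB 20 6 13))
          (Ins (LOADI 20 0))))"

context gmem
begin

lemma wp_push: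
  assumes c: "cregs qB R" and R: "R 13 = ls" "R 14 = lt" "fr \<le> 1" "ls < n" "lt < n"
    and post: "\<And>R' t'. frame {13, 14, 22} R R' \<Longrightarrow> R' 13 = Suc ls \<Longrightarrow> R' 14 = Suc lt \<Longrightarrow> t' \<le> t + 8 \<Longrightarrow>
      Q R' (M(D + 3 * n + ls := R 19, D + 4 * n + lt := R 19, D + 5 * n + lt := fr)) Z t'"
  shows "wp (push fr) Q R M Z t"
proof -
  have "R fr = fr" "fr \<noteq> 13" "fr \<noteq> 14" "fr \<noteq> 22" using c R(3) by (auto simp: cregs_def le_Suc_eq)
  then show ?thesis using R D_bounds by (simp add: push_def cregsD[OF c] post frame_def)
qed

text \<open>
  The last condition keeps the trail within its \<open>n\<close> words: it has one entry for every vertex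
  deleted below the current root and for every vertex of \<open>ss\<close> but the root.
\<close>

definition node :: "nat set \<Rightarrow> (nat \<Rightarrow> nat list) \<Rightarrow> nat list \<Rightarrow> (nat \<times> nat) list \<Rightarrow> bool" where
  "node A adj ss T \<longleftrightarrow> active A adj \<and> distinct ss \<and> set ss \<subseteq> A \<and> conn E (set ss) \<and>
     csets E k A (set ss) \<noteq> {} \<and> length ss < k \<and> length T + card A < length ss + n"

text \<open>\<open>P\<close> is empty or consists of the vertex held back. The condition for
  \<open>P = {}\<close> is the crucial one: as long as nothing is held back, all vertices still to
  be scanned belong to \<open>s0 @ F\<close>, so the next discovery is adjacent to this set and can
  be added to it without losing connectedness. \<open>Q\<close> avoids \<open>P\<close>, so a queue
  of \<open>k\<close> vertices certifies a solution without the held vertex.\<close>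

definition search ::
  "nat set \<Rightarrow> (nat \<Rightarrow> nat list) \<Rightarrow> nat list \<Rightarrow> nat list \<Rightarrow> nat list \<Rightarrow> nat \<Rightarrow> nat \<Rightarrow> nat list \<Rightarrow> nat list \<Rightarrow>
     nat set \<Rightarrow> bool" where
  "search A adj s0 F Q i cur dn rs P \<longleftrightarrow>
     distinct (s0 @ F) \<and> conn E (set (s0 @ F)) \<and> set (s0 @ F) \<subseteq> set Q \<and> distinct Q \<and> set Q \<subseteq> A \<and>
     conn E (set Q) \<and> csets E k A (set (s0 @ F)) = csets E k A (set s0) \<and> i \<le> length Q \<and> length Q \<le> k \<and>
     (rs \<noteq> [] \<longrightarrow> cur \<in> set (take i Q) \<and> adj cur = dn @ rs \<and> set dn \<subseteq> set Q \<union> P) \<and>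
     (\<forall>u \<in> set (take i Q). set (adj u) \<subseteq> set Q \<union> P \<union> (if u = cur then set rs else {})) \<and>
     (P = {} \<longrightarrow> set (drop i Q) \<subseteq> set (s0 @ F) \<and> (rs \<noteq> [] \<longrightarrow> cur \<in> set (s0 @ F))) \<and>
     (\<forall>v \<in> P. v \<in> A \<and> v \<notin> set Q \<and> (\<exists>u \<in> set (s0 @ F). (u, v) \<in> E))"

lemma search_seen:
  "search A adj s0 F Q i cur dn (w # rs) P \<Longrightarrow> w \<in> set Q \<union> P \<Longrightarrow> search A adj s0 F Q i cur (dn @ [w]) rs P"
  unfolding search_def by (auto split: if_splits)

lemma search_hold:
  assumes "search A adj s0 F Q i cur dn (w # rs) {}" "w \<notin> set Q" "w \<in> A" "(cur, w) \<in> E"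
  shows "search A adj s0 F Q i cur (dn @ [w]) rs {w}"
  using assms unfolding search_def by (auto split: if_splits)

lemma search_new:
  assumes "search A adj s0 F Q i cur dn (w # rs) P" "w \<notin> set Q \<union> P" "w \<in> A" "(cur, w) \<in> E" "P \<noteq> {}"
    "length Q < k"
  shows "search A adj s0 F (Q @ [w]) i cur (dn @ [w]) rs P"
proof -
  note A = assms(1)[unfolded search_def]
  have "cur \<in> set Q" using A by (auto dest: in_set_takeD)
  then have "conn E (insert w (set Q))" using conn_insert[OF symE, of "set Q" cur w] A assms by auto
  moreover have "take i (Q @ [w]) = take i Q" using A by simp
  ultimately show ?thesis
    using A assms(2-6) unfolding search_def by (auto split: if_splits)
qed

lemma search_next:
  assumes "search A adj s0 F Q i cur dn [] P" "i < length Q"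
  shows "search A adj s0 F Q (Suc i) (Q ! i) [] (adj (Q ! i)) P"
proof -
  have "drop i Q = Q ! i # drop (Suc i) Q" using assms(2) by (simp add: Cons_nth_drop_Suc)
  then show ?thesis
    using assms unfolding search_def by (auto simp: take_Suc_conv_app_nth split: if_splits)
qed

text \<open>All lists of queued vertices have been scanned, so \<open>csets_forced\<close> applies
  to the queue. Afterwards \<open>v\<close> is the only vertex left to scan, and it is in
  \<open>F\<close>; this re-establishes the condition for \<open>P = {}\<close>.\<close>

lemma search_forced:
  assumes "search A adj s0 F Q i cur dn [] {v}" "i = length Q" "length Q < k" "active A adj"
  shows "search A adj s0 (F @ [v]) (Q @ [v]) i cur dn [] {}"
proof -
  note A = assms(1)[unfolded search_def]
  obtain u where u: "u \<in> set (s0 @ F)" "(u, v) \<in> E" using A by blast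
  have Q: "conn E (insert v (set Q))" using conn_insert[OF symE, of "set Q" u v] u A by blast
  have SF: "conn E (insert v (set (s0 @ F)))" using conn_insert[OF symE, of "set (s0 @ F)" u v] u A by blast
  have "csets E k A (insert v (set (s0 @ F))) = csets E k A (set (s0 @ F))"
  proof (rule csets_forced[of "set Q"])
    show "card (set Q) < k" using assms(3) card_length[of Q] by linarith
    show "w \<in> insert v (set Q)" if "u \<in> set Q" "w \<in> A" "(u, w) \<in> E" for u w
    proof -
      have "u \<in> A" using that A by blast
      then have "w \<in> set (adj u)" using that assms(4) by (auto simp: active_def)
      moreover have "set (adj u) \<subseteq> insert v (set Q)" using A that assms(2) by (auto split: if_splits)
      ultimately show ?thesis by blast
    qed
  qed (use A u in auto)
  then show ?thesis
    using A Q SF assms(2,3) unfolding search_def by (auto split: if_splits)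
qed

text \<open>The scanned entries of a list are distinct and all queued or held back. So at most
  \<open>k + 1\<close> entries lie behind the scan at any time, however long the list is; this makes
  the search quadratic in \<open>k\<close>.\<close>

lemma search_dn:
  assumes "search A adj s0 F Q i cur dn (w # rs) P" "finite P" "distinct (adj cur)"
  shows "length dn \<le> length Q + card P"
proof -
  have "length dn = card (set dn)" using assms unfolding search_def by (auto simp: distinct_card)
  also have "\<dots> \<le> card (set Q \<union> P)" using assms unfolding search_def by (intro card_mono) auto
  also have "\<dots> \<le> card (set Q) + card P" by (rule card_Un_le)
  also have "card (set Q) \<le> length Q" by (rule card_length)
  finally show ?thesis by simp
qed

definition held :: "nat \<Rightarrow> nat \<Rightarrow> nat set" where
  "held h v = (if h = 0 then {} else {v})"

lemma held_simps [simp]: "held 0 v = {}" "held (Suc 0) v = {v}"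
  by (simp_all add: held_def)

text \<open>The outcomes: one vertex is missing (a fan), \<open>k\<close> vertices are queued
  besides the held one (a branching), or the queue is exhausted with nothing held back (a single
  solution).\<close>

definition search_exit :: "nat list \<Rightarrow> nat list \<Rightarrow> nat \<Rightarrow> nat \<Rightarrow> nat list \<Rightarrow> bool" where
  "search_exit ss Q i h rs \<longleftrightarrow> h = 0 \<and> length ss + 1 = k \<or>
     length ss + 2 \<le> k \<and> h = 1 \<and> length Q = k \<or>
     length ss + 2 \<le> k \<and> h = 0 \<and> rs = [] \<and> i = length Q"

lemma wp_search:
  assumes c: "cregs qB R" and k2: "2 \<le> k" and nd: "node A adj s0 T" and r: "repr adj M"
    and a: "work qB (set s0) ord s0 s0 (map fst T) (map snd T) M"
    and R: "R 13 = length s0" "R 14 = length T" "R 15 = length s0" "R 16 = 0" "R 17 = 0" "R 18 = 0"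
      "R 20 = k - 1 - length s0"
    and post: "\<And>R' M' t' F Q1 i cur dn rs h.
      frame {13, 14, 15, 16, 17, 18, 19, 20, 21, 22, 23} R R' \<Longrightarrow> R' 13 = length (s0 @ F) \<Longrightarrow>
      R' 14 = length T + length F \<Longrightarrow> R' 15 = length Q1 \<Longrightarrow> R' 18 = h \<Longrightarrow> 
      t' \<le> t + 1 + 240 * (k * k) \<Longrightarrow>
      work qB (set Q1 \<union> held h (R' 19)) ord Q1 (s0 @ F) (map fst T @ F) (map snd T @ map (\<lambda>_. 0) F) M' \<Longrightarrow>
      (\<And>x. x < D \<Longrightarrow> M' x = M x) \<Longrightarrow>
      search A adj s0 F Q1 i cur dn rs (held h (R' 19)) \<Longrightarrow> search_exit (s0 @ F) Q1 i h rs \<Longrightarrow> Q R' M' Z t'"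
  shows "wp (Loop 20 search_body) Q R M Z t"
proof -
  let ?W = "{13, 14, 15, 16, 17, 18, 19, 20, 21, 22, 23 :: nat}"
  have A: "active A adj" using nd by (simp add: node_def)
  have An: "A \<subseteq> {..<n}" and adjA: "\<And>u. u \<in> A \<Longrightarrow> set (adj u) = {w \<in> A. (u, w) \<in> E}"
    using A by (auto simp: active_def)
  have finA: "finite A" using finite_subset[OF An] by auto
  define I where "I = (\<lambda>(F, Q1, i, cur, dn, rs, h, st) R' M' Z'. Z' = Z \<and> frame ?W R R' \<and>
     search A adj s0 F Q1 i cur dn rs (held h (R' 19)) \<and> h \<le> 1 \<and>
     R' 13 = length (s0 @ F) \<and> R' 14 = length T + length F \<and>
     R' 15 = length Q1 \<and> R' 16 = i \<and> R' 17 = nxt cur 0 rs \<and> R' 18 = h \<and>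
     work qB (set Q1 \<union> held h (R' 19)) ord Q1 (s0 @ F) (map fst T @ F) (map snd T @ map (\<lambda>_. 0) F) M' \<and>
     (\<forall>x < D. M' x = M x) \<and> st \<le> (1 :: nat) \<and> (st = 0 \<longleftrightarrow> R' 20 = 0) \<and>
     (st = 0 \<longrightarrow> search_exit (s0 @ F) Q1 i h rs) \<and>
     (st \<noteq> 0 \<longrightarrow> length (s0 @ F) + 2 \<le> k \<and> (h \<noteq> 0 \<longrightarrow> length Q1 < k)))"
  \<comment> \<open>Each queue position is worth \<open>k + 3\<close> units: one for taking it up
    and \<open>k + 2\<close> for its list, by \<open>search_dn\<close>. The term
    \<open>k - length (s0 @ F)\<close> pays for forced vertices and \<open>st\<close> for the last
    round. A unit of 40 steps covers any round.\<close>
  define f where "f = (\<lambda>(F :: nat list, Q1 :: nat list, i, cur :: nat, dn :: nat list, rs :: nat list, h :: nat, st).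
     40 * ((k + 3) * (k - i) + (if rs = [] then 0 else k + 2 - length dn) + (k - length (s0 @ F)) + st))"
  let ?g = "([], s0, 0, 0, [], [], 0, if k - 1 - length s0 = 0 then 0 else 1)"
  show ?thesis
  proof (rule wp_Loop[where I = I and f = f and g = ?g])
    have "search A adj s0 [] s0 0 0 [] [] {}" using nd by (auto simp: search_def node_def)
    moreover have "length s0 < k" using nd by (simp add: node_def)
    ultimately show "I ?g R M Z"
      using R a unfolding I_def by (auto simp: frame_refl search_exit_def)
  next
    fix g' R' M' Z' t'
    assume I: "I g' R' M' Z'" "R' 20 = 0" and t: "t' + f g' \<le> t + f ?g + 1"
    obtain F Q1 i cur dn rs h st where g': "g' = (F, Q1, i, cur, dn, rs, h, st)" by (metis surj_pair)
    have "f ?g \<le> 40 * ((k + 3) * k + k + 1)" by (auto simp: f_def)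
    also have "\<dots> \<le> 240 * (k * k)"
    proof -
      define q where "q = k * k"
      have "k \<le> q" "1 \<le> q" using k2 by (auto simp: q_def)
      moreover have "(k + 3) * k = q + 3 * k" by (simp add: q_def algebra_simps)
      ultimately show ?thesis unfolding q_def[symmetric] by simp
    qed
    finally show "Q R' M' Z' t'"
      using post[of R' F Q1 h t' M' i cur dn rs] I t unfolding g' I_def by auto
  next
    fix g R1 M1 Z1 t1 P
    assume I0: "I g R1 M1 Z1" and st0: "R1 20 \<noteq> 0"
      and P: "\<And>g' R' M' Z' t'. I g' R' M' Z' \<Longrightarrow> f g' < f g \<Longrightarrow> t' + 2 + f g' \<le> t1 + f g \<Longrightarrow> P R' M' Z' t'"
    obtain F Q1 i cur dn rs h st where g: "g = (F, Q1, i, cur, dn, rs, h, st)" by (metis surj_pair)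
    let ?ss = "s0 @ F" and ?tv = "map fst T @ F" and ?tf = "map snd T @ map (\<lambda>_. 0) F"
    have I: "Z1 = Z" "frame ?W R R1" "search A adj s0 F Q1 i cur dn rs (held h (R1 19))" "h \<le> 1"
     "R1 13 = length ?ss" "R1 14 = length T + length F"
     "R1 15 = length Q1" "R1 16 = i" "R1 17 = nxt cur 0 rs" "R1 18 = h"
     "work qB (set Q1 \<union> held h (R1 19)) ord Q1 ?ss ?tv ?tf M1" "\<forall>x < D. M1 x = M x" "st = 1"
     "length ?ss + 2 \<le> k" "h \<noteq> 0 \<longrightarrow> length Q1 < k"
      using I0 st0 unfolding g I_def by auto
    have c1: "cregs qB R1" by (rule cregs_frame[OF c I(2)]) auto
    note b = work_bounds[OF I(11)] D_bounds
    have kB: "k - x \<le> B" for x using B_big by simp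
    have r1: "repr adj M1" using repr_cong[OF r] I(12) by auto
    have Q1: "distinct Q1" "set Q1 \<subseteq> A" "set Q1 \<subseteq> {..<n}" "i \<le> length Q1" "length Q1 \<le> k"
      using I(3) An by (auto simp: search_def)
    have Q1len: "w \<in> A \<Longrightarrow> w \<notin> set Q1 \<Longrightarrow> length Q1 < card A" for w
      using card_mono[of A "insert w (set Q1)"] Q1 finA distinct_card[OF Q1(1)] by auto
    have cA: "card A \<le> n" using card_mono[OF _ An] by simp
    show "wp search_body P R1 M1 Z1 t1"
    proof (cases rs)
      case (Cons w rs')
      note search = I(3)[unfolded Cons]
      have cur: "cur \<in> set (take i Q1)" "adj cur = dn @ w # rs'"
        using search unfolding search_def by auto
      have curA: "cur \<in> A" "cur < n" using cur(1) Q1 An by (auto dest: in_set_takeD)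
      have w: "w \<in> A" "w < n" "(cur, w) \<in> E" "\<And>x. x \<in> set rs' \<Longrightarrow> (cur, x) \<in> E"
        using adjA[OF curA(1)] cur(2) An by auto
      note m = repr_seg[OF r1 curA(2) cur(2)]
      have nb: "nxt cur 0 rs' < D" using nxt_bound w by blast
      have ab: "ad cur w + 3 < D" "3 + n \<le> ad cur w" using ad_bounds[OF w(3)] by auto
      have mk: "M1 (D + w) = (if w \<in> set Q1 \<union> held h (R1 19) then 1 else 0)" using work_nth(1)[OF I(11) w(2)] .
      have "distinct (adj cur)" using r1 curA by (simp add: repr_def reprv_def)
      then have "length dn \<le> length Q1 + card (held h (R1 19))"
        by (intro search_dn[OF search]) (auto simp: held_def)
      then have dn: "length dn \<le> k + 1" using Q1(5) by (auto simp: held_def split: if_splits)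
      show ?thesis
      proof (cases "w \<in> set Q1 \<union> held h (R1 19)")
        case True
        have K: "P R2 M1 Z t2" if "frame {17, 21, 22, 23} R1 R2" "R2 17 = nxt cur 0 rs'" "t2 \<le> t1 + 30" for R2 t2
          
        proof (rule P[of "(F, Q1, i, cur, dn @ [w], rs', h, 1)"])
          show "I (F, Q1, i, cur, dn @ [w], rs', h, 1) R2 M1 Z"
            using I st0 that frame_trans[OF I(2) that(1), of ?W] search_seen[OF search True]
            unfolding I_def by (auto simp: frameD[OF that(1)])
        qed (use that dn in \<open>auto simp: f_def g I(13) Cons\<close>)
        show ?thesis using I(1,5-10) Cons m nb ab w mk True b D_bounds
          unfolding search_body_def by (simp add: cregsD[OF c1] K frame_def kB)
      next
        case False
        show ?thesis
        proof (cases "h = 0")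
          case True
          have K: "P R2 N Z t2" if "N = M1(D + w := Suc 0)"
            "frame {17, 18, 19, 20, 21, 22, 23} R1 R2" "R2 17 = nxt cur 0 rs'" "R2 18 = 1" "R2 19 = w"
            "R2 20 = (if length Q1 = k then 0 else R1 20)" "t2 \<le> t1 + 30" for R2 N t2
            
          proof (rule P[of "(F, Q1, i, cur, dn @ [w], rs', 1, if length Q1 = k then 0 else 1)"])
            have "work qB (set Q1 \<union> held 1 w) ord Q1 ?ss ?tv ?tf N"
              using that(1) work_mark[OF I(11) w(2)] True by simp
            moreover have "\<forall>x < D. N x = M x" using that(1) I(12) by auto
            moreover have "search A adj s0 F Q1 i cur (dn @ [w]) rs' {w}"
              using search_hold[of A adj s0 F Q1 i cur dn w rs'] search True False w by simp
            ultimately show "I (F, Q1, i, cur, dn @ [w], rs', 1, if length Q1 = k then 0 else 1) R2 N Z"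
              using I that st0 Q1(5) frame_trans[OF I(2) that(2), of ?W]
              unfolding I_def search_exit_def by (auto simp: frameD[OF that(2)])
          qed (use that Q1 dn in \<open>auto simp: f_def g I(13) Cons\<close>)
          show ?thesis using I(1,5-10) Cons m nb ab w mk False True b D_bounds Q1(5)
            unfolding search_body_def by (simp add: cregsD[OF c1] K frame_def kB)
        next
          case h: False
          then have h1: "h = 1" using I(4) by simp
          have len: "length Q1 < card A" "length Q1 < k" using Q1len w False I(15) h by auto
          have "length Q1 < n" using len cA by simp
          have K: "P R2 N Z t2" if "N = M1(D + w := Suc 0, qB + length Q1 := w)"
            "frame {15, 17, 20, 21, 22, 23} R1 R2" "R2 15 = Suc (length Q1)" "R2 17 = nxt cur 0 rs'"
            "R2 20 = (if Suc (length Q1) = k then 0 else R1 20)" "t2 \<le> t1 + 30" for R2 N t2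
            
          proof (rule P[of "(F, Q1 @ [w], i, cur, dn @ [w], rs', 1, if Suc (length Q1) = k then 0 else 1)"])
            have "work qB (set (Q1 @ [w]) \<union> held 1 (R1 19)) ord (Q1 @ [w]) ?ss ?tv ?tf N"
              using that(1) work_snoc_q[OF work_mark[OF I(11) w(2)] \<open>length Q1 < n\<close> refl, of w] h1
              by (simp add: insert_commute)
            moreover have "\<forall>x < D. N x = M x" using that(1) I(12) b by auto
            moreover have "search A adj s0 F (Q1 @ [w]) i cur (dn @ [w]) rs' {R1 19}"
              using search_new[of A adj s0 F Q1 i cur dn w rs' "{R1 19}"] search h1 False w len by simp
            ultimately show "I (F, Q1 @ [w], i, cur, dn @ [w], rs', 1, if Suc (length Q1) = k then 0 else 1) R2 N Z"
              using I that st0 len h1 frame_trans[OF I(2) that(2), of ?W]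
              unfolding I_def search_exit_def by (auto simp: frameD[OF that(2)] insert_commute)
          qed (use that Q1 dn h1 in \<open>auto simp: f_def g I(13) Cons\<close>)
          show ?thesis using I(1,5-10) Cons m nb ab w mk False h1 b D_bounds len \<open>length Q1 < n\<close>
            unfolding search_body_def by (simp add: cregsD[OF c1] K frame_def kB)
        qed
      qed
    next
      case Nil
      note search = I(3)[unfolded Nil]
      show ?thesis
      proof (cases "i < length Q1")
        case True
        let ?u = "Q1 ! i"
        have u: "?u \<in> A" "?u < n" using Q1 True An by (meson nth_mem subsetD lessThan_iff)+
        have E: "w \<in> set (adj ?u) \<Longrightarrow> (?u, w) \<in> E" for w using adjA[OF u(1)] by auto
        have nb: "nxt ?u 0 (adj ?u) < D" using nxt_bound E by blast
        have hd: "M1 (?u + 3) = nxt ?u 0 (adj ?u)" using r1 u(2) by (simp add: repr_def reprv_def add.commute)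
        have qm: "M1 (qB + i) = ?u" using work_nth(3)[OF I(11) True] .
        have ki: "(k + 3) * (k - i) = (k + 3) * (k - Suc i) + (k + 3)"
          using True Q1(5) by (metis Suc_diff_Suc add.commute mult_Suc_right order_less_le_trans)
        have K: "P R2 M1 Z t2" if
          "frame {16, 17, 21, 22, 23} R1 R2" "R2 17 = nxt ?u 0 (adj ?u)" "R2 16 = Suc i" "t2 \<le> t1 + 30" for R2 t2
          
        proof (rule P[of "(F, Q1, Suc i, ?u, [], adj ?u, h, 1)"])
          show "I (F, Q1, Suc i, ?u, [], adj ?u, h, 1) R2 M1 Z"
            using I that st0 frame_trans[OF I(2) that(1), of ?W] search_next[OF search True]
            unfolding I_def by (auto simp: frameD[OF that(1)])
        qed (use that ki in \<open>auto simp: f_def g I(13) Nil\<close>)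
        show ?thesis using I(1,5-10) Nil hd nb u qm b D_bounds True
          unfolding search_body_def by (simp add: cregsD[OF c1] K frame_def kB)
      next
        case False
        then have i: "i = length Q1" using Q1 by simp
        show ?thesis
        proof (cases "h = 0")
          case True
          have K: "P R2 M1 Z t2" if "frame {20, 23} R1 R2" "R2 20 = 0" "t2 \<le> t1 + 30" for R2 t2
            
          proof (rule P[of "(F, Q1, i, cur, dn, [], h, 0)"])
            show "I (F, Q1, i, cur, dn, [], h, 0) R2 M1 Z"
              using I that frame_trans[OF I(2) that(1), of ?W] i Nil True
              unfolding I_def search_exit_def by (auto simp: frameD[OF that(1)])
          qed (use that in \<open>auto simp: f_def g I(13) Nil\<close>)
          show ?thesis using I(1,5-10) Nil b D_bounds i True
            unfolding search_body_def by (simp add: cregsD[OF c1] K frame_def kB)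
        next
          case h: False
          then have h1: "h = 1" using I(4) by simp
          let ?v = "R1 19"
          have v: "?v \<in> A" "?v \<notin> set Q1" "?v < n" using search h1 An by (auto simp: search_def)
          have len: "length Q1 < card A" "length Q1 < k" using Q1len v I(15) h by auto
          have "length Q1 < n" using len cA by simp
          have "length ?ss \<le> length Q1"
            using I(3) card_mono[of "set Q1" "set ?ss"] distinct_card[of ?ss] distinct_card[of Q1]
            by (auto simp: search_def)
          moreover have "length T + card A < length s0 + n" using nd by (simp add: node_def)
          ultimately have sp: "length ?ss < n" "length T + length F < n" using len cA by auto
          have K: "P R2 N Z t2" if "N = M1(qB + length Q1 := ?v, D + 3 * n + length ?ss := ?v,
               D + 4 * n + (length T + length F) := ?v, D + 5 * n + (length T + length F) := 0)"
            "frame {13, 14, 15, 18, 20, 22, 23} R1 R2" "R2 15 = Suc (length Q1)" "R2 18 = 0" "R2 13 = Suc (length ?ss)"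
            "R2 14 = Suc (length T + length F)" "R2 20 = k - 1 - Suc (length ?ss)" "t2 \<le> t1 + 30" for R2 N t2
            
          proof (rule P[of "(F @ [?v], Q1 @ [?v], i, cur, dn, [], 0, if k = length ?ss + 2 then 0 else 1)"])
            have "work qB (set Q1 \<union> held h ?v) ord (Q1 @ [?v]) (?ss @ [?v]) (?tv @ [?v]) (?tf @ [0]) N"
              unfolding that(1) using sp \<open>length Q1 < n\<close>
              by (intro work_snoc_tf work_snoc_tv work_snoc_s work_snoc_q I(11)) auto
            then have "work qB (set (Q1 @ [?v]) \<union> held 0 (R2 19)) ord (Q1 @ [?v]) (s0 @ F @ [?v])
                (map fst T @ F @ [?v]) (map snd T @ map (\<lambda>_. 0) (F @ [?v])) N" using h1 by simp
            moreover have "\<forall>x < D. N x = M x" using that(1) I(12) b by auto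
            moreover have "search A adj s0 (F @ [?v]) (Q1 @ [?v]) i cur dn [] {}"
              using search_forced[of A adj s0 F Q1 i cur dn ?v] search h1 i len A by simp
            ultimately show "I (F @ [?v], Q1 @ [?v], i, cur, dn, [], 0, if k = length ?ss + 2 then 0 else 1) R2 N Z"
              using I that Nil frame_trans[OF I(2) that(2), of ?W]
              unfolding I_def search_exit_def by (auto simp: frameD[OF that(2)])
          qed (use that I(14) in \<open>auto simp: f_def g I(13) Nil\<close>)
          define P' where "P' = wp (push 0) (wp (Ins (SUB 20 6 13)) (\<lambda>R' M' Z' t'. P R' M' Z' (Suc t')))"
          have K': "P' R3 N3 Z t3" if "N3 = M1(qB + length Q1 := ?v)" "frame {15, 18, 22, 23} R1 R3"
            "R3 15 = Suc (length Q1)" "R3 18 = 0" "t3 \<le> t1 + 10" for R3 N3 t3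
            unfolding P'_def
          proof (rule wp_push)
            show c3: "cregs qB R3" by (rule cregs_frame[OF c1 that(2)]) auto
            show "R3 13 = length ?ss" "R3 14 = length T + length F" using I(5,6) by (auto simp: frameD[OF that(2)])
            fix R4 t4 assume e4: "frame {13, 14, 22} R3 R4" and R4: "R4 13 = Suc (length ?ss)"
              "R4 14 = Suc (length T + length F)" "t4 \<le> t3 + 8"
            have c4: "cregs qB R4" by (rule cregs_frame[OF c3 e4]) auto
            have "P (R4(20 := k - 1 - Suc (length ?ss))) (N3(D + 3 * n + length ?ss := R3 19,
              D + 4 * n + (length T + length F) := R3 19, D + 5 * n + (length T + length F) := 0)) Z (Suc (Suc t4))"
            proof (rule K)
              show "frame {13, 14, 15, 18, 20, 22, 23} R1 (R4(20 := k - 1 - Suc (length ?ss)))"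
                using that(2) e4 by (auto simp: frame_def)
            qed (use that R4 in \<open>auto simp: frameD[OF e4] frameD[OF that(2)]\<close>)
            then show "wp (Ins (SUB 20 6 13)) (\<lambda>R' M' Z' t'. P R' M' Z' (Suc t')) R4 (N3(D + 3 * n + length ?ss := R3 19,
              D + 4 * n + (length T + length F) := R3 19, D + 5 * n + (length T + length F) := 0)) Z t4"
              using R4 by (simp add: cregsD[OF c4] kB)
          qed (use sp in auto)
          have "wp (Ins (ADD 22 9 15)) (wp (Ins (STORE 22 19)) (wp (Ins (ADD 15 15 1)) (wp (Ins (LOADI 18 0)) P')))
              (R1(23 := 0)) M1 Z (Suc (Suc (Suc (Suc t1))))"
            using I(7) b \<open>length Q1 < n\<close> by (simp add: cregsD[OF c1] K' frame_def)
          then show ?thesis using I(1,7-10) Nil i h1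
            by (simp add: search_body_def P'_def)
        qed
      qed
    qed
  qed
qed

end

section \<open>Nodes of the enumeration tree\<close>

definition printA :: "nat \<Rightarrow> nat \<Rightarrow> com" where
  "printA br lr = For 29 lr (Ins (ADD 22 br 29) ;; Ins (LOAD 21 22) ;; Ins (PRINT 21))"

definition fanprint :: com where
  "fanprint = Ins (ADD 16 13 0) ;; Ins (SUB 20 15 16) ;;
     Loop 20 (printA 10 13 ;; Ins (ADD 22 9 16) ;; Ins (LOAD 21 22) ;; Ins (PRINT 21) ;;
       Ins (ADD 16 16 1) ;; Ins (SUB 20 15 16))"

text \<open>After a branching the mode stays 1, so the next round of the main loop treats the node
  that includes \<open>v\<close>. The leaves set it to 2.\<close>

definition node_com :: com where
  "node_com = copyS ;; Ins (LOADI 18 0) ;; Ins (SUB 20 6 13) ;; Loop 20 search_body ;; unmarkQ ;;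
     Cond 18 (Ins (ADD 22 7 19) ;; Ins (STORE 22 0)) Skip ;;
     Ins (SUB 23 6 13) ;;
     Cond 23
       (Cond 18 (push 1) (printA 9 15 ;; Ins (LOADI 24 2)))
       (copyS ;; expand 13 ;; fanprint ;; unmarkQ ;; Ins (LOADI 24 2))"

context gmem
begin

lemma wp_printA:
  assumes R: "R br = base" "R lr = length xs" "R (Suc 0) = 1" "br \<notin> {21, 22, 29, 31}"
      "lr \<notin> {Suc 0, 21, 22, 29, 31}"
    and xs: "array M base xs" "base + length xs \<le> S" "\<And>x. x \<in> set xs \<Longrightarrow> x \<le> B"
    and post: "\<And>R' t'. frame {21, 22, 29, 31} R R' \<Longrightarrow> t' \<le> t + 3 + 7 * length xs \<Longrightarrow> Q R' M (Z @ xs) t'"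
  shows "wp (printA br lr) Q R M Z t"
  unfolding printA_def
proof (rule wp_For[where L = "length xs" and d = 3 and
      J = "\<lambda>x R' M' Z'. frame {21, 22, 29, 31} R R' \<and> M' = M \<and> Z' = Z @ take x xs"])
  fix x R1 M1 Z1 t1
  assume x: "x < length xs" and J: "frame {21, 22, 29, 31} R R1 \<and> M1 = M \<and> Z1 = Z @ take x xs"
    and R1: "R1 29 = x" "R1 lr = length xs" "R1 1 = 1"
  have "M (base + x) = xs ! x" "xs ! x \<le> B" using xs x by (auto simp: array_def)
  moreover have "R1 br = base" using J R by (auto simp: frame_def)
  moreover have "base + x < S" using xs x by simp
  moreover have "frame {21, 22, 29, 31} R (R1(22 := base + x, 21 := xs ! x, 29 := Suc x, 31 := length xs - Suc x))"
    using J by (auto simp: frame_def)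
  moreover have "br \<noteq> 22" "lr \<noteq> 22" "lr \<noteq> 21" using R by auto
  ultimately show "wp (Ins (ADD 22 br 29) ;; Ins (LOAD 21 22) ;; Ins (PRINT 21))
     (\<lambda>R' M' Z' t'. t' \<le> t1 + 3 \<and> R' 29 = x \<and> R' lr = length xs \<and> R' 1 = 1 \<and>
        frame {21, 22, 29, 31} R (R'(29 := x + 1, 31 := length xs - (x + 1))) \<and> M' = M \<and> Z' = Z @ take (x + 1) xs)
      R1 M1 Z1 t1"
    using J R1 x D_bounds by (simp add: take_Suc_conv_app_nth)
next
  show "Q R1 M1 Z1 t1" if "frame {21, 22, 29, 31} R R1 \<and> M1 = M \<and> Z1 = Z @ take (length xs) xs"
    "t1 \<le> t + 3 + (3 + 4) * length xs" for R1 M1 Z1 t1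
    using that post by auto
qed (use R xs D_bounds in \<open>auto simp: frame_def\<close>)

lemma wp_fanprint:
  assumes c: "cregs qB R" and a: "work qB mk ord (ss @ xs) ss tv tf M" and R: "R 13 = length ss" "R 15 = length (ss @ xs)"
    and ss: "set (ss @ xs) \<subseteq> {..<n}"
    and post: "\<And>R' t'. frame {16, 20, 21, 22, 29, 31} R R' \<Longrightarrow>
      t' \<le> t + 3 + (15 + 7 * length ss) * length xs \<Longrightarrow> Q R' M (Z @ concat (map (\<lambda>w. ss @ [w]) xs)) t'"
  shows "wp fanprint Q R M Z t"
proof -
  note b = work_bounds[OF a] D_bounds
  let ?W = "{16, 20, 21, 22, 29, 31 :: nat}"
  let ?d = "15 + 7 * length ss"
  define I where "I = (\<lambda>x R' M' Z'. x \<le> length xs \<and> M' = M \<and> frame ?W R R' \<and> R' 16 = length ss + x \<and>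
     R' 20 = length xs - x \<and> Z' = Z @ concat (map (\<lambda>w. ss @ [w]) (take x xs)))"
  let ?f = "\<lambda>x. ?d * (length xs - x)"
  let ?b = "printA 10 13 ;; Ins (ADD 22 9 16) ;; Ins (LOAD 21 22) ;; Ins (PRINT 21) ;;
       Ins (ADD 16 16 1) ;; Ins (SUB 20 15 16)"
  have "wp (Loop 20 ?b) Q (R(16 := length ss, 20 := length xs)) M Z (t + 2)"
  proof (rule wp_Loop[where I = I and f = ?f and g = 0])
    show "I 0 (R(16 := length ss, 20 := length xs)) M Z" by (auto simp: I_def frame_def)
  next
    fix x R' M' Z' t' assume "I x R' M' Z'" "R' 20 = 0" "t' + ?f x \<le> t + 2 + ?f 0 + 1"
    then show "Q R' M' Z' t'" using post[of R' t'] by (auto simp: I_def)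
  next
    fix x R1 M1 Z1 t1 P assume I: "I x R1 M1 Z1" "R1 20 \<noteq> 0"
      and P: "\<And>x' R' M' Z' t'. I x' R' M' Z' \<Longrightarrow> ?f x' < ?f x \<Longrightarrow> t' + 2 + ?f x' \<le> t1 + ?f x \<Longrightarrow> P R' M' Z' t'"
    then have x: "x < length xs" by (auto simp: I_def)
    have I': "M1 = M" "frame ?W R R1" "R1 16 = length ss + x" "Z1 = Z @ concat (map (\<lambda>w. ss @ [w]) (take x xs))"
      using I by (auto simp: I_def)
    have c1: "cregs qB R1" by (rule cregs_frame[OF c I'(2)]) auto
    have q: "M (qB + (length ss + x)) = xs ! x" using work_nth(3)[OF a, of "length ss + x"] x by (simp add: nth_append)
    have xn: "xs ! x < n" using ss nth_mem[OF x] by auto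
    have len: "length ss + length xs \<le> n" using b by simp
    have e: "?d * (length xs - x) = ?d * (length xs - Suc x) + ?d"
      using x by (metis Suc_diff_Suc add.commute mult_Suc_right)
    show "wp ?b P R1 M1 Z1 t1"
      unfolding wp.simps(3)
    proof (rule wp_printA[where base = "D + 3 * n" and xs = ss])
      show "array M1 (D + 3 * n) ss" using a I' by (simp add: work_def)
      show "R1 13 = length ss" using R by (simp add: frameD[OF I'(2)])
      show "y \<le> B" if "y \<in> set ss" for y using that ss b by auto
      fix R2 t2 assume e2: "frame {21, 22, 29, 31} R1 R2" and t2: "t2 \<le> t1 + 3 + 7 * length ss"
      have c2: "cregs qB R2" by (rule cregs_frame[OF c1 e2]) auto
      have R2: "R2 16 = length ss + x" "R2 15 = length ss + length xs" "R2 13 = length ss"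
        using I' R by (auto simp: frameD[OF e2] frameD[OF I'(2)])
      have K: "P R3 M Z3 t3" if "frame {16, 20, 21, 22} R2 R3" "R3 16 = Suc (length ss + x)" "R3 20 = length xs - Suc x"
        "Z3 = Z1 @ ss @ [xs ! x]" "t3 \<le> t2 + 5" for R3 Z3 t3
      proof (rule P[of "Suc x"])
        have "frame ?W R R3" using I'(2) e2 that(1) by (auto simp: frame_def)
        then show "I (Suc x) R3 M Z3"
          using that x I' unfolding I_def by (auto simp: take_Suc_conv_app_nth)
      qed (use e t2 that in auto)
      show "wp (Ins (ADD 22 9 16)) (wp (Ins (LOAD 21 22)) (wp (Ins (PRINT 21)) (wp (Ins (ADD 16 16 1))
            (wp (Ins (SUB 20 15 16)) P)))) R2 M1 (Z1 @ ss) t2"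
        using R2 I'(1) q xn len x b by (simp add: cregsD[OF c2] K frame_def)
    qed (use cregsD[OF c1] b len in auto)
  qed
  then show ?thesis using R b by (simp add: fanprint_def cregsD[OF c])
qed

text \<open>The condition of \<open>lists_graphlets\<close> for an arbitrary family of sets, so that
  the outputs for disjoint families can be joined.\<close>

definition listing :: "nat list list \<Rightarrow> nat set set \<Rightarrow> bool" where
  "listing xss \<X> \<longleftrightarrow> (\<forall>xs \<in> set xss. distinct xs) \<and> distinct (map set xss) \<and> set (map set xss) = \<X>"

lemma expanded_fan:
  assumes "expanded A adj ss Q1 (length ss) cur []" "active A adj" "set ss \<subseteq> A"
  shows "\<exists>xs. Q1 = ss @ xs \<and> distinct (ss @ xs) \<and> set xs = {w \<in> A - set ss. \<exists>u \<in> set ss. (u, w) \<in> E}"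
proof -
  note X = assms(1)[unfolded expanded_def]
  obtain xs where xs: "Q1 = ss @ xs" using X by blast
  have adjA: "\<And>u. u \<in> set ss \<Longrightarrow> set (adj u) = {w \<in> A. (u, w) \<in> E}" using assms(2,3) by (auto simp: active_def)
  have 1: "w \<in> set xs" if "w \<in> A - set ss" "u \<in> set ss" "(u, w) \<in> E" for u w
  proof -
    have "\<forall>u \<in> set (take (length ss) Q1). set (adj u) \<subseteq> set Q1 \<union> (if u = cur then set [] else {})"
      using X by blast
    then have "set (adj u) \<subseteq> set Q1" using that(2) xs by (auto split: if_splits)
    then show ?thesis using adjA[OF that(2)] that xs by auto
  qed
  have 2: "\<exists>u \<in> set ss. (u, w) \<in> E" if w: "w \<in> set xs" for w
  proof -
    obtain j where j: "j < length xs" "xs ! j = w" using w by (auto simp: in_set_conv_nth)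
    obtain l' where l': "l' < length ss" "Q1 ! (length ss + j) \<in> set (adj (Q1 ! l'))"
      using X xs j by (metis le_add1 length_append nat_add_left_cancel_less)
    then have "w \<in> set (adj (ss ! l'))" using xs j by (simp add: nth_append)
    then show ?thesis using adjA[of "ss ! l'"] l'(1) by auto
  qed
  show ?thesis using 1 2 X xs by (intro exI[of _ xs]) auto
qed

lemma listing_fan:
  assumes "distinct (ss @ xs)"
  shows "listing (map (\<lambda>w. ss @ [w]) xs) ((\<lambda>w. insert w (set ss)) ` set xs)"
proof -
  have "inj_on (\<lambda>w. insert w (set ss)) (set xs)"
    using assms by (intro inj_onI) (metis disjoint_iff distinct_append insertE insertI1)
  then show ?thesis using assms by (auto simp: listing_def distinct_map comp_def)
qed

abbreviation forced :: "nat list \<Rightarrow> (nat \<times> nat) list" where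
  "forced F \<equiv> map (\<lambda>v. (v, 0)) F"

abbreviation WN :: "nat set" where
  "WN \<equiv> {13, 14, 15, 16, 17, 18, 19, 20, 21, 22, 23, 24, 29, 31}"

lemma wp_fan:
  assumes c: "cregs qB R" and k2: "2 \<le> k" and A: "active A adj" and ss: "distinct ss" "set ss \<subseteq> A" "conn E (set ss)"
    and len: "length ss + 1 = k" and ne: "csets E k A (set ss) \<noteq> {}" and r: "repr adj M"
    and a: "work qB {} ord qs ss tv tf M" and R: "R 13 = length ss"
    and post: "\<And>R' M' t' qs' xss. frame {15, 16, 17, 20, 21, 22, 23, 24, 29, 31} R R' \<Longrightarrow> R' 24 = 2 \<Longrightarrow>
      t' \<le> t + 300 * (k * k * card (csets E k A (set ss))) \<Longrightarrow>
      work qB {} ord qs' ss tv tf M' \<Longrightarrow> (\<And>x. x < D \<Longrightarrow> M' x = M x) \<Longrightarrow>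
      listing xss (csets E k A (set ss)) \<Longrightarrow> Q R' M' (Z @ concat xss) t'"
  shows "wp (copyS ;; expand 13 ;; fanprint ;; unmarkQ ;; Ins (LOADI 24 2)) Q R M Z t"
  unfolding wp.simps(3)
proof (rule wp_copyS[OF c R a])
  have An: "A \<subseteq> {..<n}" using A by (simp add: active_def)
  then show "set ss \<subseteq> {..<n}" using ss by blast
  fix R1 M1 t1
  assume e1: "frame {15, 16, 17, 21, 22, 31} R R1" and R1: "R1 15 = length ss" "R1 16 = 0" "R1 17 = 0"
    and t1: "t1 \<le> t + 6 + 10 * length ss" and a1: "work qB (set ss) ord ss ss tv tf M1" and
    l1: "\<And>x. x < D \<Longrightarrow> M1 x = M x"
  have c1: "cregs qB R1" by (rule cregs_frame[OF c e1]) auto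
  have r1: "repr adj M1" by (rule repr_cong[OF r l1])
  have R1': "13 = (13::nat) \<and> R1 13 = length ss \<or> 13 = (15::nat)" using R by (simp add: frameD[OF e1])
  show "wp (expand 13) (wp fanprint (wp unmarkQ (wp (Ins (LOADI 24 2)) Q))) R1 M1 Z t1"
  proof (rule wp_expand[OF c1 R1' A r1 a1 ss(1,2) R1 refl], goal_cases)
    case (1 R2 M2 t2 Q1 cur)
    have c2: "cregs qB R2" by (rule cregs_frame[OF c1 1(1)]) auto
    obtain xs where xs: "Q1 = ss @ xs" "distinct (ss @ xs)" "set xs = {w \<in> A - set ss. \<exists>u \<in> set ss. (u, w) \<in> E}"
      using expanded_fan[of A adj ss Q1 cur] 1(6) A ss by auto
    have Xs: "csets E k A (set ss) = (\<lambda>w. insert w (set ss)) ` set xs"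
      unfolding xs(3) by (rule csets_fan[OF symE ss(3)]) (use ss len in \<open>auto simp: distinct_card\<close>)
    have L: "listing (map (\<lambda>w. ss @ [w]) xs) (csets E k A (set ss))" unfolding Xs by (rule listing_fan[OF xs(2)])
    have N: "card (csets E k A (set ss)) = length xs"
      using L distinct_card[of "map set (map (\<lambda>w. ss @ [w]) xs)"] by (auto simp: listing_def)
    have xs0: "0 < length xs" using ne Xs by (cases xs) auto
    have Q1n: "set (ss @ xs) \<subseteq> {..<n}" using ss xs An by auto
    \<comment> \<open>Each available neighbour of a vertex of \<open>T\<close> is in
      \<open>T\<close> or is a fan vertex, and fan vertices correspond to solutions. So scanning all
      lists of \<open>T\<close> is paid for by the output.\<close>
    have deg: "length (adj u) \<le> length ss + length xs" if u: "u \<in> set ss" for u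
    proof -
      have "u \<in> A" using u ss by blast
      then have "distinct (adj u)" "set (adj u) \<subseteq> set (ss @ xs)"
        using r A An u xs(3) by (auto simp: repr_def reprv_def active_def)
      then have "length (adj u) \<le> card (set (ss @ xs))" by (metis card_mono distinct_card finite_set)
      then show ?thesis using card_length[of "ss @ xs"] by simp
    qed
    have "(\<Sum>u\<in>set ss. length (adj u) + 2) \<le> (\<Sum>u\<in>set ss. length ss + length xs + 2)"
      by (intro sum_mono) (use deg in auto)
    then have sm: "(\<Sum>u\<in>set ss. length (adj u) + 2) \<le> length ss * (length ss + length xs + 2)"
      using ss(1) by (simp add: distinct_card)
    show ?case
    proof (rule wp_fanprint[OF c2 1(4)[unfolded xs(1)] _ 1(2)[unfolded xs(1)] Q1n])
      show "R2 13 = length ss" using R by (simp add: frameD[OF 1(1)] frameD[OF e1])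
      fix R3 t3 assume e3: "frame {16, 20, 21, 22, 29, 31} R2 R3"
        and t3: "t3 \<le> t2 + 3 + (15 + 7 * length ss) * length xs"
      have c3: "cregs qB R3" by (rule cregs_frame[OF c2 e3]) auto
      have R3: "R3 15 = length (ss @ xs)" using 1(2) xs(1) by (simp add: frameD[OF e3])
      show "wp unmarkQ (wp (Ins (LOADI 24 2)) Q) R3 M2 (Z @ concat (map (\<lambda>w. ss @ [w]) xs)) t3"
      proof (rule wp_unmarkQ[OF c3 R3 1(4)[unfolded xs(1)] Q1n])
        fix R4 M4 t4
        assume e4: "frame {16, 21, 22, 31} R3 R4" and t4: "t4 \<le> t3 + 3 + 8 * length (ss @ xs)"
          and a4: "work qB (set (ss @ xs) - set (ss @ xs)) ord (ss @ xs) ss tv tf M4"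
          and l4: "\<And>x. x < D \<Longrightarrow> M4 x = M2 x"
        have "Q (R4(24 := 2)) M4 (Z @ concat (map (\<lambda>w. ss @ [w]) xs)) (Suc t4)"
        proof (rule post[OF _ _ _ _ _ L])
          show "frame {15, 16, 17, 20, 21, 22, 23, 24, 29, 31} R (R4(24 := 2))"
            using e1 1(1) e3 e4 by (auto simp: frame_def)
          show "work qB {} ord (ss @ xs) ss tv tf M4" using a4 by simp
          show "M4 x = M x" if "x < D" for x using that l1 1(5) l4 by simp
          let ?p = "k * k * length xs"
          have s: "length ss + 1 = k" by fact
          have p: "k * k \<le> ?p" "k * length xs \<le> ?p" "length xs \<le> ?p" "k \<le> ?p" "1 \<le> ?p"
            "length ss * length ss \<le> ?p" "length ss * length xs \<le> ?p" "length ss \<le> ?p"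
          proof -
            show a: "k * k \<le> ?p" "k * length xs \<le> ?p" "length xs \<le> ?p" using xs0 k2 by (auto simp: Suc_le_eq)
            have kk: "k \<le> k * k" "length ss \<le> k" using k2 s by auto
            then show b: "k \<le> ?p" using a by linarith
            then show "1 \<le> ?p" using k2 by linarith
            show "length ss * length ss \<le> ?p" using mult_mono[of "length ss" k "length ss" k] kk a by linarith
            show "length ss * length xs \<le> ?p" using mult_mono[of "length ss" k "length xs" "length xs"] kk a by linarith
            show "length ss \<le> ?p" using kk b by linarith
          qed
          have "t4 \<le> t + 6 + 10 * length ss + 22 + 20 * (length ss * (length ss + length xs + 2)) +
            3 + (15 + 7 * length ss) * length xs + 3 + 8 * length (ss @ xs)"
            using t1 1(3) t3 t4 sm by simp
          also have "\<dots> = t + 34 + 58 * length ss + 20 * (length ss * length ss) + 27 * (length ss * length xs) + 23 * length xs"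
            by (simp add: algebra_simps)
          finally show "Suc t4 \<le> t + 300 * (k * k * card (csets E k A (set ss)))"
            unfolding N using p by linarith
        qed simp
        then show "wp (Ins (LOADI 24 2)) Q R4 M4 (Z @ concat (map (\<lambda>w. ss @ [w]) xs)) t4"
          using D_bounds by simp
      qed
    qed
  qed
qed

text \<open>One continuation for each way to leave a node. A branching outputs nothing, so its cost
  has no factor \<open>N\<close>; its queue of \<open>k\<close> vertices provides the solution
  without \<open>v\<close>. A leaf outputs all solutions of the node, and its time may grow with
  their number.\<close>

lemma wp_node:
  assumes c: "cregs qB R" and k2: "2 \<le> k" and nd: "node A adj ss T" and r: "repr adj M"
    and a: "work qB {} ord qs ss (map fst T) (map snd T) M"
    and R: "R 13 = length ss" "R 14 = length T" "R 24 = 1"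
    and branch: "\<And>R' M' t' qs' F v. frame WN R R' \<Longrightarrow> R' 24 = 1 \<Longrightarrow>
      R' 13 = length (ss @ F @ [v]) \<Longrightarrow> R' 14 = length (T @ forced F @ [(v, 1)]) \<Longrightarrow>
      t' \<le> t + 400 * (k * k) \<Longrightarrow>
      work qB {} ord qs' (ss @ F @ [v]) (map fst (T @ forced F @ [(v, 1)])) (map snd (T @ forced F @ [(v, 1)])) M' \<Longrightarrow>
      (\<And>x. x < D \<Longrightarrow> M' x = M x) \<Longrightarrow> distinct (ss @ F @ [v]) \<Longrightarrow> set (ss @ F @ [v]) \<subseteq> A \<Longrightarrow>
      conn E (set (ss @ F)) \<Longrightarrow> conn E (set (ss @ F @ [v])) \<Longrightarrow> length (ss @ F) + 2 \<le> k \<Longrightarrow>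
      csets E k A (set (ss @ F)) = csets E k A (set ss) \<Longrightarrow>
      csets E k (A - {v}) (set (ss @ F)) \<noteq> {} \<Longrightarrow> Q R' M' Z t'"
    and leaf: "\<And>R' M' t' qs' F xss. frame WN R R' \<Longrightarrow> R' 24 = 2 \<Longrightarrow>
      R' 13 = length (ss @ F) \<Longrightarrow> R' 14 = length (T @ forced F) \<Longrightarrow>
      t' \<le> t + 700 * (k * k * card (csets E k A (set ss))) \<Longrightarrow>
      work qB {} ord qs' (ss @ F) (map fst (T @ forced F)) (map snd (T @ forced F)) M' \<Longrightarrow>
      (\<And>x. x < D \<Longrightarrow> M' x = M x) \<Longrightarrow> set (ss @ F) \<subseteq> A \<Longrightarrow> length F \<le> k \<Longrightarrow>
      listing xss (csets E k A (set ss)) \<Longrightarrow> Q R' M' (Z @ concat xss) t'"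
  shows "wp node_com Q R M Z t"
  unfolding node_com_def wp.simps(3)[of copyS] wp.simps(3)[of "Ins _"] wp.simps(3)[of "Loop _ _"]
    wp.simps(3)[of unmarkQ] wp.simps(3)[of "Cond _ _ _"]
proof (rule wp_copyS[OF c R(1) a])
  have A: "active A adj" and An: "A \<subseteq> {..<n}" and ss: "set ss \<subseteq> A" "length ss < k" "distinct ss"
    and ne: "csets E k A (set ss) \<noteq> {}" and finA: "finite A"
    using nd by (auto simp: node_def active_def intro: finite_subset[of _ "{..<n}"])
  have kB: "k - x \<le> B" for x using B_big by simp
  show "set ss \<subseteq> {..<n}" using ss An by blast
  fix R1 M1 t1
  assume e1: "frame {15, 16, 17, 21, 22, 31} R R1" and R1: "R1 15 = length ss" "R1 16 = 0" "R1 17 = 0"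
    and t1: "t1 \<le> t + 6 + 10 * length ss" and a1: "work qB (set ss) ord ss ss (map fst T) (map snd T) M1" and
    l1: "\<And>x. x < D \<Longrightarrow> M1 x = M x"
  have c1: "cregs qB R1" by (rule cregs_frame[OF c e1]) auto
  have r1: "repr adj M1" by (rule repr_cong[OF r l1])
  let ?R1 = "R1(18 := 0, 20 := k - 1 - length ss)"
  define Z2 where "Z2 = wp (Ins (SUB 23 6 13)) (wp (Cond 23
       (Cond 18 (push 1) (printA 9 15 ;; Ins (LOADI 24 2)))
       (copyS ;; expand 13 ;; fanprint ;; unmarkQ ;; Ins (LOADI 24 2))) Q)"
  define Z1 where "Z1 = wp (Cond 18 (Ins (ADD 22 7 19) ;; Ins (STORE 22 0)) Skip) Z2"
  have "wp (Loop 20 search_body) (wp unmarkQ Z1) ?R1 M1 Z (t1 + 2)"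
  proof (rule wp_search[OF _ k2 nd r1 a1], goal_cases)
    case (9 R2 M2 t2 F Q1 i cur dn rs h)
    note s = 9(9)[unfolded search_def]
    have cs0: "csets E k A (set (ss @ F)) = csets E k A (set ss)" using s by (elim conjE)
    have Q1k: "length Q1 \<le> k" using s by (elim conjE)
    have c2: "cregs qB R2" by (rule cregs_frame[OF _ 9(1)]) (use c1 in auto)
    have Q1n: "set Q1 \<subseteq> {..<n}" using s An by blast
    show ?case
    proof (rule wp_unmarkQ[OF c2 9(4,7) Q1n])
      fix R3 M3 t3
      assume e3: "frame {16, 21, 22, 31} R2 R3" and t3: "t3 \<le> t2 + 3 + 8 * length Q1"
        and a3: "work qB (set Q1 \<union> held h (R2 19) - set Q1) ord Q1 (ss @ F) (map fst T @ F)
          (map snd T @ map (\<lambda>_. 0) F) M3" and l3: "\<And>x. x < D \<Longrightarrow> M3 x = M2 x"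
      let ?v = "R2 19"
      have c3: "cregs qB R3" by (rule cregs_frame[OF c2 e3]) auto
      have v: "h \<noteq> 0 \<Longrightarrow> ?v \<in> A \<and> ?v < n \<and> ?v \<notin> set Q1" using s An by (auto simp: held_def)
      define q where "q = k * k"
      have kk: "k \<le> q" "1 \<le> q" using k2 by (auto simp: q_def)
      have step: "Z2 R4 M4 Z t4" if e4: "frame {22} R3 R4"
        and a4: "work qB {} ord Q1 (ss @ F) (map fst T @ F) (map snd T @ map (\<lambda>_. 0) F) M4"
        and l4: "\<And>x. x < D \<Longrightarrow> M4 x = M x" and t4: "t4 \<le> t3 + 4" for R4 M4 t4
      proof -
        have c4: "cregs qB R4" by (rule cregs_frame[OF c3 e4]) auto
        have R4: "R4 13 = length (ss @ F)" "R4 14 = length T + length F" "R4 15 = length Q1" "R4 18 = h"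
          "R4 19 = ?v" "R4 24 = 1"
          using 9(1-5) R by (auto simp: frameD[OF e4] frameD[OF e3] frameD[OF 9(1)] frameD[OF e1])
        have eR: "frame WN R R4" using e1 9(1) e3 e4 by (auto simp: frame_def)
        have tt: "t4 + 20 + 10 * k \<le> t + 390 * (k * k)"
        proof -
          have "length Q1 \<le> k" "length ss < k" using Q1k ss by auto
          then show ?thesis using t1 9(6) t3 t4 kk unfolding q_def[symmetric] by simp
        qed
        have b: "length Q1 \<le> n" "length (ss @ F) \<le> n" "D + n \<le> qB" "qB \<le> D + 2 * n"
          using work_bounds[OF a4] by auto
        consider (fan) "length (ss @ F) + 1 = k" "h = 0" | (br) "length (ss @ F) + 2 \<le> k" "h = 1" "length Q1 = k" |
          (comp) "length (ss @ F) + 2 \<le> k" "h = 0" "rs = []" "i = length Q1"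
          using 9(10) unfolding search_exit_def by blast
        then show "Z2 R4 M4 Z t4"
        proof cases
          case fan
          note cs = cs0
          have "wp (copyS ;; expand 13 ;; fanprint ;; unmarkQ ;; Ins (LOADI 24 2)) Q (R4(23 := 0)) M4 Z (t4 + 2)"
          proof (rule wp_fan[OF _ k2 A _ _ _ fan(1) _ _ a4], goal_cases)
            case (8 R5 M5 t5 qs5 xss)
            show ?case
            proof (rule leaf[of _ F])
              show "frame WN R R5" using eR 8(1) by (auto simp: frame_def)
              show "R5 13 = length (ss @ F)" "R5 14 = length (T @ forced F)"
                using R4 by (auto simp: frameD[OF 8(1)])
              show "work qB {} ord qs5 (ss @ F) (map fst (T @ forced F)) (map snd (T @ forced F)) M5"
                using 8(4) by (simp add: comp_def)
              show "listing xss (csets E k A (set ss))" using 8(6) cs by simp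
              have "0 < card (csets E k A (set ss))" using ne finite_csets[OF finA] by (simp add: card_gt_0_iff)
              then have "k * k \<le> k * k * card (csets E k A (set ss))" by simp
              then show "t5 \<le> t + 700 * (k * k * card (csets E k A (set ss)))"
                using 8(3) tt unfolding cs by linarith
            qed (use 8 l4 fan s in auto)
          qed (use s c4 R4 ne cs repr_cong[OF r l4] in auto)
          then show ?thesis using fan R4 by (simp add: Z2_def cregsD[OF c4] kB)
        next
          case br
          have vv: "?v \<in> A" "?v < n" "?v \<notin> set Q1" using v br by auto
          have sQ: "set (ss @ F) \<subseteq> set Q1" "distinct (ss @ F)" "conn E (set (ss @ F))" using s by auto
          \<comment> \<open>Room for one more entry: the queue has \<open>k\<close> vertices of
            \<open>A\<close>, more than \<open>T\<close>, and by \<open>node\<close> the free part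
            of the trail is then nonempty as well.\<close>
          have "length (ss @ F) < card A" 
            using card_mono[of A "set Q1"] s finA br distinct_card[of Q1] by auto
          moreover have "length T + card A < length ss + n" using nd by (simp add: node_def)
          moreover have "card A \<le> n" using card_mono[OF _ An] by simp
          ultimately have sp: "length (ss @ F) < n" "length T + length F < n" by auto
          obtain u where u: "u \<in> set (ss @ F)" "(u, ?v) \<in> E" using s br by auto
          have K: "Q R5 M5 Z t5" if "M5 = M4(D + 3 * n + length (ss @ F) := ?v,
               D + 4 * n + (length T + length F) := ?v, D + 5 * n + (length T + length F) := 1)"
            "frame {13, 14, 22, 23} R4 R5" "R5 13 = Suc (length (ss @ F))" "R5 14 = Suc (length T + length F)"
            "t5 \<le> t4 + 20" for R5 M5 t5
          proof (rule branch[of _ F ?v])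
            show "frame WN R R5" using eR that(2) by (auto simp: frame_def)
            show "R5 24 = 1" using R4 by (simp add: frameD[OF that(2)])
            show "R5 13 = length (ss @ F @ [?v])" "R5 14 = length (T @ forced F @ [(?v, 1)])" using that by auto
            have "work qB {} ord Q1 ((ss @ F) @ [?v]) ((map fst T @ F) @ [?v]) ((map snd T @ map (\<lambda>_. 0) F) @ [1]) M5"
              unfolding that(1) using sp
              by (intro work_snoc_tf work_snoc_tv work_snoc_s a4) auto
            then show "work qB {} ord Q1 (ss @ F @ [?v]) (map fst (T @ forced F @ [(?v, 1)]))
               (map snd (T @ forced F @ [(?v, 1)])) M5" by (simp add: comp_def)
            show "M5 x = M x" if "x < D" for x using l4[OF that] that \<open>M5 = _\<close> by simp
            show "distinct (ss @ F @ [?v])" "set (ss @ F @ [?v]) \<subseteq> A" using sQ vv s by auto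
            show "conn E (set (ss @ F))" by fact
            show "conn E (set (ss @ F @ [?v]))"
              using conn_insert[OF symE sQ(3) u] by simp
            show "csets E k (A - {?v}) (set (ss @ F)) \<noteq> {}"
            proof (rule csets_nonempty[OF symE, of "set Q1"])
              show "card (set (ss @ F)) \<le> k" using br(1) card_length[of "ss @ F"] by linarith
              show "k \<le> card (set Q1)" using s br(3) distinct_card[of Q1] by simp
              show "conn E (set Q1)" using s by blast
              show "set Q1 \<subseteq> A - {?v}" using s vv by blast
            qed (use sQ in auto)
            show "csets E k A (set (ss @ F)) = csets E k A (set ss)" by (rule cs0)
          qed (use br tt that in auto)
          have "wp (push 1) (\<lambda>R M Z t. Q R M Z (Suc (Suc t))) (R4(23 := k - Suc (length (ss @ F)))) M4 Z (Suc (Suc (Suc t4)))"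
          proof (rule wp_push)
            fix R5 t5 assume e5: "frame {13, 14, 22} (R4(23 := k - Suc (length (ss @ F)))) R5" and R5: "R5 13 = Suc (length (ss @ F))"
              "R5 14 = Suc (length T + length F)" "t5 \<le> Suc (Suc (Suc t4)) + 8"
            show "Q R5 (M4(D + 3 * n + length (ss @ F) := (R4(23 := k - Suc (length (ss @ F)))) 19,
              D + 4 * n + (length T + length F) := (R4(23 := k - Suc (length (ss @ F)))) 19,
              D + 5 * n + (length T + length F) := 1)) Z (Suc (Suc t5))"
            proof (rule K)
              show "frame {13, 14, 22, 23} R4 R5" using e5 by (auto simp: frame_def)
            qed (use R4 R5 in auto)
          qed (use sp R4 c4 in auto)
          then show ?thesis using br R4
            by (simp add: Z2_def cregsD[OF c4] kB)
        next
          case comp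
          have cl: "csets E k A (set (ss @ F)) = {set Q1}"
          proof (rule csets_component)
            show "card (set Q1) \<le> k" using s card_length[of Q1] by linarith
            show "csets E k A (set (ss @ F)) \<noteq> {}" using cs0 ne by simp
            show "w \<in> set Q1" if "u \<in> set Q1" "w \<in> A" "(u, w) \<in> E" for u w
            proof -
              have "u \<in> A" using that s by blast
              then have "w \<in> set (adj u)" using that A by (auto simp: active_def)
              moreover have "set (adj u) \<subseteq> set Q1" using s that comp by (auto split: if_splits)
              ultimately show ?thesis by blast
            qed
            show "set (ss @ F) \<noteq> {}" using s by (auto simp: conn_def)
          qed (use s in auto)
          then have cs: "csets E k A (set ss) = {set Q1}" using cs0 by simp
          note len = Q1k
          have R4': "k - 1 - length (ss @ F) \<noteq> 0" using comp by simp
          have "wp (printA 9 15) (wp (Ins (LOADI 24 2)) (\<lambda>R M Z t. Q R M Z (Suc t)))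
              (R4(23 := k - 1 - length (ss @ F))) M4 Z (t4 + 3)"
          proof (rule wp_printA[where base = qB and xs = Q1])
            show "array M4 qB Q1" using a4 by (simp add: work_def)
            show "x \<le> B" if "x \<in> set Q1" for x using Q1n that D_bounds by auto
            show "qB + length Q1 \<le> S" using b D_bounds by simp
            fix R5 t5 assume e5: "frame {21, 22, 29, 31} (R4(23 := k - 1 - length (ss @ F))) R5"
              and t5: "t5 \<le> t4 + 3 + 3 + 7 * length Q1"
            have "Q (R5(24 := 2)) M4 (Z @ concat [Q1]) (Suc (Suc t5))"
            proof (rule leaf[of _ F])
              show "frame WN R (R5(24 := 2))" using eR e5 by (auto simp: frame_def)
              show "(R5(24 := 2)) 13 = length (ss @ F)" "(R5(24 := 2)) 14 = length (T @ forced F)"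
                using R4 by (auto simp: frameD[OF e5])
              show "work qB {} ord Q1 (ss @ F) (map fst (T @ forced F)) (map snd (T @ forced F)) M4"
                using a4 by (simp add: comp_def)
              show "listing [Q1] (csets E k A (set ss))" using cs s by (simp add: listing_def)
              show "Suc (Suc t5) \<le> t + 700 * (k * k * card (csets E k A (set ss)))"
                using t5 tt len kk unfolding cs q_def[symmetric] by simp
            qed (use l4 comp s in auto)
            then show "wp (Ins (LOADI 24 2)) (\<lambda>R M Z t. Q R M Z (Suc t)) R5 M4 (Z @ Q1) t5"
              using D_bounds by simp
          qed (use R4 c4 in \<open>auto simp: cregs_def\<close>)
          then show ?thesis using comp R4 R4'
            by (simp add: Z2_def cregsD[OF c4] numeral_3_eq_3 kB)
        qed
      qed
      have h: "R3 18 = h" "R3 19 = ?v" using 9(5) by (auto simp: frameD[OF e3])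
      have low: "\<And>x. x < D \<Longrightarrow> M3 x = M x" using l3 9(8) l1 by simp
      show "Z1 R3 M3 Z t3"
      proof (cases "h = 0")
        case True
        then show ?thesis using step[of R3 M3 "t3 + 1"] a3 low h by (simp add: Z1_def frame_refl)
      next
        case False
        then have "set Q1 \<union> held h ?v - set Q1 - {?v} = {}" by (auto simp: held_def)
        then have "work qB {} ord Q1 (ss @ F) (map fst T @ F) (map snd T @ map (\<lambda>_. 0) F) (M3(D + ?v := 0))"
          using work_unmark[OF a3, of ?v] v[OF False] by metis
        then have "Z2 (R3(22 := D + ?v)) (M3(D + ?v := 0)) Z (Suc (Suc (Suc (Suc t3))))"
          using low by (intro step) (auto simp: frame_def)
        then show ?thesis using h False v[OF False] D_bounds by (simp add: Z1_def cregsD[OF c3])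
      qed
    qed
  qed (use c1 R1 R e1 in \<open>auto simp: frame_def\<close>)
  then show "wp (Ins (LOADI 18 0)) (wp (Ins (SUB 20 6 13)) (wp (Loop 20 search_body) (wp unmarkQ (wp (Cond 18 (Ins (ADD 22 7 19) ;; Ins (STORE 22 0)) Skip)
     (wp (Ins (SUB 23 6 13)) (wp (Cond 23
       (Cond 18 (push 1) (printA 9 15 ;; Ins (LOADI 24 2)))
       (copyS ;; expand 13 ;; fanprint ;; unmarkQ ;; Ins (LOADI 24 2))) Q)))))) R1 M1 Z t1"
    unfolding Z1_def Z2_def using R by (simp add: cregsD[OF c1] frameD[OF e1] kB)
qed

end

section \<open>Backtracking\<close>

text \<open>By truncated subtraction, \<open>flag - 1\<close> is nonzero only for flag 2; such a
  vertex is restored and \<open>T\<close> stays as it is. With flags 0 and 1 the vertex leaves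
  \<open>T\<close>. An entry with flag 1 is not dropped: only its flag changes to 2, and mode 1
  starts the node without the vertex.\<close>

definition pop_com :: com where
  "pop_com = Cond 14
     (Ins (SUB 14 14 1) ;; Ins (ADD 22 11 14) ;; Ins (LOAD 19 22) ;; Ins (ADD 22 12 14) ;; Ins (LOAD 23 22) ;;
      Ins (SUB 22 23 1) ;;
      Cond 22 (walk False)
        (Ins (SUB 13 13 1) ;;
         Cond 23 (walk True ;; Ins (ADD 22 12 14) ;; Ins (STORE 22 2) ;; Ins (ADD 14 14 1) ;; Ins (LOADI 24 1))
           Skip))
     (Ins (LOADI 24 0))"

definition enum_com :: com where
  "enum_com = Loop 24 (Ins (SUB 22 24 1) ;; Cond 22 pop_com node_com)"

context gmem
begin

lemma unlinked_cong:
  assumes "unlinked v ws M M'" "\<And>x. x < D \<Longrightarrow> M x = G x" "\<And>w. w \<in> set ws \<Longrightarrow> (w, v) \<in> E"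
  shows "unlinked v ws G M'"
  unfolding unlinked_def
proof (intro conjI allI impI ballI)
  show "M' x = G x" if "x < D" "\<forall>w\<in>set ws. x \<notin> region w" for x
    using assms that by (simp add: unlinked_def)
  fix w x assume w: "w \<in> set ws" "x \<in> region w"
  have "M y = G y" if "y \<in> region w" for y using region_low[OF that] assms(2) ED[OF assms(3)[OF w(1)]] by blast
  then have "relink True v w M x = relink True v w G x" using relink_cong[OF assms(3)[OF w(1)] _ w(2)] by blast
  then show "M' x = relink True v w G x" using assms(1) w by (simp add: unlinked_def)
qed

text \<open>\<open>G\<close> fixes the graph part of the memory word for word, while the queue and
  the scratch registers are left open. So the states before and after a subtree satisfy the same
  \<open>config\<close>.\<close>

definition config :: "nat list \<Rightarrow> nat \<Rightarrow> (nat \<Rightarrow> nat) \<Rightarrow> nat list \<Rightarrow> (nat \<times> nat) list \<Rightarrow> (nat \<Rightarrow> nat) \<Rightarrow> (nat \<Rightarrow> nat) \<Rightarrow> bool"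
  where
  "config ord ri G ss T R M \<longleftrightarrow> cregs (D + 2 * n) R \<and> (\<forall>x < D. M x = G x) \<and>
     (\<exists>qs. work (D + 2 * n) {} ord qs ss (map fst T) (map snd T) M) \<and>
     R 13 = length ss \<and> R 14 = length T \<and> R 25 = ri"

lemma wp_pop_forced:
  assumes c: "config ord ri G (ss @ [v]) (T @ [(v, 0)]) R M" and v: "v < n"
    and post: "\<And>R' t'. config ord ri G ss T R' M \<Longrightarrow> R' 24 = R 24 \<Longrightarrow> t' \<le> t + 20 \<Longrightarrow> Q R' M Z t'"
  shows "wp pop_com Q R M Z t"
proof -
  obtain qs where a: "work (D + 2 * n) {} ord qs (ss @ [v]) (map fst (T @ [(v, 0)])) (map snd (T @ [(v, 0)])) M"
    and cc: "cregs (D + 2 * n) R" "R 13 = Suc (length ss)" "R 14 = Suc (length T)" "R 25 = ri" "\<forall>x<D. M x = G x"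
    using c by (auto simp: config_def)
  have m: "M (D + 4 * n + length T) = v" "M (D + 5 * n + length T) = 0"
    using work_nth(5,6)[OF a, of "length T"] by (auto simp: nth_append)
  have b: "Suc (length ss) \<le> n" "Suc (length T) \<le> n" using work_bounds[OF a] by auto
  have a': "work (D + 2 * n) {} ord qs ss (map fst T) (map snd T) M"
    using work_prefix[of _ _ _ qs "[]" ss "[v]" "map fst T" "[v]" "map snd T" "[0]"] a by simp
  have K: "Q R' M Z t'" if "frame {13, 14, 19, 22, 23} R R'" "R' 13 = length ss" "R' 14 = length T" "t' \<le> t + 20" for R' t'
  proof (rule post)
    have "cregs (D + 2 * n) R'" by (rule cregs_frame[OF cc(1) that(1)]) auto
    then show "config ord ri G ss T R' M"
      using a' cc that by (auto simp: config_def frameD[OF that(1)])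
    show "R' 24 = R 24" by (simp add: frameD[OF that(1)])
  qed (use that in auto)
  show ?thesis using cc(2,3) m b v D_bounds by (simp add: pop_com_def cregsD[OF cc(1)] K frame_def)
qed

lemma wp_pop_branch:
  assumes c: "config ord ri G (ss @ [v]) (T @ [(v, 1)]) R M" and v: "v < n"
    and r: "repr adj G" "\<And>w. w \<in> set (adj v) \<Longrightarrow> v \<in> set (adj w)"
    and post: "\<And>R' M' t'. config ord ri M' ss (T @ [(v, 2)]) R' M' \<Longrightarrow> R' 24 = 1 \<Longrightarrow> unlinked v (adj v) G M' \<Longrightarrow>
      t' \<le> t + 30 + 20 * length (adj v) \<Longrightarrow> Q R' M' Z t'"
  shows "wp pop_com Q R M Z t"
proof -
  obtain qs where a: "work (D + 2 * n) {} ord qs (ss @ [v]) (map fst (T @ [(v, 1)])) (map snd (T @ [(v, 1)])) M"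
    and cc: "cregs (D + 2 * n) R" "R 13 = Suc (length ss)" "R 14 = Suc (length T)" "R 25 = ri" "\<forall>x<D. M x = G x"
    using c by (auto simp: config_def)
  have m: "M (D + 4 * n + length T) = v" "M (D + 5 * n + length T) = 1"
    using work_nth(5,6)[OF a, of "length T"] by (auto simp: nth_append)
  have b: "Suc (length ss) \<le> n" "Suc (length T) \<le> n" using work_bounds[OF a] by auto
  have a': "work (D + 2 * n) {} ord qs ss (map fst T @ [v]) (map snd T) M"
    using work_prefix[of _ _ _ qs "[]" ss "[v]" "map fst T @ [v]" "[]" "map snd T" "[1]"] a by simp
  have rM: "repr adj M" using repr_cong[OF r(1)] cc(5) by simp
  define Q' where "Q' = wp (Ins (ADD 22 12 14)) (wp (Ins (STORE 22 2)) (wp (Ins (ADD 14 14 1)) (wp (Ins (LOADI 24 1))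
     (\<lambda>R M Z t. Q R M Z (Suc (Suc t))))))"
  have "wp (walk True) Q' R1 M Z t1"
    if e1: "frame {13, 14, 19, 22, 23} R R1" and R1: "R1 13 = length ss" "R1 14 = length T" "R1 19 = v" "t1 \<le> t + 12" for R1 t1
  proof -
    have c1: "cregs (D + 2 * n) R1" by (rule cregs_frame[OF cc(1) e1]) auto
    show ?thesis
    proof (rule wp_delete[OF c1 R1(3) v rM r(2)])
      fix R2 M2 t2 assume e2: "frame {17, 21, 22, 26, 27, 28} R1 R2" and t2: "t2 \<le> t1 + 5 + 20 * length (adj v)"
        and d2: "unlinked v (adj v) M M2" and h2: "\<And>x. D \<le> x \<Longrightarrow> M2 x = M x"
      have c2: "cregs (D + 2 * n) R2" by (rule cregs_frame[OF c1 e2]) auto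
      have R2: "R2 14 = length T" using R1 by (simp add: frameD[OF e2])
      let ?R = "R2(22 := D + 5 * n + length T, 14 := Suc (length T), 24 := Suc 0)"
      let ?M = "M2(D + 5 * n + length T := 2)"
      have "Q ?R ?M Z (Suc (Suc (Suc (Suc (Suc (Suc t2))))))"
      proof (rule post)
        have "work (D + 2 * n) {} ord qs ss (map fst T @ [v]) (map snd T @ [2]) ?M"
          by (rule work_snoc_tf[OF work_cong[OF a' h2]]) (use b in auto)
        then show "config ord ri ?M ss (T @ [(v, 2)]) ?R ?M"
          using c2 R1 cc by (auto simp: config_def frameD[OF e2] frameD[OF e1])
        have "unlinked v (adj v) G M2"
          by (rule unlinked_cong[OF d2]) (use cc(5) repr_E[OF r(1) v] ED in auto)
        then show "unlinked v (adj v) G ?M"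
          using repr_E[OF r(1) v] ED region_low unfolding unlinked_def by fastforce
      qed (use t2 R1 in auto)
      then show "Q' R2 M2 Z t2" using R2 b D_bounds by (simp add: Q'_def cregsD[OF c2])
    qed
  qed
  note K = this
  show ?thesis using cc(2,3) m b v D_bounds K by (simp add: pop_com_def cregsD[OF cc(1)] frame_def Q'_def)
qed

lemma wp_pop_undo:
  assumes c: "config ord ri G' ss (T @ [(v, 2)]) R M" and v: "v < n"
    and r: "repr adj G" "\<And>w. w \<in> set (adj v) \<Longrightarrow> v \<in> set (adj w)" "unlinked v (adj v) G G'"
    and post: "\<And>R' M' t'. config ord ri G ss T R' M' \<Longrightarrow> R' 24 = R 24 \<Longrightarrow>
      t' \<le> t + 30 + 20 * length (adj v) \<Longrightarrow> Q R' M' Z t'"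
  shows "wp pop_com Q R M Z t"
proof -
  obtain qs where a: "work (D + 2 * n) {} ord qs ss (map fst (T @ [(v, 2)])) (map snd (T @ [(v, 2)])) M"
    and cc: "cregs (D + 2 * n) R" "R 13 = length ss" "R 14 = Suc (length T)" "R 25 = ri" "\<forall>x<D. M x = G' x"
    using c by (auto simp: config_def)
  have m: "M (D + 4 * n + length T) = v" "M (D + 5 * n + length T) = 2"
    using work_nth(5,6)[OF a, of "length T"] by (auto simp: nth_append)
  have b: "length ss \<le> n" "Suc (length T) \<le> n" using work_bounds[OF a] by auto
  have a': "work (D + 2 * n) {} ord qs ss (map fst T) (map snd T) M"
    using work_prefix[of _ _ _ qs "[]" ss "[]" "map fst T" "[v]" "map snd T" "[2]"] a by simp
  have "wp (walk False) (\<lambda>R M Z t. Q R M Z (Suc (Suc t))) R1 M Z t1"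
    if e1: "frame {14, 19, 22, 23} R R1" and R1: "R1 14 = length T" "R1 19 = v" "t1 \<le> t + 12" for R1 t1
  proof -
    have c1: "cregs (D + 2 * n) R1" by (rule cregs_frame[OF cc(1) e1]) auto
    show ?thesis
    proof (rule wp_undelete[OF c1 R1(2) v r])
      show "M x = G' x" if "x < D" for x using cc(5) that by simp
      fix R2 M2 t2 assume e2: "frame {17, 21, 22, 26, 27, 28} R1 R2" and t2: "t2 \<le> t1 + 5 + 20 * length (adj v)"
        and l2: "\<And>x. x < D \<Longrightarrow> M2 x = G x" and h2: "\<And>x. D \<le> x \<Longrightarrow> M2 x = M x"
      have c2: "cregs (D + 2 * n) R2" by (rule cregs_frame[OF c1 e2]) auto
      show "Q R2 M2 Z (Suc (Suc t2))"
      proof (rule post)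
        show "config ord ri G ss T R2 M2"
          using work_cong[OF a' h2] c2 l2 cc R1 by (auto simp: config_def frameD[OF e2] frameD[OF e1])
        show "R2 24 = R 24" by (simp add: frameD[OF e2] frameD[OF e1])
      qed (use t2 R1 in auto)
    qed
  qed
  note K = this
  show ?thesis using cc(2,3) m b v D_bounds K by (simp add: pop_com_def cregsD[OF cc(1)] frame_def)
qed

lemma enum_com_node:
  assumes "R 24 = 1" "R (Suc 0) = 1"
    "wp node_com (\<lambda>R M Z t. wp enum_com Q R M Z (Suc t)) (R(22 := 0)) M Z (Suc (Suc (Suc t)))"
  shows "wp enum_com Q R M Z t"
  using assms unfolding enum_com_def by (subst wp_Loop_unfold) simp

lemma enum_com_pop:
  assumes "R 24 = 2" "R (Suc 0) = 1"
    "wp pop_com (\<lambda>R M Z t. wp enum_com Q R M Z (Suc (Suc t))) (R(22 := 1)) M Z (Suc (Suc (Suc t)))"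
  shows "wp enum_com Q R M Z t"
  using assms D_bounds unfolding enum_com_def by (subst wp_Loop_unfold) (simp add: numeral_2_eq_2)

lemma config_upd [simp]: "12 < i \<Longrightarrow> i \<notin> {13, 14, 25} \<Longrightarrow> config ord ri G ss T (R(i := x)) M = config ord ri G ss T R M"
  by (auto simp: config_def)

lemma config_cst: "config ord ri G ss T R M \<Longrightarrow> cregs (D + 2 * n) R"
  by (simp add: config_def)

text \<open>Forced vertices are popped without trying their exclusion, which would leave no
  solution; the graph is not touched.\<close>

lemma enum_com_pop_all:
  assumes "config ord ri G (ss @ F) (T @ forced F) R M" "R 24 = 2" "set F \<subseteq> {..<n}"
    "\<And>R' t'. config ord ri G ss T R' M \<Longrightarrow> R' 24 = 2 \<Longrightarrow> t' \<le> t + 25 * length F \<Longrightarrow> wp enum_com Q R' M Z t'"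
  shows "wp enum_com Q R M Z t"
  using assms
proof (induction F arbitrary: R t rule: rev_induct)
  case (snoc v F)
  have c: "cregs (D + 2 * n) R" using snoc.prems(1) by (rule config_cst)
  show ?case
  proof (rule enum_com_pop)
    show "wp pop_com (\<lambda>R M Z t. wp enum_com Q R M Z (Suc (Suc t))) (R(22 := 1)) M Z (Suc (Suc (Suc t)))"
    proof (rule wp_pop_forced[of ord ri G "ss @ F" v "T @ forced F"])
      fix R' t' assume A: "config ord ri G (ss @ F) (T @ forced F) R' M" "R' 24 = (R(22 := 1)) 24"
        "t' \<le> Suc (Suc (Suc t)) + 20"
      show "wp enum_com Q R' M Z (Suc (Suc t'))"
        by (rule snoc.IH) (use A snoc.prems in auto)
    qed (use snoc.prems in auto)
  qed (use snoc.prems c in \<open>auto simp: cregs_def\<close>)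
qed auto

text \<open>
  At most \<open>2 N - 1\<close> branchings and leaves take \<open>O(k\<^sup>2)\<close> steps each, and each of the \<open>N\<close> solutions pays
  \<open>O(k)\<close> for each of the at most \<open>k - s\<close> inclusions that lead to it.
\<close>

definition tbound :: "nat \<Rightarrow> nat \<Rightarrow> nat" where
  "tbound s N = 3000 * (k * k * (2 * N - 1)) + 100 * (k * ((k - s) * N))"

text \<open>For positive numbers of solutions,
  \<open>(2 * N1 - 1) + (2 * N2 - 1) + 1 = 2 * (N1 + N2) - 1\<close> pays for the search. Including
  a vertex lowers \<open>k - s\<close> by one for each of the \<open>N1\<close> solutions below it,
  which releases \<open>100 * (k * N1)\<close> for the deletion.\<close>

lemma tbound_branch:
  assumes "s \<le> s'" "s' + 2 \<le> k" "0 < N1" "0 < N2"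
  shows "tbound (Suc s') N1 + tbound s' N2 + 3000 * (k * k) + 100 * (k * N1) \<le> tbound s (N1 + N2)"
proof -
  obtain a b where N: "N1 = Suc a" "N2 = Suc b" using assms by (metis gr0_implies_Suc)
  obtain d where d: "k = s' + 2 + d" using assms by (metis le_Suc_ex)
  have 1: "(k - Suc s') * N1 + N1 = (k - s') * N1" using d by simp
  have 2: "(k - s') * N1 + (k - s') * N2 \<le> (k - s) * (N1 + N2)"
    using assms mult_le_mono1[of "k - s'" "k - s" "N1 + N2"] by (simp add: add_mult_distrib2)
  have "100 * (k * ((k - Suc s') * N1)) + 100 * (k * ((k - s') * N2)) + 100 * (k * N1) =
     100 * (k * ((k - s') * N1 + (k - s') * N2))"
    unfolding 1[symmetric] by (simp add: algebra_simps)
  also have "\<dots> \<le> 100 * (k * ((k - s) * (N1 + N2)))" using 2 by simp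
  finally have 3: "100 * (k * ((k - Suc s') * N1)) + 100 * (k * ((k - s') * N2)) + 100 * (k * N1) \<le>
     100 * (k * ((k - s) * (N1 + N2)))" .
  have 4: "3000 * (k * k * (2 * N1 - 1)) + 3000 * (k * k * (2 * N2 - 1)) + 3000 * (k * k) =
    3000 * (k * k * (2 * (N1 + N2) - 1))"
    unfolding N by (simp add: algebra_simps)
  show ?thesis unfolding tbound_def using 3 4 by linarith
qed

lemma tbound_leaf:
  assumes "0 < N"
  shows "3000 * (k * k * N) \<le> tbound s N"
proof -
  have "k * k * N \<le> k * k * (2 * N - 1)" by (rule mult_le_mono2) (use assms in simp)
  then show ?thesis unfolding tbound_def by linarith
qed

lemma listing_append:
  "listing xss X \<Longrightarrow> listing yss Y \<Longrightarrow> X \<inter> Y = {} \<Longrightarrow> listing (xss @ yss) (X \<union> Y)"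
  unfolding listing_def by (auto simp: disjoint_iff)

lemma active_delete:
  assumes "active A adj" "repr adj M" "v \<in> A"
  shows "active (A - {v}) (deladj v adj)" "\<And>w. w \<in> set (adj v) \<Longrightarrow> v \<in> set (adj w)"
proof -
  show s: "v \<in> set (adj w)" if "w \<in> set (adj v)" for w
    using assms that ED[of v w] by (auto simp: active_def)
  have "set (deladj v adj u) = {w \<in> A - {v}. (u, w) \<in> E}" if u: "u \<in> A - {v}" for u
  proof -
    have d: "distinct (adj u)" using assms u by (auto simp: active_def repr_def reprv_def)
    have au: "set (adj u) = {w \<in> A. (u, w) \<in> E}" using assms(1) u by (auto simp: active_def)
    have av: "set (adj v) = {w \<in> A. (v, w) \<in> E}" using assms(1,3) by (auto simp: active_def)
    show ?thesis
    proof (cases "u \<in> set (adj v)")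
      case True
      then show ?thesis using d au by (auto simp: deladj_def)
    next
      case False
      then have "(u, v) \<notin> E" using av u ED[of u v] by auto
      then show ?thesis using False au by (auto simp: deladj_def)
    qed
  qed
  then show "active (A - {v}) (deladj v adj)" using assms(1) by (auto simp: active_def)
qed

text \<open>The recursion that the loop simulates: whatever happens in the subtree, the same
  \<open>config\<close> reappears in mode 2 with the solutions printed. The measure drops because
  inclusion lengthens \<open>ss\<close> and exclusion shrinks \<open>A\<close>.\<close>

theorem wp_enumC:
  assumes "2 \<le> k" "node A adj ss T" "repr adj G" "config ord ri G ss T R M" "R 24 = 1"
    and "\<And>R' M' t' xss. config ord ri G ss T R' M' \<Longrightarrow> R' 24 = 2 \<Longrightarrow> listing xss (csets E k A (set ss)) \<Longrightarrow>
      t' \<le> t + tbound (length ss) (card (csets E k A (set ss))) \<Longrightarrow> wp enum_com Q R' M' (Z @ concat xss) t'"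
  shows "wp enum_com Q R M Z t"
  using assms
proof (induction "card A - length ss" arbitrary: A adj ss T G R M Z t rule: less_induct)
  case less
  note k2 = less.prems(1) and nd = less.prems(2) and r = less.prems(3) and cf = less.prems(4) and cont = less.prems(6)
  have A: "active A adj" and An: "A \<subseteq> {..<n}" and ss: "distinct ss" "set ss \<subseteq> A" "length ss < k"
    and ne: "csets E k A (set ss) \<noteq> {}" and cap: "length T + card A < length ss + n"
    using nd by (auto simp: node_def active_def)
  have finA: "finite A" using An finite_subset by blast
  have N0: "0 < card (csets E k A (set ss))" using ne finite_csets[OF finA] by (simp add: card_gt_0_iff)
  obtain qs where c: "cregs (D + 2 * n) R" "\<And>x. x < D \<Longrightarrow> M x = G x"
     "work (D + 2 * n) {} ord qs ss (map fst T) (map snd T) M" "R 13 = length ss" "R 14 = length T" "R 25 = ri"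
    using cf by (auto simp: config_def)
  have rM: "repr adj M" using repr_cong[OF r c(2)] .
  have kk: "k \<le> k * k" "1 \<le> k * k" using k2 by auto
  show ?case
  proof (rule enum_com_node)
    show "R 24 = 1" "R (Suc 0) = 1" using less.prems c(1) by (auto simp: cregs_def)
    show "wp node_com (\<lambda>R M Z t. wp enum_com Q R M Z (Suc t)) (R(22 := 0)) M Z (Suc (Suc (Suc t)))"
    proof (rule wp_node[OF _ k2 nd rM c(3)], goal_cases)
      case (5 R1 M1 t1 qs1 F v)
      let ?s = "ss @ F" and ?T = "T @ forced F"
      have v: "v \<in> A" "v < n" using 5(9) An by auto
      have c1: "cregs (D + 2 * n) R1" by (rule cregs_frame[OF _ 5(1)]) (use c(1) in auto)
      have cf1: "config ord ri G (?s @ [v]) (?T @ [(v, 1)]) R1 M1"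
        using c1 5 c by (auto simp: config_def frameD[OF 5(1)])
      note del = active_delete[OF A r v(1)]
      let ?X1 = "csets E k A (set (?s @ [v]))" and ?X2 = "csets E k (A - {v}) (set ?s)"
      have X: "csets E k A (set ss) = ?X1 \<union> ?X2" "?X1 \<inter> ?X2 = {}"
        using csets_split[where E = E and k = k and A = A and T = "set ?s" and v = v] 5(13) by auto
      have cs: "length (?s @ [v]) \<le> card A"
        using card_mono[OF finA 5(9)] distinct_card[OF 5(8)] by simp
      \<comment> \<open>A solution \<open>Y\<close> without \<open>v\<close> and the connected set
        \<open>T \<union> {v}\<close> overlap, so their union is connected and has at least
        \<open>k\<close> vertices; inside it \<open>T \<union> {v}\<close> grows to a
        solution.\<close>
      have ne1: "?X1 \<noteq> {}"
      proof -
        obtain Y where Y: "set ?s \<subseteq> Y" "Y \<subseteq> A - {v}" "conn E Y" "card Y = k"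
          using 5(14) by (auto simp: csets_def)
        have fY: "finite Y" using Y(2) finA finite_subset by blast
        obtain z where "z \<in> set ?s" using 5(10)[unfolded conn_def, THEN conjunct1] by (metis ex_in_conv)
        then have "z \<in> Y \<inter> set (?s @ [v])" using Y(1) by auto
        then have "conn E (Y \<union> set (?s @ [v]))"
          using conn_Un[OF Y(3), of "set (?s @ [v])"] 5(11) by auto
        then show ?thesis
        proof (intro csets_nonempty[OF symE, of "Y \<union> set (?s @ [v])"])
          show "card (set (?s @ [v])) \<le> k" using card_length[of "?s @ [v]"] 5(12) by simp
          show "k \<le> card (Y \<union> set (?s @ [v]))" using Y(4) card_mono[of "Y \<union> set (?s @ [v])" Y] fY by auto
        qed (use Y fY 5 v in auto)
      qed
      have fin: "finite ?X1" "finite ?X2" using finA by (simp_all add: finite_csets)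
      have N: "card (csets E k A (set ss)) = card ?X1 + card ?X2"
        unfolding X(1) by (rule card_Un_disjoint[OF fin X(2)])
      have N12: "0 < card ?X1" "0 < card ?X2" using ne1 5(14) fin by (auto simp: card_gt_0_iff)
      \<comment> \<open>The list of \<open>v\<close> is walked twice, for deletion and for
        restoration, at 20 steps per entry. This makes at most \<open>80 * (k * card ?X1)\<close>,
        within the share that \<open>tbound_branch\<close> releases.\<close>
      have deg: "length (adj v) \<le> 2 * (k * card ?X1)"
      proof -
        have "distinct (adj v)" using r v by (simp add: repr_def reprv_def)
        then have "length (adj v) = card {w \<in> A. (v, w) \<in> E}"
          using A v(1) distinct_card[of "adj v"] by (simp add: active_def)
        also have "\<dots> \<le> k + k * card ?X1"
          by (rule card_neighbours_le[OF symE finA _ _ ne1])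
            (use 5(9,11,12) card_length[of "?s @ [v]"] in auto)
        finally have "length (adj v) \<le> k + k * card ?X1" .
        moreover have "k \<le> k * card ?X1" using N12 by simp
        ultimately show ?thesis by linarith
      qed
      have node1: "node A adj (?s @ [v]) (?T @ [(v, 1)])"
        using A 5 ne1 cap by (auto simp: node_def)
      have meas1: "card A - length (?s @ [v]) < card A - length ss" using cs by simp
      \<comment> \<open>The continuations nest in the order of execution: the subtree with
        \<open>v\<close>, the deletion of \<open>v\<close>, the subtree without \<open>v\<close>,
        its restoration, and the removal of the forced vertices \<open>F\<close>.\<close>
      show ?case
      proof (rule less.hyps[OF meas1 k2 node1 r cf1 5(2)])
        fix R2 M2 t2 xss1
        assume cf2: "config ord ri G (?s @ [v]) (?T @ [(v, 1)]) R2 M2" and R2: "R2 24 = 2" and L1: "listing xss1 ?X1"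
          and t2: "t2 \<le> Suc t1 + tbound (length (?s @ [v])) (card ?X1)"
        show "wp enum_com Q R2 M2 (Z @ concat xss1) t2"
        proof (rule enum_com_pop)
          show "R2 24 = 2" "R2 (Suc 0) = 1" using R2 config_cst[OF cf2] by (auto simp: cregs_def)
          show "wp pop_com (\<lambda>R M Z t. wp enum_com Q R M Z (Suc (Suc t))) (R2(22 := 1)) M2 (Z @ concat xss1) (Suc (Suc (Suc t2)))"
          proof (rule wp_pop_branch[of ord ri G ?s v ?T _ _ adj])
            fix R3 M3 t3 assume cf3: "config ord ri M3 ?s (?T @ [(v, 2)]) R3 M3" and R3: "R3 24 = 1"
              and d3: "unlinked v (adj v) G M3" and t3: "t3 \<le> Suc (Suc (Suc t2)) + 30 + 20 * length (adj v)"
            have r3: "repr (deladj v adj) M3" by (rule repr_deladj[OF r d3 v(2) del(2)])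
            have node2: "node (A - {v}) (deladj v adj) ?s (?T @ [(v, 2)])"
              using del(1) 5 cap v finA cs by (auto simp: node_def)
            have meas2: "card (A - {v}) - length ?s < card A - length ss" using cs v finA by simp
            show "wp enum_com Q R3 M3 (Z @ concat xss1) (Suc (Suc t3))"
            proof (rule less.hyps[OF meas2 k2 node2 r3 cf3 R3])
              fix R4 M4 t4 xss2
              assume cf4: "config ord ri M3 ?s (?T @ [(v, 2)]) R4 M4" and R4: "R4 24 = 2" and L2: "listing xss2 ?X2"
                and t4: "t4 \<le> Suc (Suc t3) + tbound (length ?s) (card ?X2)"
              show "wp enum_com Q R4 M4 ((Z @ concat xss1) @ concat xss2) t4"
              proof (rule enum_com_pop)
                show "R4 24 = 2" "R4 (Suc 0) = 1" using R4 config_cst[OF cf4] by (auto simp: cregs_def)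
                show "wp pop_com (\<lambda>R M Z t. wp enum_com Q R M Z (Suc (Suc t))) (R4(22 := 1)) M4
                    ((Z @ concat xss1) @ concat xss2) (Suc (Suc (Suc t4)))"
                proof (rule wp_pop_undo[of ord ri M3 ?s ?T v _ _ adj G])
                  fix R5 M5 t5 assume cf5: "config ord ri G ?s ?T R5 M5" and R5: "R5 24 = (R4(22 := 1)) 24"
                    and t5: "t5 \<le> Suc (Suc (Suc t4)) + 30 + 20 * length (adj v)"
                  show "wp enum_com Q R5 M5 ((Z @ concat xss1) @ concat xss2) (Suc (Suc t5))"
                  proof (rule enum_com_pop_all[OF cf5])
                    show "R5 24 = 2" using R5 R4 by simp
                    show "set F \<subseteq> {..<n}" using 5(9) An by auto
                    fix R6 t6 assume cf6: "config ord ri G ss T R6 M5" and R6: "R6 24 = 2"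
                      and t6: "t6 \<le> Suc (Suc t5) + 25 * length F"
                    have "wp enum_com Q R6 M5 (Z @ concat (xss1 @ xss2)) t6"
                    proof (rule cont[OF cf6 R6])
                      show "listing (xss1 @ xss2) (csets E k A (set ss))"
                        unfolding X(1) by (rule listing_append[OF L1 L2 X(2)])
                      define q where "q = k * k"
                      define p where "p = k * card ?X1"
                      have "tbound (Suc (length ?s)) (card ?X1) + tbound (length ?s) (card ?X2) + 3000 * q + 100 * p \<le>
                          tbound (length ss) (card (csets E k A (set ss)))"
                        unfolding N q_def p_def by (rule tbound_branch) (use 5(12) N12 in auto)
                      moreover have "length F \<le> k" using 5(12) by simp
                      moreover have "k \<le> q" "1 \<le> q" using kk by (auto simp: q_def)
                      moreover have "t2 \<le> Suc t1 + tbound (Suc (length ?s)) (card ?X1)"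
                        using t2 by (simp only: length_append_singleton)
                      ultimately show "t6 \<le> t + tbound (length ss) (card (csets E k A (set ss)))"
                        using t6 t5 t4 t3 5(5)[folded q_def] deg[folded p_def] by linarith
                    qed
                    then show "wp enum_com Q R6 M5 ((Z @ concat xss1) @ concat xss2) t6" by simp
                  qed
                qed (use cf4 v r del(2) d3 in auto)
              qed
            qed
          qed (use cf2 v r del(2) in auto)
        qed
      qed
    next
      case (6 R1 M1 t1 qs1 F xss)
      have c1: "cregs (D + 2 * n) R1" by (rule cregs_frame[OF _ 6(1)]) (use c(1) in auto)
      have cf1: "config ord ri G (ss @ F) (T @ forced F) R1 M1"
        using c1 6 c by (auto simp: config_def frameD[OF 6(1)])
      show ?case
      proof (rule enum_com_pop_all[OF cf1 6(2)])
        show "set F \<subseteq> {..<n}" using 6(8) An by auto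
        fix R2 t2 assume cf2: "config ord ri G ss T R2 M1" and R2: "R2 24 = 2" and t2: "t2 \<le> Suc t1 + 25 * length F"
        show "wp enum_com Q R2 M1 (Z @ concat xss) t2"
        proof (rule cont[OF cf2 R2 6(10)])
          let ?N = "card (csets E k A (set ss))"
          define p where "p = k * k * ?N"
          have "k * k \<le> p" using N0 by (simp add: p_def)
          then have "k \<le> p" "1 \<le> p" using kk by linarith+
          moreover have "3000 * p \<le> tbound (length ss) ?N" unfolding p_def by (rule tbound_leaf[OF N0])
          ultimately show "t2 \<le> t + tbound (length ss) ?N"
            using t2 6(5,9) unfolding p_def[symmetric] by linarith
        qed
      qed
    qed (use c less.prems(5) in auto)
  qed
qed

end

section \<open>The whole program\<close>

text \<open>Register 25 is the number \<open>i\<close> of remaining vertices and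
  \<open>ord ! (i - 1)\<close> the root. The loop ends at \<open>i = k - 1\<close>, so every treated
  prefix is connected with at least \<open>k\<close> vertices and its root has a solution.\<close>

definition root_body :: com where
  "root_body =
     Ins (ADD 22 8 25) ;; Ins (SUB 22 22 1) ;; Ins (LOAD 19 22) ;; Ins (STORE 10 19) ;;
     Ins (LOADI 13 1) ;; Ins (LOADI 14 0) ;; Ins (LOADI 24 1) ;; enum_com ;;
     Ins (ADD 22 8 25) ;; Ins (SUB 22 22 1) ;; Ins (LOAD 19 22) ;; walk True ;;
     Ins (SUB 25 25 1) ;; Ins (SUB 30 25 6)"

definition root_com :: com where
  "root_com = Loop 30 root_body"

text \<open>\<open>D = 3 + n + 8 * m\<close> is computed by doubling \<open>m\<close> three times.
  Register 9 first points to the array of the root order, so the finished queue is that order, and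
  is moved behind it afterwards.\<close>

definition bfs_com :: com where
  "bfs_com = Ins (ADD 22 21 21) ;; Ins (ADD 22 22 22) ;; Ins (ADD 22 22 22) ;; Ins (ADD 22 22 4) ;;
     Ins (ADD 7 22 3) ;; Ins (ADD 8 7 4) ;; Ins (ADD 9 8 0) ;; Ins (ADD 10 8 4) ;; Ins (ADD 10 10 4) ;;
     Ins (ADD 11 10 4) ;; Ins (ADD 12 11 4) ;; Ins (STORE 9 0) ;; Ins (STORE 7 1) ;; Ins (LOADI 15 1) ;;
     expand 15 ;; unmarkQ ;; Ins (ADD 9 8 4) ;; Ins (ADD 25 4 0) ;; Ins (SUB 30 25 6)"

text \<open>For \<open>k > n\<close> nothing is printed. The case \<open>k = 1\<close> is separate
  since a root alone would already be a solution, while a node needs fewer than \<open>k\<close>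
  vertices in \<open>T\<close>.\<close>

definition main_com :: com where
  "main_com = Ins (LOADI 1 1) ;; Ins (LOADI 2 2) ;; Ins (LOADI 3 3) ;; Ins (LOAD 4 0) ;; Ins (LOAD 21 1) ;;
     Ins (LOAD 5 2) ;; Ins (SUB 6 5 1) ;; Ins (SUB 22 5 4) ;;
     Cond 22 Skip (Cond 6 (bfs_com ;; root_com) (For 29 4 (Ins (PRINT 29))))"

context gmem
begin

definition deg :: "nat \<Rightarrow> nat" where
  "deg u = card {w. (u, w) \<in> E}"

lemma finite_nb: "finite {w. (u, w) \<in> E}"
  using E_sub by (auto intro: finite_subset[of _ "{..<n}"])

lemma length_adj_le: "repr adj M \<Longrightarrow> u < n \<Longrightarrow> length (adj u) \<le> deg u"
  unfolding deg_def
  using card_mono[OF finite_nb, of "set (adj u)" u] distinct_card[of "adj u"]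
  by (auto simp: repr_def reprv_def)

lemma enum_com_done:
  assumes "R 24 = 2" "R (Suc 0) = 1" "R 14 = 0"
    "Q (R(22 := 1, 24 := 0)) M Z (Suc (Suc (Suc (Suc (Suc (Suc (Suc (Suc (t)))))))))"
  shows "wp enum_com Q R M Z t"
  using assms D_bounds unfolding enum_com_def
  by (subst wp_Loop_unfold) (simp add: pop_com_def wp_Loop_unfold)

lemma tbound_le: "0 < N \<Longrightarrow> tbound s N \<le> 6100 * (k * k * N)"
proof -
  have "k * k * (2 * N - 1) \<le> 2 * (k * k * N)"
    using mult_le_mono2[of "2 * N - 1" "2 * N" "k * k"] by simp
  moreover have "(k - s) * N \<le> k * N" by simp
  then have "k * ((k - s) * N) \<le> k * (k * N)" by (rule mult_le_mono2)
  then have "k * ((k - s) * N) \<le> k * k * N" by (simp add: mult.assoc)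
  ultimately show ?thesis unfolding tbound_def by linarith
qed

lemma wp_rootC:
  assumes k: "2 \<le> k" "k \<le> n" and ord: "distinct ord" "set ord = {..<n}"
    and pre: "\<And>j. 0 < j \<Longrightarrow> j \<le> n \<Longrightarrow> conn E (set (take j ord))"
    and r: "repr adj M" and A: "active {..<n} adj" and c: "cregs (D + 2 * n) R"
    and a: "work (D + 2 * n) {} ord qs ss [] [] M" and R: "R 25 = n" "R 30 = n - (k - 1)"
    and post: "\<And>R' M' t' xss. listing xss (csets E k {..<n} {}) \<Longrightarrow>
      t' \<le> t + 1 + (\<Sum>u<n. 20 * deg u + 100) + 6200 * (k * k * card (csets E k {..<n} {})) \<Longrightarrow>
      Q R' M' (Z @ concat xss) t'"
  shows "wp root_com Q R M Z t"
proof -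
  let ?V = "{..<n}"
  let ?A = "\<lambda>i. set (take i ord)"
  have len: "length ord = n" using distinct_card[OF ord(1)] ord(2) by simp
  define I where "I = (\<lambda>(i, adj, xss) R M Z'. cregs (D + 2 * n) R \<and> k - 1 \<le> i \<and> i \<le> n \<and> R 25 = i \<and>
     R 30 = i - (k - 1) \<and> repr adj M \<and> active (?A i) adj \<and> (\<exists>qs ss. work (D + 2 * n) {} ord qs ss [] [] M) \<and>
     listing xss (csets E k ?V {} - csets E k (?A i) {}) \<and> Z' = Z @ concat xss)"
  \<comment> \<open>Each remaining root holds the budget for its own deletion, in terms of its
    original degree; all these add up to \<open>O(n + m)\<close>. The rest is paid by the solutions
    within the remaining prefix.\<close>
  define f where "f = (\<lambda>(i, adj :: nat \<Rightarrow> nat list, xss :: nat list list).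
     (\<Sum>u\<in>?A i. 20 * deg u + 100) + 6200 * (k * k * card (csets E k (?A i) {})))"
  show ?thesis
    unfolding root_com_def
  proof (rule wp_Loop[where I = I and f = f and g = "(n, adj, [])"])
    have "\<exists>qs ss. work (D + 2 * n) {} ord qs ss [] [] M" using a by blast
    moreover have "take n ord = ord" using len by simp
    ultimately show "I (n, adj, []) R M Z"
      using c R r A k ord(2) by (simp add: I_def listing_def)
  next
    fix g R' M' Z' t' assume I: "I g R' M' Z'" "R' 30 = 0" and t: "t' + f g \<le> t + f (n, adj, []) + 1"
    obtain i adj' xss where g: "g = (i, adj', xss)" by (metis surj_pair)
    have i: "i = k - 1" using I unfolding g I_def by auto
    have "card (?A i) \<le> length (take i ord)" by (rule card_length)
    also have "\<dots> \<le> i" by simp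
    also have "i < k" using i k by linarith
    finally have "card (?A i) < k" .
    then have "csets E k (?A i) {} = {}" by (intro csets_small) auto
    then have L: "listing xss (csets E k ?V {})" "Z' = Z @ concat xss" using I(1) unfolding g I_def by auto
    have "f (n, adj, []) = (\<Sum>u<n. 20 * deg u + 100) + 6200 * (k * k * card (csets E k ?V {}))"
      using len ord(2) by (simp add: f_def)
    then show "Q R' M' Z' t'" unfolding L(2) using t by (intro post[OF L(1)]) linarith
  next
    fix g R1 M1 Z1 t1 P assume I0: "I g R1 M1 Z1" and R30: "R1 30 \<noteq> 0"
      and P: "\<And>g' R' M' Z' t'. I g' R' M' Z' \<Longrightarrow> f g' < f g \<Longrightarrow> t' + 2 + f g' \<le> t1 + f g \<Longrightarrow> P R' M' Z' t'"
    obtain i adj1 xss where g: "g = (i, adj1, xss)" by (metis surj_pair)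
    obtain qs1 ss1 where I: "cregs (D + 2 * n) R1" "i \<le> n" "R1 25 = i" "repr adj1 M1" "active (?A i) adj1"
      "work (D + 2 * n) {} ord qs1 ss1 [] [] M1" "listing xss (csets E k ?V {} - csets E k (?A i) {})" "Z1 = Z @ concat xss"
      and ik: "k \<le> i"
      using I0 R30 unfolding g I_def by auto
    obtain j where j: "i = Suc j" using ik k by (cases i) auto
    let ?v = "ord ! j"
    have jn: "j < n" using I(2) j by simp
    have v: "?v < n" using ord(2) jn len nth_mem[of j ord] by auto
    have Ai: "?A i = insert ?v (?A j)" using j jn len by (simp add: take_Suc_conv_app_nth)
    have vj: "?v \<notin> ?A j" using ord(1) jn len by (auto simp: in_set_conv_nth nth_eq_iff_index_eq)
    have Aj: "?A i - {?v} = ?A j" using Ai vj by auto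
    have cA: "card (?A i) = i" using ord(1) I(2) len distinct_card[of "take i ord"] by simp
    have AV: "?A i \<subseteq> ?V" using ord(2) set_take_subset[of i ord] by simp
    have mo: "M1 (D + n + j) = ?v" using work_nth(2)[OF I(6)] jn len by simp
    let ?M2 = "M1(D + 3 * n := ?v)"
    have "work (D + 2 * n) {} ord qs1 [] [] [] M1"
      using work_prefix[of _ _ _ qs1 "[]" "[]" ss1 "[]" "[]" "[]" "[]"] I(6) by simp
    then have a2: "work (D + 2 * n) {} ord qs1 [?v] [] [] ?M2"
      using work_snoc_s[of "D + 2 * n" "{}" ord qs1 "[]" "[]" "[]" M1 "D + 3 * n" ?v] n0 by simp
    have r2: "repr adj1 ?M2" by (rule repr_cong[OF I(4)]) auto
    have "conn E (?A i)" using pre[of i] I(2) j by simp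
    \<comment> \<open>The prefix itself is the connected set around the root that certifies a
      solution.\<close>
    then have ne: "csets E k (?A i) (set [?v]) \<noteq> {}"
      by (intro csets_nonempty[OF symE, of "?A i"]) (use Ai cA ik k conn_singleton in auto)
    have nd: "node (?A i) adj1 [?v] []"
      using I(2,5) ne k Ai cA by (auto simp: node_def conn_singleton)
    let ?X = "csets E k (?A i) {?v}"
    have split: "csets E k (?A i) {} = ?X \<union> csets E k (?A j) {}" "?X \<inter> csets E k (?A j) {} = {}"
      using csets_split[where E = E and k = k and A = "?A i" and T = "{}" and v = ?v] Aj by auto
    have fin: "finite ?X" "finite (csets E k (?A j) {})" by (simp_all add: finite_csets)
    have N: "card (csets E k (?A i) {}) = card ?X + card (csets E k (?A j) {})"
      unfolding split(1) by (rule card_Un_disjoint[OF fin split(2)])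
    have N0: "0 < card ?X" using ne fin by (simp add: card_gt_0_iff)
    have sub: "csets E k (?A i) {} \<subseteq> csets E k ?V {}" using AV by (auto simp: csets_def)
    note del = active_delete[OF I(5) r2, of ?v]
    have vA: "?v \<in> ?A i" using Ai by simp
    define Q3 where "Q3 = wp (walk True) (wp (Ins (SUB 25 25 1)) (wp (Ins (SUB 30 25 6)) P))"
    define Q2 where "Q2 = wp (Ins (ADD 22 8 25)) (wp (Ins (SUB 22 22 1)) (wp (Ins (LOAD 19 22)) Q3))"
    have fin3: "Q3 R3 M3 (Z1 @ concat xss') t3" if cf: "config ord i ?M2 [?v] [] R3 M3" and R3: "R3 19 = ?v"
      and L: "listing xss' ?X" and t3: "t3 \<le> t1 + 20 + 6100 * (k * k * card ?X)" for R3 M3 t3 xss'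
    proof -
      obtain qs3 where c3: "cregs (D + 2 * n) R3" "\<And>x. x < D \<Longrightarrow> M3 x = ?M2 x"
        "work (D + 2 * n) {} ord qs3 [?v] [] [] M3" "R3 25 = i" using cf by (auto simp: config_def)
      have r3: "repr adj1 M3" by (rule repr_cong[OF r2 c3(2)])
      show ?thesis unfolding Q3_def
      proof (rule wp_delete[OF c3(1) R3 v r3 del(2)[OF vA]])
        fix R4 M4 t4 assume e4: "frame {17, 21, 22, 26, 27, 28} R3 R4" and t4: "t4 \<le> t3 + 5 + 20 * length (adj1 ?v)"
          and d4: "unlinked ?v (adj1 ?v) M3 M4" and h4: "\<And>x. D \<le> x \<Longrightarrow> M4 x = M3 x"
        have c4: "cregs (D + 2 * n) R4" by (rule cregs_frame[OF c3(1) e4]) auto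
        have R4: "R4 25 = Suc j" using c3(4) j by (simp add: frameD[OF e4])
        have "P (R4(25 := j, 30 := j - (k - 1))) M4 (Z1 @ concat xss') (Suc (Suc t4))"
          
        proof (rule P[of "(j, deladj ?v adj1, xss @ xss')"])
          have "listing (xss @ xss') ((csets E k ?V {} - csets E k (?A i) {}) \<union> ?X)"
            by (rule listing_append[OF I(7) L]) (use split in blast)
          moreover have "(csets E k ?V {} - csets E k (?A i) {}) \<union> ?X = csets E k ?V {} - csets E k (?A j) {}"
            using split sub by blast
          moreover have "repr (deladj ?v adj1) M4" by (rule repr_deladj[OF r3 d4 v del(2)[OF vA]])
          moreover have "active (?A j) (deladj ?v adj1)" using del(1)[OF vA] Aj by simp
          ultimately show "I (j, deladj ?v adj1, xss @ xss') (R4(25 := j, 30 := j - (k - 1))) M4 (Z1 @ concat xss')"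
            using c4 ik j jn I(8) work_cong[OF c3(3) h4] unfolding I_def by auto
          have s: "(\<Sum>u\<in>?A i. 20 * deg u + 100) = (20 * deg ?v + 100) + (\<Sum>u\<in>?A j. 20 * deg u + 100)"
            unfolding Ai using vj by simp
          define p p' where "p = k * k * card ?X" and "p' = k * k * card (csets E k (?A j) {})"
          have pp: "k * k * card (csets E k (?A i) {}) = p + p'"
            unfolding N p_def p'_def by (simp add: add_mult_distrib2)
          show "f (j, deladj ?v adj1, xss @ xss') < f g"
            unfolding f_def g split_conv s pp p'_def[symmetric] by simp
          have "length (adj1 ?v) \<le> deg ?v" by (rule length_adj_le[OF I(4) v])
          then show "Suc (Suc t4) + 2 + f (j, deladj ?v adj1, xss @ xss') \<le> t1 + f g"
            unfolding f_def g split_conv s pp p'_def[symmetric] using t4 t3[folded p_def] by simp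
        qed
        moreover have "j - (k - 1) \<le> B" "j \<le> B" using jn D_bounds by auto
        ultimately show "wp (Ins (SUB 25 25 1)) (wp (Ins (SUB 30 25 6)) P) R4 M4 (Z1 @ concat xss') t4"
          using R4 by (simp add: cregsD[OF c4])
      qed
    qed
    have mid: "Q2 R3 M3 (Z1 @ concat xss') t3" if cf: "config ord i ?M2 [?v] [] R3 M3"
      and L: "listing xss' ?X" and t3: "t3 \<le> t1 + 17 + 6100 * (k * k * card ?X)" for R3 M3 t3 xss'
    proof -
      obtain qs3 where c3: "cregs (D + 2 * n) R3" "R3 25 = i" "work (D + 2 * n) {} ord qs3 [?v] [] [] M3"
        using cf by (auto simp: config_def)
      have "M3 (D + n + j) = ?v" using work_nth(2)[OF c3(3)] jn len by simp
      moreover have "Q3 (R3(22 := D + n + j, 19 := ?v)) M3 (Z1 @ concat xss') (Suc (Suc (Suc t3)))"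
        by (rule fin3[OF _ _ L]) (use cf t3 in auto)
      ultimately show ?thesis using c3(2) j jn v D_bounds
        by (simp add: Q2_def cregsD[OF c3(1)])
    qed
    let ?R2 = "R1(22 := D + n + j, 19 := ?v, 13 := 1, 14 := 0, 24 := 1)"
    have "wp enum_com Q2 ?R2 ?M2 Z1 (Suc (Suc (Suc (Suc (Suc (Suc (Suc (t1))))))))"
    proof (rule wp_enumC[OF k(1) nd r2])
      show "config ord i ?M2 [?v] [] ?R2 ?M2" using I(1,3) a2 by (auto simp: config_def)
      fix R3 M3 t3 xss' assume cf: "config ord i ?M2 [?v] [] R3 M3" and R3: "R3 24 = 2"
        and L: "listing xss' (csets E k (?A i) (set [?v]))"
        and t3: "t3 \<le> Suc (Suc (Suc (Suc (Suc (Suc (Suc (t1))))))) + tbound (length [?v]) (card (csets E k (?A i) (set [?v])))"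
      show "wp enum_com Q2 R3 M3 (Z1 @ concat xss') t3"
      proof (rule enum_com_done)
        show "R3 24 = 2" "R3 (Suc 0) = 1" "R3 14 = 0" using R3 cf by (auto simp: config_def cregs_def)
        show "Q2 (R3(22 := 1, 24 := 0)) M3 (Z1 @ concat xss') (Suc (Suc (Suc (Suc (Suc (Suc (Suc (Suc (t3)))))))))"
          by (rule mid) (use cf L t3 tbound_le[OF N0, of 1] in auto)
      qed
    qed simp
    then show "wp root_body P R1 M1 Z1 t1"
      unfolding root_body_def wp.simps(3) Q3_def[symmetric] Q2_def[symmetric]
      using I(3) j jn v mo D_bounds by (simp add: cregsD[OF I(1)])
  qed
qed

end

context gmem
begin

lemma wp_bfsC:
  assumes k: "2 \<le> k" and cV: "conn E {..<n}"
    and r: "repr adj M" and A: "active {..<n} adj" and z: "\<And>x. D \<le> x \<Longrightarrow> M x = 0"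
    and R: "R 0 = 0" "R (Suc 0) = 1" "R 2 = 2" "R 3 = 3" "R 4 = n" "R 5 = k" "R 6 = k - 1" "R 21 = m"
      "R 16 = 0" "R 17 = 0"
    and post: "\<And>R' M' t' ord. cregs (D + 2 * n) R' \<Longrightarrow> distinct ord \<Longrightarrow> set ord = {..<n} \<Longrightarrow>
      (\<And>j. 0 < j \<Longrightarrow> j \<le> n \<Longrightarrow> conn E (set (take j ord))) \<Longrightarrow> repr adj M' \<Longrightarrow>
      work (D + 2 * n) {} ord [] [] [] [] M' \<Longrightarrow> R' 25 = n \<Longrightarrow> R' 30 = n - (k - 1) \<Longrightarrow>
      t' \<le> t + 60 + 20 * (\<Sum>u<n. length (adj u) + 2) + 8 * n \<Longrightarrow> Q R' M' Z t'"
  shows "wp bfs_com Q R M Z t"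
proof -
  let ?M1 = "M(D + n := 0, D := Suc 0)"
  define Q1 where "Q1 = wp (expand 15) (wp unmarkQ (wp (Ins (ADD 9 8 4)) (wp (Ins (ADD 25 4 0)) (wp (Ins (SUB 30 25 6)) Q))))"
  have a0: "work (D + n) {} [] [] [] [] [] M" using z by (simp add: work_def)
  have a1: "work (D + n) (set [0]) [] [0] [] [] [] ?M1"
    using work_mark[OF work_snoc_q[OF a0, of "D + n" 0], of 0] n0 by simp
  have r1: "repr adj ?M1" by (rule repr_cong[OF r]) auto
  have main: "Q1 R1 ?M1 Z t1" if c1: "cregs (D + n) R1" and R1: "R1 15 = 1" "R1 16 = 0" "R1 17 = 0"
    and t1: "t1 \<le> t + 14" for R1 t1
    unfolding Q1_def
  proof (rule wp_expand[OF c1 _ A r1 a1 _ _ _ R1(2,3) refl], goal_cases)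
    case (5 R2 M2 t2 Q1 cur)
    note X = 5(6)[simplified, unfolded expanded_def]
    have c2: "cregs (D + n) R2" by (rule cregs_frame[OF c1 5(1)]) auto
    have QV: "distinct Q1" "set Q1 \<subseteq> {..<n}" using X by auto
    have adjV: "u < n \<Longrightarrow> set (adj u) = {w. w < n \<and> (u, w) \<in> E}" for u using A by (auto simp: active_def)
    obtain xs where xs: "Q1 = 0 # xs" using X by auto
    have cl: "set (adj u) \<subseteq> set Q1" if "u \<in> set Q1" for u
    proof -
      have "\<forall>u \<in> set (take (length Q1) Q1). set (adj u) \<subseteq> set Q1 \<union> (if u = cur then set [] else {})"
        using X by (elim conjE)
      then show ?thesis using that by (auto split: if_splits)
    qed
    have "{..<n} \<subseteq> set Q1"
    proof (rule conn_closed[OF cV, of 0])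
      show "w \<in> set Q1" if "u \<in> set Q1" "u \<in> {..<n}" "w \<in> {..<n}" "(u, w) \<in> E" for u w
        using cl[OF that(1)] adjV[of u] that by auto
    qed (use xs n0 in auto)
    then have sQ: "set Q1 = {..<n}" using QV by blast
    have len: "length Q1 = n" using distinct_card[OF QV(1)] sQ by simp
    have pre: "conn E (set (take j Q1))" if "0 < j" "j \<le> n" for j
    proof (rule conn_prefix[OF symE])
      fix l assume l: "0 < l" "l < length Q1"
      have "\<forall>l. length [0 :: nat] \<le> l \<longrightarrow> l < length Q1 \<longrightarrow> (\<exists>l' < l. l' < length Q1 \<and> Q1 ! l \<in> set (adj (Q1 ! l')))"
        using X by (elim conjE)
      then obtain l' where l': "l' < l" "Q1 ! l \<in> set (adj (Q1 ! l'))" using l by (auto simp: Suc_le_eq)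
      have "Q1 ! l' < n" using sQ nth_mem[of l' Q1] l l' by auto
      then show "\<exists>l'<l. (Q1 ! l', Q1 ! l) \<in> E" using l' adjV by auto
    qed (use that len in auto)
    show ?case
    proof (rule wp_unmarkQ[OF c2 5(2,4) QV(2)])
      fix R3 M3 t3 assume e3: "frame {16, 21, 22, 31} R2 R3" and t3: "t3 \<le> t2 + 3 + 8 * length Q1"
        and a3: "work (D + n) (set Q1 - set Q1) [] Q1 [] [] [] M3" and l3: "\<And>x. x < D \<Longrightarrow> M3 x = M2 x"
      have c3: "cregs (D + n) R3" by (rule cregs_frame[OF c2 e3]) auto
      let ?R = "R3(9 := D + 2 * n, 25 := n, 30 := n - (k - 1))"
      have "Q ?R M3 Z (Suc (Suc (Suc t3)))"
      proof (rule post[where ord = Q1])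
        show "cregs (D + 2 * n) ?R" using c3 by (auto simp: cregs_def)
        show "repr adj M3" by (rule repr_cong[OF r1]) (use l3 5(5) in simp)
        show "work (D + 2 * n) {} Q1 [] [] [] [] M3" using a3 len by (auto simp: work_def)
        show "Suc (Suc (Suc t3)) \<le> t + 60 + 20 * (\<Sum>u<n. length (adj u) + 2) + 8 * n"
          using 5(3) t1 t3 len by simp
      qed (use QV sQ pre in auto)
      moreover have "D + 2 * n = D + n + n" by simp
      moreover have "n \<le> B" "D + n + n \<le> B" "n - (k - 1) \<le> B" using D_bounds by auto
      ultimately show "wp (Ins (ADD 9 8 4)) (wp (Ins (ADD 25 4 0)) (wp (Ins (SUB 30 25 6)) Q)) R3 M3 Z t3"
        by (simp add: cregsD[OF c3])
    qed
  qed (use R1 n0 in auto)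
  let ?R1 = "R(22 := m + m + (m + m) + (m + m + (m + m)) + n, 7 := D, 8 := D + n, 9 := D + n, 10 := D + n + n + n,
    11 := D + n + n + n + n, 12 := D + n + n + n + n + n, 15 := 1)"
  have "Q1 ?R1 ?M1 Z (Suc (Suc (Suc (Suc (Suc (Suc (Suc (Suc (Suc (Suc (Suc (Suc (Suc (Suc t))))))))))))))"
    by (rule main) (use R in \<open>auto simp: cregs_def\<close>)
  moreover have "m + m + (m + m) + (m + m + (m + m)) + n + 3 = D" by (simp add: D_def)
  moreover have "m + m + (m + m) + (m + m + (m + m)) + n \<le> B" "D + n + n + n \<le> B" "D + 5 * n \<le> B" "D + n < S"
    using D_bounds n0 by (auto simp: D_def)
  ultimately show ?thesis
    using R D_bounds unfolding bfs_com_def wp.simps(3) Q1_def[symmetric]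
    by simp
qed

theorem wp_mainC:
  assumes k: "0 < k" and cV: "conn E {..<n}"
    and r: "repr adj M" and A: "active {..<n} adj" and z: "\<And>x. D \<le> x \<Longrightarrow> M x = 0"
    and M: "M 0 = n" "M 1 = m" "M 2 = k"
    and post: "\<And>R' M' t' xss. listing xss (csets E k {..<n} {}) \<Longrightarrow>
      t' \<le> 10000 * (n + (\<Sum>u<n. deg u) + k * k * card (csets E k {..<n} {})) \<Longrightarrow> Q R' M' (concat xss) t'"
  shows "wp main_com Q (\<lambda>_. 0) M [] 0"
proof -
  let ?R = "(\<lambda>_. 0)(1 := 1, 2 := 2, 3 := 3, 4 := n, 21 := m, 5 := k, 6 := k - 1, 22 := k - n) :: nat \<Rightarrow> nat"
  define C where "C = (Cond 22 Skip (Cond 6 (bfs_com ;; root_com) (For 29 4 (Ins (PRINT 29)))))"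
  let ?N = "card (csets E k {..<n} {})"
  have kB: "k \<le> B" "k - x \<le> B" for x using B_big by auto
  have "wp C Q ?R M [] 8"
  proof (cases "k \<le> n")
    case False
    have "csets E k {..<n} {} = {}" by (rule csets_small) (use False in auto)
    then have "Q ?R M (concat []) 10" by (intro post) (use n0 in \<open>auto simp: listing_def\<close>)
    then show ?thesis using False by (simp add: C_def)
  next
    case kn: True
    show ?thesis
    proof (cases "k = 1")
      case True
      have cs: "csets E k {..<n} {} = (\<lambda>v. {v}) ` {..<n}"
        using True conn_singleton by (auto simp: csets_def card_1_singleton_iff)
      have L: "listing (map (\<lambda>v. [v]) [0..<n]) (csets E k {..<n} {})"
        unfolding cs by (auto simp: listing_def distinct_map inj_on_def)
      have cc: "concat (map (\<lambda>v. [v]) [0..<n]) = [0..<n]" by (induction n) auto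
      have "wp (For 29 4 (Ins (PRINT 29))) Q ?R M [] 10"
      proof (rule wp_For[where L = n and d = 1 and J = "\<lambda>x R M Z. Z = [0..<x]"])
        fix R' M' Z' t' assume "Z' = [0..<n]" "t' \<le> 10 + 3 + (1 + 4) * n"
        then show "Q R' M' Z' t'" using post[OF L, of t' R' M'] cc n0 by simp
      qed (use D_bounds in auto)
      then show ?thesis using True kn by (simp add: C_def)
    next
      case False
      then have k2: "2 \<le> k" using k by simp
      have "wp bfs_com (wp root_com (\<lambda>R M Z t. Q R M Z (t + 1))) ?R M [] 10"
      proof (rule wp_bfsC[OF k2 cV r A z], goal_cases)
        case (12 R1 M1 t1 ord)
        show ?case
        proof (rule wp_rootC[OF k2 kn 12(2,3,4,5) A 12(1,6,7,8)])
          fix R2 M2 t2 xss assume L: "listing xss (csets E k {..<n} {})"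
            and t2: "t2 \<le> t1 + 1 + (\<Sum>u<n. 20 * deg u + 100) + 6200 * (k * k * ?N)"
          have "(\<Sum>u<n. length (adj u) + 2) \<le> (\<Sum>u<n. deg u + 2)"
            by (intro sum_mono) (use length_adj_le[OF r] in auto)
          moreover define d where "d = (\<Sum>u<n. deg u)"
          moreover define p where "p = k * k * ?N"
          moreover have "(\<Sum>u<n. deg u + 2) = d + 2 * n" "(\<Sum>u<n. 20 * deg u + 100) = 20 * d + 100 * n"
            unfolding d_def sum.distrib sum_distrib_left[symmetric] by simp_all
          ultimately have "t2 + 1 \<le> 10000 * (n + d + p)"
            using t2 12(9) n0 by simp
          then have "Q R2 M2 (concat xss) (t2 + 1)"
            unfolding d_def p_def by (rule post[OF L])
          then show "Q R2 M2 ([] @ concat xss) (t2 + 1)" by simp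
        qed auto
      qed auto
      then show ?thesis using kn False k k2 by (simp add: C_def)
    qed
  qed
  moreover have "n < S" "n \<le> B" "m \<le> B" "2 < S" "3 \<le> B" using D_bounds n0 by (auto simp: D_def)
  ultimately show ?thesis
    using M kB unfolding main_com_def C_def[symmetric] by (simp add: eval_nat_numeral)
qed

end

section \<open>From connected digraphs to cuts, and from graphlets to vertex sets\<close>

lemma connected_iff_conn:
  assumes "pair_graph G" "induced_subgraph H (with_proj G)"
  shows "Digraph_Component.connected H \<longleftrightarrow> conn (parcs G) (verts H)"
proof -
  interpret pair_graph G by fact
  let ?V = "verts H" and ?E = "{e \<in> parcs G. fst e \<in> verts H \<and> snd e \<in> verts H}"
  have H: "arcs H = ?E" "tail H = fst" "head H = snd"
    using assms(2) by (auto simp: induced_subgraph_def subgraph_def compatible_def)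
  have sym: "(v, u) \<in> parcs G" if "(u, v) \<in> parcs G" for u v
    using that arcs_symmetric by blast
  \<comment> \<open>Both directions of every edge are arcs, so symmetrising adds nothing and
    reachability can be taken in \<open>H\<close> itself.\<close>
  have "parcs (mk_symmetric H) = ?E"
    unfolding parcs_mk_symmetric H using sym by fastforce
  then have "Digraph_Component.connected H \<longleftrightarrow> ?V \<noteq> {} \<and> (\<forall>u\<in>?V. \<forall>v\<in>?V. (u, v) \<in> rtrancl_on ?V ?E)"
    by (simp add: Digraph_Component.connected_def strongly_connected_def reachable_def)
  also have "\<dots> \<longleftrightarrow> conn (parcs G) ?V"
  proof
    assume A: "?V \<noteq> {} \<and> (\<forall>u\<in>?V. \<forall>v\<in>?V. (u, v) \<in> rtrancl_on ?V ?E)"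
    show "conn (parcs G) ?V"
      unfolding conn_def
    proof (intro conjI allI impI)
      fix U assume U: "U \<subseteq> ?V" "U \<noteq> {}" "\<forall>x\<in>U. \<forall>y\<in>?V. (x, y) \<in> parcs G \<longrightarrow> y \<in> U"
      obtain x where x: "x \<in> U" using U by blast
      have "y \<in> U" if "(x, y) \<in> rtrancl_on ?V ?E" for y
        using that by (induction rule: rtrancl_on_induct) (use x U in auto)
      then show "U = ?V" using A U x by blast
    qed (use A in auto)
  next
    assume A: "conn (parcs G) ?V"
    have "?V \<subseteq> {v. (u, v) \<in> rtrancl_on ?V ?E}" if "u \<in> ?V" for u
    proof (rule conn_closed[OF A that])
      fix v w assume "v \<in> {v. (u, v) \<in> rtrancl_on ?V ?E}" "v \<in> ?V" "w \<in> ?V" "(v, w) \<in> parcs G"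
      then show "w \<in> {v. (u, v) \<in> rtrancl_on ?V ?E}"
        using rtrancl_on_into_rtrancl_on[of u v ?V ?E w] by simp
    qed (use that in simp)
    then show "?V \<noteq> {} \<and> (\<forall>u\<in>?V. \<forall>v\<in>?V. (u, v) \<in> rtrancl_on ?V ?E)"
      using A by (auto simp: conn_def)
  qed
  finally show ?thesis .
qed

text \<open>An induced subgraph is determined by its vertex set; so \<open>N\<close> counts the
  connected vertex sets of size \<open>k\<close>.\<close>

lemma verts_graphlets:
  assumes "pair_graph G"
  shows "verts ` graphlets (with_proj G) k = csets (parcs G) k (pverts G) {}"
    and "inj_on verts (graphlets (with_proj G) k)"
proof -
  interpret pair_graph G by fact
  show "verts ` graphlets (with_proj G) k = csets (parcs G) k (pverts G) {}"
  proof (intro equalityI subsetI)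
    fix X assume "X \<in> verts ` graphlets (with_proj G) k"
    then show "X \<in> csets (parcs G) k (pverts G) {}"
      using connected_iff_conn[OF assms]
      by (auto simp: graphlets_def csets_def induced_subgraph_def subgraph_def)
  next
    fix X assume X: "X \<in> csets (parcs G) k (pverts G) {}"
    let ?H = "with_proj G \<restriction> X"
    have H: "induced_subgraph ?H (with_proj G)" using X by (intro induced_induce) (auto simp: csets_def)
    then have "?H \<in> graphlets (with_proj G) k"
      using X connected_iff_conn[OF assms H] by (simp add: graphlets_def csets_def)
    moreover have "X = verts ?H" by simp
    ultimately show "X \<in> verts ` graphlets (with_proj G) k" by (rule rev_image_eqI)
  qed
  show "inj_on verts (graphlets (with_proj G) k)"
    by (intro inj_onI pre_digraph.equality)
      (auto simp: graphlets_def induced_subgraph_def subgraph_def compatible_def)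
qed

lemma (in gmem) dlseg_nth:
  assumes "\<And>i. i < length xs \<Longrightarrow> M (ad u (xs ! i)) = xs ! i \<and>
      M (ad u (xs ! i) + 1) = (if i + 1 < length xs then ad u (xs ! (i + 1)) else 0) \<and>
      M (ad u (xs ! i) + 2) = (if i > 0 then ad u (xs ! (i - 1)) else 0) \<and>
      M (ad u (xs ! i) + 3) = ad (xs ! i) u"
  shows "dlseg M u 0 xs 0"
proof -
  have "dlseg M u (if j = 0 then 0 else ad u (xs ! (j - 1))) (drop j xs) 0" for j
  proof (induction "length xs - j" arbitrary: j)
    case (Suc d)
    then have j: "j < length xs" by simp
    have "nxt u 0 (drop (Suc j) xs) = (if j + 1 < length xs then ad u (xs ! (j + 1)) else 0)"
      using Cons_nth_drop_Suc[of "Suc j" xs, symmetric] by auto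
    moreover have "dlseg M u (ad u (xs ! j)) (drop (Suc j) xs) 0" using Suc.hyps(1)[of "Suc j"] Suc.hyps(2) by simp
    moreover have "drop j xs = xs ! j # drop (Suc j) xs" using j by (simp add: Cons_nth_drop_Suc)
    ultimately show ?case using assms[OF j] by auto
  qed simp
  from this[of 0] show ?thesis by simp
qed

text \<open>Meant for \<open>x = n + m + k\<close>, which is at least 2. The exponent 6 is the least
  possible at \<open>x = 2\<close>, where the left side is 50.\<close>

lemma word_bound:
  assumes "2 \<le> (x :: nat)"
  shows "20 * x + 10 \<le> x ^ 6"
proof -
  have "2 ^ 5 \<le> x ^ 5" using assms by (rule power_mono) simp
  then have "32 * x \<le> x ^ 6" using mult_le_mono1[of 32 "x ^ 5" x] by (simp add: power_eq_if mult.commute)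
  then show ?thesis using assms by linarith
qed

theorem theorem6:
  shows "\<exists>(P :: instr list) (c_time :: nat) (c_space :: nat) (c_word :: nat).
    \<forall>(G :: nat pair_pre_digraph) (n :: nat) (m :: nat) (k :: nat) (N :: nat) (M :: nat \<Rightarrow> nat).
      pair_graph G \<and> Digraph_Component.connected (with_proj G) \<and> pverts G = {..<n} \<and>
      m = card (uedges G) \<and> k > 0 \<and> N = card (graphlets (with_proj G) k) \<and>
      adjacency_list_input G k M
      \<longrightarrow> (\<exists>t s. (ram_step (c_space * (n + m)) ((n + m + k) ^ c_word) P ^^ t) (initial M) s \<and>
                 halted P s \<and>
                 t \<le> c_time * (n + m + k\<^sup>2 * N) \<and>
                 lists_graphlets (with_proj G) k (out s))"
proof (rule exI[of _ "compile 0 main_com @ [HALT]"], rule exI[of _ 20000], rule exI[of _ 20], rule exI[of _ 6],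
    intro allI impI, elim conjE)
  fix G :: "nat pair_pre_digraph" and n m k N :: nat and M :: "nat \<Rightarrow> nat"
  let ?P = "compile 0 main_com @ [HALT]" and ?S = "20 * (n + m)" and ?B = "(n + m + k) ^ 6"
  assume G: "pair_graph G" and con: "Digraph_Component.connected (with_proj G)" and V: "pverts G = {..<n}"
    and m: "m = card (uedges G)" and k: "0 < k" and N: "N = card (graphlets (with_proj G) k)"
    and inp: "adjacency_list_input G k M"
  interpret pair_graph G by fact
  let ?E = "parcs G"
  have cn: "card (pverts G) = n" using V by simp
  note inp' = inp[unfolded adjacency_list_input_def Let_def cn m[symmetric]]
  note M = inp'[THEN conjunct1] inp'[THEN conjunct2, THEN conjunct1]
    inp'[THEN conjunct2, THEN conjunct2, THEN conjunct1]
  have zero: "\<And>a. 3 + n + 8 * m \<le> a \<Longrightarrow> M a = 0" using inp' by (elim conjE) simp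
  from inp'[THEN conjunct2, THEN conjunct2, THEN conjunct2, THEN conjunct1]
  obtain adj addr where bij: "bij_betw addr ?E {3 + n + 4 * i | i. i < 2 * m}" and
    listing: "\<forall>v \<in> pverts G. distinct (adj v) \<and> set (adj v) = {w. (v, w) \<in> ?E} \<and>
      M (3 + v) = (if adj v = [] then 0 else addr (v, adj v ! 0)) \<and>
      (\<forall>i < length (adj v). M (addr (v, adj v ! i)) = adj v ! i \<and>
      M (addr (v, adj v ! i) + 1) = (if i + 1 < length (adj v) then addr (v, adj v ! (i + 1)) else 0) \<and>
      M (addr (v, adj v ! i) + 2) = (if i > 0 then addr (v, adj v ! (i - 1)) else 0) \<and>
      M (addr (v, adj v ! i) + 3) = addr (adj v ! i, v))"
    by (elim exE conjE)
  have adj: "distinct (adj v)" "set (adj v) = {w. (v, w) \<in> ?E}"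
      "M (3 + v) = (if adj v = [] then 0 else addr (v, adj v ! 0))" and
    nodes: "\<And>i. i < length (adj v) \<Longrightarrow> M (addr (v, adj v ! i)) = adj v ! i \<and>
      M (addr (v, adj v ! i) + 1) = (if i + 1 < length (adj v) then addr (v, adj v ! (i + 1)) else 0) \<and>
      M (addr (v, adj v ! i) + 2) = (if i > 0 then addr (v, adj v ! (i - 1)) else 0) \<and>
      M (addr (v, adj v ! i) + 3) = addr (adj v ! i, v)" if "v < n" for v
    using bspec[OF listing, of v] that V by auto
  have cV: "conn ?E {..<n}"
    using connected_iff_conn[OF G, of "with_proj G"] con V induced_subgraph_refl by simp
  then have n0: "0 < n" by (auto simp: conn_def)
  have B: "20 * (n + m + k) + 10 \<le> ?B" by (rule word_bound) (use n0 k in linarith)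
  \<comment> \<open>Since \<open>n\<close> is positive, \<open>20 * (n + m)\<close> covers the
    \<open>3 + n + 8 * m\<close> words of the input and the six arrays.\<close>
  interpret g: gmem ?S ?B n m k ?E "\<lambda>u w. addr (u, w)"
  proof
    show "sym ?E" using arcs_symmetric by (auto intro: symI)
    show "?E \<subseteq> {..<n} \<times> {..<n}" using wellformed V by fastforce
    show "(v, v) \<notin> ?E" for v using no_loops by fastforce
    show "\<exists>i<2 * m. addr (u, w) = 3 + n + 4 * i" if "(u, w) \<in> ?E" for u w
      using bij_betw_apply[OF bij that] by auto
    show "u = u' \<and> w = w'" if "(u, w) \<in> ?E" "(u', w') \<in> ?E" "addr (u, w) = addr (u', w')" for u w u' w'
      using inj_onD[OF bij_betw_imp_inj_on[OF bij] that(3,1,2)] by simp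
  qed (use n0 B in auto)
  have repr: "g.repr adj M"
    unfolding g.repr_def g.reprv_def
  proof (intro allI impI conjI)
    fix u assume u: "u < n"
    show "M (3 + u) = g.nxt u 0 (adj u)" using adj(3)[OF u] by (cases "adj u") auto
    show "g.dlseg M u 0 (adj u) 0" by (rule g.dlseg_nth[OF nodes[OF u]])
  qed (use adj in auto)
  have active: "g.active {..<n} adj"
    using adj(2) g.E_sub by (auto simp: g.active_def)
  have cards: "card (csets ?E k {..<n} {}) = N"
    unfolding N using verts_graphlets[OF G, of k] V card_image by metis
  \<comment> \<open>The addresses of the nodes count the arcs, so the degrees sum to
    \<open>2 * m\<close>; hence the time constant is twice that of \<open>wp_mainC\<close>.\<close>
  have "card ?E = card {3 + n + 4 * i | i. i < 2 * m}" by (rule bij_betw_same_card[OF bij])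
  also have "{3 + n + 4 * i | i. i < 2 * m} = (\<lambda>i. 3 + n + 4 * i) ` {..<2 * m}" by auto
  also have "card \<dots> = 2 * m" by (subst card_image) (auto simp: inj_on_def)
  finally have "card ?E = 2 * m" .
  moreover have "?E = Sigma {..<n} (\<lambda>u. {w. (u, w) \<in> ?E})" using g.E_sub by auto
  then have "card ?E = (\<Sum>u<n. g.deg u)"
    unfolding g.deg_def using g.finite_nb by (metis card_SigmaI finite_lessThan)
  ultimately have deg: "(\<Sum>u<n. g.deg u) = 2 * m" by simp
  define Q where "Q = (\<lambda>(R :: nat \<Rightarrow> nat) (M :: nat \<Rightarrow> nat) Z t. t \<le> 20000 * (n + m + k\<^sup>2 * N) \<and> lists_graphlets (with_proj G) k Z)"
  have "g.wp main_com Q (\<lambda>_. 0) M [] 0"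
  proof (rule g.wp_mainC[OF k cV repr active _ M])
    show "M x = 0" if "g.D \<le> x" for x using zero that by (simp add: g.D_def)
    fix R' M' t' xss assume L: "g.listing xss (csets ?E k {..<n} {})"
      and t: "t' \<le> 10000 * (n + (\<Sum>u<n. g.deg u) + k * k * card (csets ?E k {..<n} {}))"
    have "lists_graphlets (with_proj G) k (concat xss)"
      using L verts_graphlets(1)[OF G, of k] V unfolding g.listing_def lists_graphlets_def by auto
    moreover have "t' \<le> 20000 * (n + m + k\<^sup>2 * N)"
      using t unfolding deg cards power2_eq_square by simp
    ultimately show "Q R' M' (concat xss) t'" by (simp add: Q_def)
  qed
  moreover have "code_at ?P 0 (compile 0 main_com)" by (auto simp: code_at_def)
  ultimately obtain u R' M' Z' where
    "g.runs ?P u (g.conf 0 (\<lambda>_. 0) M []) (g.conf (0 + clen main_com) R' M' Z')" "Q R' M' Z' (0 + u)"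
    using g.wp_sound[of ?P 0 main_com "\<lambda>_. 0" Q M "[]" 0] by auto
  then show "\<exists>t s. (ram_step ?S ?B ?P ^^ t) (initial M) s \<and> halted ?P s \<and>
      t \<le> 20000 * (n + m + k\<^sup>2 * N) \<and> lists_graphlets (with_proj G) k (out s)"
    by (intro exI[of _ u] exI[of _ "g.conf (clen main_com) R' M' Z'"])
      (auto simp: initial_def halted_def Q_def nth_append)
qed

end
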